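(* Let $\mathbb{V}=\mathbb{R}[1,1]\oplus\mathbb{R}[2,0]$, i.e. $\mathbb{R}^4$ with the orthogonal $S^1$-action in which $e^{i\phi}$ rotates $(x_1,x_2)$ by the angle $\phi$ and fixes $x_3,x_4$. Let $U\colon\mathbb{V}\to\mathbb{R}$ be $$U(x_1,x_2,x_3,x_4)=-x_3(x_1^2+x_2^2)+\tfrac13x_3^3+\tfrac12(x_4-x_3)^2 .$$ Then: (i) $(U')^{-1}(0)=\{0\}$; (ii) $\sigma(U''(0))=\{0,2\}$; (iii) $\deg_{\mathrm{B}}(-U',B_1(0,\mathbb{V}),0)=0\in\mathbb{Z}$, where $\deg_{\mathrm{B}}$ is the Brouwer degree; (iv) $\deg^\nabla_{S^1}(-U',B_1(0,\mathbb{V}))=\chi_{S^1}(S^1/\mathbb{Z}_1^+)\neq\Theta\in U(S^1)$.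
   Context: $U'$ and $U''$ are the gradient and Hessian of $U$, $\sigma$ the spectrum, $B_1(0,\mathbb{V})$ the open unit ball. $U(S^1)$ (the Euler ring of $S^1$) is, as a $\mathbb{Z}$-module, free with basis $\chi_{S^1}(S^1/H^+)$, $H$ running over the closed subgroups $S^1,\mathbb{Z}_1,\mathbb{Z}_2,\dots$ of $S^1$ ($\mathbb{Z}_1$ is the trivial subgroup); $\Theta$ is its zero element. Degree for equivariant gradient maps (Gęba), for $G=S^1$. Let $\mathbb{V}$ be a finite-dimensional orthogonal $G$-representation, $D\subset\mathbb{V}$ open, bounded, $G$-invariant, and $\varphi$ a $G$-invariant $C^1$ function on a $G$-invariant neighbourhood of $\mathrm{cl}(D)$ with $(\nabla\varphi)^{-1}(0)\cap\partial D=\emptyset$ ($D$-admissible). Such a $\varphi$ is generic if $(\nabla\varphi)^{-1}(0)\cap D$ is a finite union of orbits $G(x_1),\dots,G(x_p)$, $\varphi$ is $C^2$ near them, $\dim\ker\nabla^2\varphi(x_i)=\dim G(x_i)$ for each $i$, and for each $i$, with $H=G_{x_i}$ the isotropy group and $\mathbb{V}^H$ its fixed-point space, $\nabla\varphi(y+v)=\nabla\varphi(y)+v$ for all $y\in\mathbb{V}^H$ near $G(x_i)$ and all sufficiently small $v\in(\mathbb{V}^H)^\perp$. For generic $\varphi$, $$\deg^\nabla_G(\nabla\varphi,D)=\sum_{i=1}^p(-1)^{m^-(\nabla^2\varphi(x_i))}\chi_G(G/G_{x_i}^+)\in U(G),$$ where $m^-$ is the Morse index (number of negative eigenvalues counted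 with multiplicity). For an arbitrary admissible $\varphi$, $\deg^\nabla_G(\nabla\varphi,D)$ is defined as the degree of any generic $\psi$ joined to $\varphi$ by a continuous family of $G$-invariant, $D$-admissible $C^1$ functions with gradient depending continuously on all variables; such $\psi$ exists and the result does not depend on the choice. Here the degree is applied to $\varphi=-U$. *)

theory Defs
  imports "HOL-Analysis.Analysis" "HOL-Algebra.Group_Action" "HOL-Library.Poly_Mapping"
begin

section \<open>Gradient, Hessian, spectrum, Morse index\<close>

definition grad :: "('a::real_inner \<Rightarrow> real) \<Rightarrow> 'a \<Rightarrow> 'a"
  where "grad \<phi> x = (THE g. GDERIV \<phi> x :> g)"

definition hessian :: "('a::real_inner \<Rightarrow> real) \<Rightarrow> 'a \<Rightarrow> 'a \<Rightarrow> 'a"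
  where "hessian \<phi> x = frechet_derivative (grad \<phi>) (at x)"

text \<open>The spectrum is taken over the reals; it is only applied to Hessians, which are symmetric.\<close>

definition spectrum :: "('a::euclidean_space \<Rightarrow> 'a) \<Rightarrow> real set"
  where "spectrum A = {\<mu>. \<not> bij (\<lambda>v. A v - \<mu> *\<^sub>R v)}"

text \<open>For a symmetric operator the multiplicity of an eigenvalue is the dimension of its
  eigenspace.\<close>

definition morse_index :: "('a::euclidean_space \<Rightarrow> 'a) \<Rightarrow> nat"
  where "morse_index A = (\<Sum>\<mu> | \<mu> \<in> spectrum A \<and> \<mu> < 0. dim {v. A v = \<mu> *\<^sub>R v})"

text \<open>Only applied to open sets \<open>S\<close>.\<close>

definition C1_on :: "'a::real_normed_vector set \<Rightarrow> ('a \<Rightarrow> 'b::real_normed_vector) \<Rightarrow> bool"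
  where "C1_on S f \<longleftrightarrow> (\<exists>f'. (\<forall>x\<in>S. (f has_derivative blinfun_apply (f' x)) (at x))
    \<and> continuous_on S f')"

definition C2_on :: "'a::real_normed_vector set \<Rightarrow> ('a \<Rightarrow> 'b::real_normed_vector) \<Rightarrow> bool"
  where "C2_on S f \<longleftrightarrow> (\<exists>f'. (\<forall>x\<in>S. (f has_derivative blinfun_apply (f' x)) (at x))
    \<and> C1_on S f')"

section \<open>Brouwer degree\<close>

text \<open>The analytic definition: \<open>deg(f, D, y)\<close>, for \<open>D\<close> open and bounded, \<open>f\<close> continuous on the
  closure of \<open>D\<close> and \<open>y \<notin> f(\<partial>D)\<close>, is the sum of the signs of the Jacobian determinants over
  \<open>g\<^sup>-\<^sup>1(y)\<close>, where \<open>g\<close> is any \<open>C\<^sup>2\<close> map having \<open>y\<close> as a regular value and whose distance from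
  \<open>f\<close> is less than that of \<open>y\<close> from \<open>f(\<partial>D)\<close>.  The definite description expresses that such a
  \<open>g\<close> exists and that its choice is immaterial.\<close>

definition brouwer_approx ::
  "(real^'n \<Rightarrow> real^'n) \<Rightarrow> (real^'n) set \<Rightarrow> real^'n \<Rightarrow> (real^'n \<Rightarrow> real^'n) \<Rightarrow> bool"
  where "brouwer_approx f D y g \<longleftrightarrow>
    continuous_on (closure D) g \<and> C2_on D g \<and>
    (\<forall>x\<in>closure D. dist (f x) (g x) < infdist y (f ` frontier D)) \<and>
    (\<forall>x\<in>D. g x = y \<longrightarrow> det (jacobian g (at x)) \<noteq> 0)"

definition brouwer_degree ::
  "(real^'n \<Rightarrow> real^'n) \<Rightarrow> (real^'n) set \<Rightarrow> real^'n \<Rightarrow> int"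
  where "brouwer_degree f D y = (THE d.
    open D \<and> bounded D \<and> continuous_on (closure D) f \<and> y \<notin> f ` frontier D \<and>
    (\<exists>g. brouwer_approx f D y g \<and>
      real_of_int d = (\<Sum>x | x \<in> D \<and> g x = y. sgn (det (jacobian g (at x))))))"

section \<open>The circle group, its Euler ring, and orthogonal representations\<close>

definition circle_group :: "complex monoid"
  where "circle_group = \<lparr>carrier = sphere 0 1, mult = (*), one = 1\<rparr>"

typedef circle_subgroup = "{H. subgroup H circle_group \<and> closed H}"
proof -
  have "subgroup {1} circle_group"
    by unfold_locales (auto simp: circle_group_def m_inv_def)
  then show ?thesis by auto
qed

text \<open>Only meant for \<open>n \<ge> 1\<close>, when it is the group of \<open>n\<close>-th roots of unity.\<close>

definition cyclic_subgroup :: "nat \<Rightarrow> circle_subgroup"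
  where "cyclic_subgroup n = Abs_circle_subgroup {z. z ^ n = 1}"

text \<open>The underlying group of the Euler ring \<open>U(S\<^sup>1)\<close>.  Since \<open>S\<^sup>1\<close> is abelian, conjugacy
  classes of closed subgroups are just closed subgroups.\<close>

type_synonym euler_ring = "circle_subgroup \<Rightarrow>\<^sub>0 int"

definition euler_char :: "circle_subgroup \<Rightarrow> euler_ring"  \<comment> \<open>\<open>\<chi>(S\<^sup>1/H\<^sup>+)\<close>\<close>
  where "euler_char H = frag_of H"

definition orthogonal_rep :: "(complex \<Rightarrow> 'a::euclidean_space \<Rightarrow> 'a) \<Rightarrow> bool"
  where "orthogonal_rep \<rho> \<longleftrightarrow> group_action circle_group UNIV \<rho> \<and>
    (\<forall>z\<in>sphere 0 1. orthogonal_transformation (\<rho> z)) \<and>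
    continuous_on (sphere 0 1 \<times> UNIV) (\<lambda>(z, x). \<rho> z x)"

definition isotropy :: "(complex \<Rightarrow> 'a \<Rightarrow> 'a) \<Rightarrow> 'a \<Rightarrow> circle_subgroup"
  where "isotropy \<rho> x = Abs_circle_subgroup (stabilizer circle_group \<rho> x)"

definition fixed_space :: "(complex \<Rightarrow> 'a \<Rightarrow> 'a) \<Rightarrow> circle_subgroup \<Rightarrow> 'a set"
  where "fixed_space \<rho> H = {x. \<forall>z\<in>Rep_circle_subgroup H. \<rho> z x = x}"

text \<open>An orbit is diffeomorphic to \<open>S\<^sup>1/H\<close>, which is a point if \<open>H = S\<^sup>1\<close> and a circle if \<open>H\<close> is
  finite.\<close>

definition orbit_dim :: "(complex \<Rightarrow> 'a \<Rightarrow> 'a) \<Rightarrow> 'a \<Rightarrow> nat"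
  where "orbit_dim \<rho> x = (if orbit circle_group \<rho> x = {x} then 0 else 1)"

definition invariant_set :: "(complex \<Rightarrow> 'a \<Rightarrow> 'a) \<Rightarrow> 'a set \<Rightarrow> bool"
  where "invariant_set \<rho> S \<longleftrightarrow> (\<forall>z\<in>sphere 0 1. \<forall>x\<in>S. \<rho> z x \<in> S)"

definition invariant_fun :: "(complex \<Rightarrow> 'a \<Rightarrow> 'a) \<Rightarrow> 'a set \<Rightarrow> ('a \<Rightarrow> real) \<Rightarrow> bool"
  where "invariant_fun \<rho> S \<phi> \<longleftrightarrow> (\<forall>z\<in>sphere 0 1. \<forall>x\<in>S. \<phi> (\<rho> z x) = \<phi> x)"

section \<open>Degree for equivariant gradient maps\<close>

text \<open>\<open>\<phi>\<close> is a \<open>D\<close>-admissible potential, regarded as a function on the neighbourhood \<open>N\<close> of the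
  closure of \<open>D\<close>.\<close>

definition admissible_on ::
  "(complex \<Rightarrow> 'a::euclidean_space \<Rightarrow> 'a) \<Rightarrow> 'a set \<Rightarrow> 'a set \<Rightarrow> ('a \<Rightarrow> real) \<Rightarrow> bool"
  where "admissible_on \<rho> D N \<phi> \<longleftrightarrow>
    orthogonal_rep \<rho> \<and>
    open D \<and> bounded D \<and> invariant_set \<rho> D \<and>
    open N \<and> closure D \<subseteq> N \<and> invariant_set \<rho> N \<and>
    invariant_fun \<rho> N \<phi> \<and> C1_on N \<phi> \<and>
    (\<forall>x\<in>frontier D. grad \<phi> x \<noteq> 0)"

text \<open>\<open>X\<close> contains exactly one point \<open>x\<^sub>i\<close> of each critical orbit in \<open>D\<close>.\<close>

definition generic ::
  "(complex \<Rightarrow> 'a::euclidean_space \<Rightarrow> 'a) \<Rightarrow> 'a set \<Rightarrow> ('a \<Rightarrow> real) \<Rightarrow> 'a set \<Rightarrow> bool"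
  where "generic \<rho> D \<phi> X \<longleftrightarrow>
    (\<exists>N. admissible_on \<rho> D N \<phi>) \<and>
    finite X \<and> inj_on (orbit circle_group \<rho>) X \<and>
    {x\<in>D. grad \<phi> x = 0} = (\<Union>x\<in>X. orbit circle_group \<rho> x) \<and>
    (\<forall>x\<in>X.
      (\<exists>W. open W \<and> orbit circle_group \<rho> x \<subseteq> W \<and> C2_on W \<phi>) \<and>
      dim {v. hessian \<phi> x v = 0} = orbit_dim \<rho> x \<and>
      (\<exists>\<epsilon>>0. \<forall>y v. y \<in> fixed_space \<rho> (isotropy \<rho> x) \<and>
          infdist y (orbit circle_group \<rho> x) < \<epsilon> \<and>
          v \<in> orthogonal_comp (fixed_space \<rho> (isotropy \<rho> x)) \<and> norm v < \<epsilon> \<longrightarrow>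
          grad \<phi> (y + v) = grad \<phi> y + v))"

definition gradient_homotopic ::
  "(complex \<Rightarrow> 'a::euclidean_space \<Rightarrow> 'a) \<Rightarrow> 'a set \<Rightarrow> ('a \<Rightarrow> real) \<Rightarrow> ('a \<Rightarrow> real) \<Rightarrow> bool"
  where "gradient_homotopic \<rho> D \<phi> \<psi> \<longleftrightarrow>
    (\<exists>N h. (\<forall>t\<in>{0..1}. admissible_on \<rho> D N (h t)) \<and>
      continuous_on ({0..1} \<times> N) (\<lambda>(t, x). h t x) \<and>
      continuous_on ({0..1} \<times> N) (\<lambda>(t, x). grad (h t) x) \<and>
      (\<forall>x\<in>N. h (0::real) x = \<phi> x \<and> h 1 x = \<psi> x))"

text \<open>The degree of the gradient map is given as a function of the potential \<open>\<phi>\<close>.  As for the Brouwer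
  degree, the definite description expresses independence of the choice of \<open>\<psi>\<close> (and of \<open>X\<close>).\<close>

definition gradient_degree ::
  "(complex \<Rightarrow> 'a::euclidean_space \<Rightarrow> 'a) \<Rightarrow> ('a \<Rightarrow> real) \<Rightarrow> 'a set \<Rightarrow> euler_ring"
  where "gradient_degree \<rho> \<phi> D = (THE d. \<exists>\<psi> X.
    gradient_homotopic \<rho> D \<phi> \<psi> \<and> generic \<rho> D \<psi> X \<and>
    d = (\<Sum>x\<in>X. frag_cmul ((-1) ^ morse_index (hessian \<psi> x)) (euler_char (isotropy \<rho> x))))"

section \<open>The representation \<open>\<real>[1,1] \<oplus> \<real>[2,0]\<close> and the potential\<close>

definition rep_V :: "complex \<Rightarrow> real^4 \<Rightarrow> real^4"
  where "rep_V z x = vector [Re z * x$1 - Im z * x$2, Im z * x$1 + Re z * x$2, x$3, x$4]"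

definition pot_U :: "real^4 \<Rightarrow> real"
  where "pot_U x = - x$3 * ((x$1)\<^sup>2 + (x$2)\<^sup>2) + 1/3 * (x$3)^3 + 1/2 * (x$4 - x$3)\<^sup>2"

end

theory Submission
  imports Defs
begin

text \<open>Both degrees are defined by a definite description, so apart from exhibiting one good
approximation for each of them it has to be shown that all others give the same value.  This is
done with a single invariant, the \<open>mapping_degree\<close> of a continuous map
\<open>f\<close> on the closure of a bounded open \<open>D\<close> without zeros on the frontier.

It is defined by Heinz's integral: for a polynomial map \<open>p\<close> with \<open>norm (p x) > 1\<close> on the
frontier, integrate \<open>bump (p x) * det (Dp x)\<close> over \<open>D\<close>, where \<open>bump\<close> is supported in the unit
ball.  When \<open>p\<close> moves along a straight line, the rate of change of this density is the divergence
of a field with compact support in \<open>D\<close> (\<open>degree_density_deriv\<close>), so the integral does not change.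
Weierstrass approximation extends the invariant to continuous maps and gives homotopy invariance
(\<open>mapping_degree_homotopy\<close>).  Additivity and the change of variables for linear maps show that it
counts zeros with the signs of their Jacobian determinants as soon as \<open>f\<close> is differentiable with
invertible derivative at each zero (\<open>mapping_degree_eq_sum_sgn\<close>).

For the Brouwer degree of \<open>-U'\<close>, uniqueness is immediate from this.  Its value is read off from
the gradient of \<open>-U + c x\<^sub>3\<close> with small \<open>c > 0\<close>, whose only zeros are \<open>(0, 0, s, s)\<close> with
\<open>s\<^sup>2 = c\<close>; there the Jacobian determinant is \<open>8 s\<^sup>3\<close>, and the two signs cancel.

For the gradient degree, a point outside the plane \<open>x\<^sub>1 = x\<^sub>2 = 0\<close> has trivial isotropy, so the
degree is \<open>a \<chi>(S\<^sup>1/S\<^sup>1) + b \<chi>(S\<^sup>1/\<int>\<^sub>1)\<close> for integers \<open>a\<close> and \<open>b\<close> that sum the Morse signs over the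
fixed critical points and over the free critical orbits of a generic potential.
The gradient restricted to the fixed plane has mapping degree \<open>a\<close>; the gradient restricted to
the hyperplane \<open>x\<^sub>2 = 0\<close>, which meets every free orbit in two points, has mapping degree
\<open>a + 2 b\<close> (\<open>generic_fixed_degree\<close>, \<open>generic_slice_degree\<close>).  The sign of the Hessian determinant is
turned into the parity of the Morse index by the spectral theorem (\<open>sgn_det_eq_morse_index\<close>).
Hence gradient homotopies preserve \<open>a\<close> and \<open>b\<close>.  For the generic potential \<open>-U - c x\<^sub>3\<close> with
\<open>0 < c < 1\<close> the only critical orbit in the ball is the circle \<open>x\<^sub>1\<^sup>2 + x\<^sub>2\<^sup>2 = c\<close> in
\<open>x\<^sub>3 = x\<^sub>4 = 0\<close>, with even Morse index, so that \<open>a = 0\<close> and \<open>b = 1\<close>.\<close>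

section \<open>Partial derivatives of polynomials\<close>

definition partial :: "(real^'n \<Rightarrow> real) \<Rightarrow> 'n \<Rightarrow> real^'n \<Rightarrow> real"
  where "partial p i x = frechet_derivative p (at x) (axis i 1)"

lemma partial_eqI: "(p has_derivative p') (at x) \<Longrightarrow> partial p i x = p' (axis i 1)"
  unfolding partial_def using frechet_derivative_at by metis

lemma real_polynomial_has_derivative:
  assumes "real_polynomial_function p"
  shows "(p has_derivative frechet_derivative p (at x)) (at x)"
  using assms differentiable_at_real_polynomial_function frechet_derivative_works by blast

lemma partial_linear: "bounded_linear f \<Longrightarrow> partial f i = (\<lambda>x. f (axis i 1))"
  by (rule ext, rule partial_eqI) (rule bounded_linear_imp_has_derivative)

lemma partial_const: "partial (\<lambda>x. c) i = (\<lambda>x. 0)"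
  using partial_eqI[OF has_derivative_const] by fastforce

lemma partial_add:
  assumes "real_polynomial_function p" "real_polynomial_function q"
  shows "partial (\<lambda>x. p x + q x) i = (\<lambda>x. partial p i x + partial q i x)"
  using partial_eqI[OF has_derivative_add[OF assms[THEN real_polynomial_has_derivative]]]
  by (auto simp: partial_def)

lemma partial_mult:
  assumes "real_polynomial_function p" "real_polynomial_function q"
  shows "partial (\<lambda>x. p x * q x) i = (\<lambda>x. p x * partial q i x + partial p i x * q x)"
  using partial_eqI[OF has_derivative_mult[OF assms[THEN real_polynomial_has_derivative]]]
  by (auto simp: partial_def)

lemma real_polynomial_partial:
  "real_polynomial_function p \<Longrightarrow> real_polynomial_function (partial p i)"
proof (induction rule: real_polynomial_function.induct)
  case (linear f) then show ?case by (simp add: partial_linear real_polynomial_function.intros(2))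
next
  case (const c) then show ?case by (simp add: partial_const real_polynomial_function.intros(2))
next
  case (add f g) then show ?case by (simp add: partial_add real_polynomial_function.intros(3))
next
  case (mult f g) then show ?case
    by (simp add: partial_mult real_polynomial_function.intros(3) real_polynomial_function.intros(4))
qed

lemma partial_commute:
  "real_polynomial_function p \<Longrightarrow> partial (partial p i) j = partial (partial p j) i"
proof (induction rule: real_polynomial_function.induct)
  case (linear f) then show ?case by (simp add: partial_linear partial_const)
next
  case (const c) then show ?case by (simp add: partial_const)
next
  case (add f g) then show ?case by (simp add: partial_add real_polynomial_partial)
next
  case (mult f g) then show ?case
    by (simp add: partial_mult partial_add real_polynomial_partial
          real_polynomial_function.intros(4) algebra_simps)
qed

lemma linear_eq_sum_axis:
  fixes f :: "real^'n \<Rightarrow> 'b::real_vector"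
  assumes "linear f" shows "f h = (\<Sum>i\<in>UNIV. h$i *\<^sub>R f (axis i 1))"
proof -
  have "f h = f (\<Sum>i\<in>UNIV. h$i *\<^sub>R axis i 1)"
    using basis_expansion[of h] by (simp add: scalar_mult_eq_scaleR)
  also have "\<dots> = (\<Sum>i\<in>UNIV. h$i *\<^sub>R f (axis i 1))"
    using assms by (simp add: linear_sum linear_scale)
  finally show ?thesis .
qed

lemma real_polynomial_has_derivative_partial:
  fixes p :: "real^'n \<Rightarrow> real"
  assumes "real_polynomial_function p"
  shows "(p has_derivative (\<lambda>h. \<Sum>i\<in>UNIV. h$i * partial p i x)) (at x)"
proof -
  have d: "(p has_derivative frechet_derivative p (at x)) (at x)"
    by (rule real_polynomial_has_derivative[OF assms])
  have "frechet_derivative p (at x) = (\<lambda>h. \<Sum>i\<in>UNIV. h$i * partial p i x)"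
    unfolding partial_def real_scaleR_def[symmetric]
    by (rule ext) (rule linear_eq_sum_axis[OF has_derivative_linear[OF d]])
  with d show ?thesis by simp
qed

lemma real_polynomial_deriv_axis:
  assumes "real_polynomial_function p"
  shows "((\<lambda>s. p (x + s *\<^sub>R axis i 1)) has_real_derivative partial p i (x + t *\<^sub>R axis i 1)) (at t)"
proof -
  have "((\<lambda>s. x + s *\<^sub>R axis i 1) has_derivative (\<lambda>s. s *\<^sub>R axis i 1)) (at t)"
    by (auto intro!: derivative_eq_intros)
  from has_derivative_compose[OF this real_polynomial_has_derivative[OF assms]]
  show ?thesis
    using linear_scale[OF has_derivative_linear[OF real_polynomial_has_derivative[OF assms]]]
    by (simp add: has_field_derivative_def partial_def mult.commute[of "frechet_derivative _ _ _"]
        mult_commute_abs)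
qed

section \<open>Determinants\<close>

definition set_row :: "'a^'n^'m \<Rightarrow> 'm \<Rightarrow> 'a^'n \<Rightarrow> 'a^'n^'m"
  where "set_row A i v = (\<chi> k. if k = i then v else A$k)"

lemma set_row_nth: "set_row A i v $ k = (if k = i then v else A$k)"
  by (simp add: set_row_def)

lemma det_set_row:
  fixes A :: "real^'n^'n"
  shows "det (set_row A k v) =
    (\<Sum>p | p permutes UNIV. of_int (sign p) * (v $ p k * (\<Prod>i\<in>UNIV-{k}. A$i$p i)))"
proof -
  have "(\<Prod>i\<in>UNIV. set_row A k v $i$p i) = v $ p k * (\<Prod>i\<in>UNIV-{k}. A$i$p i)" for p
    by (subst prod.remove[of _ k]) (auto simp: set_row_nth intro!: prod.cong)
  then show ?thesis by (simp add: det_def)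
qed

text \<open>The determinant is linear in each row, so it can be differentiated row by row.\<close>

lemma det_has_real_derivative:
  fixes A :: "real \<Rightarrow> real^'n^'n"
  assumes "\<And>i j. ((\<lambda>s. A s $i$j) has_real_derivative A' $i$j) (at t)"
  shows "((\<lambda>s. det (A s)) has_real_derivative (\<Sum>k\<in>UNIV. det (set_row (A t) k (A'$k)))) (at t)"
proof -
  have prod: "((\<lambda>s. \<Prod>i\<in>UNIV. A s $i$p i) has_real_derivative
      (\<Sum>k\<in>UNIV. A'$k$p k * (\<Prod>i\<in>UNIV-{k}. A t$i$p i))) (at t)" for p
    using has_field_derivative_prod[of UNIV "\<lambda>i s. A s $i$p i" "\<lambda>i. A'$i$p i", OF assms]
    by simp
  have "((\<lambda>s. det (A s)) has_real_derivative
     (\<Sum>p | p permutes UNIV. of_int (sign p) *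
         (\<Sum>k\<in>UNIV. A'$k$p k * (\<Prod>i\<in>UNIV-{k}. A t$i$p i)))) (at t)"
    unfolding det_def by (intro DERIV_sum DERIV_cmult prod)
  also have "(\<Sum>p | p permutes UNIV. of_int (sign p) *
         (\<Sum>k\<in>UNIV. A'$k$p k * (\<Prod>i\<in>UNIV-{k}. A t$i$p i)))
     = (\<Sum>k\<in>UNIV. det (set_row (A t) k (A'$k)))"
    unfolding det_set_row sum_distrib_left by (rule sum.swap)
  finally show ?thesis .
qed

lemma det_set_two_rows:
  fixes A :: "real^'n^'n"
  assumes "i \<noteq> k"
  shows "det (set_row (set_row A i v) k w) = - det (set_row (set_row A i w) k v)"
proof -
  let ?p = "Transposition.transpose i k" and ?B = "set_row (set_row A i w) k v"
  have "set_row (set_row A i v) k w = (\<chi> l. ?B $ ?p l)"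
    using assms by (vector set_row_nth Transposition.transpose_def)
  moreover have "?p permutes UNIV" by (simp add: permutes_swap_id)
  moreover from this have "det (\<chi> l. ?B $ ?p l) = of_int (sign ?p) * det ?B"
    by (intro det_permute_rows)
  ultimately show ?thesis
    by (simp add: sign_swap_id assms)
qed

text \<open>The terms for \<open>(i, k)\<close> and \<open>(k, i)\<close> differ by an exchange of two rows and cancel.  With the second
partial derivatives of a map as \<open>H i k\<close>, this says that the cofactors in a Jacobian matrix have
divergence zero (Piola's identity).\<close>

lemma sum_det_set_two_rows:
  fixes A :: "real^'n^'n"
  assumes "\<And>i k. H i k = H k i"
  shows "(\<Sum>i\<in>UNIV. \<Sum>k\<in>UNIV-{i}. det (set_row (set_row A i v) k (H i k))) = 0"
proof -
  define T where "T i k = (if i = k then 0 else det (set_row (set_row A i v) k (H i k)))" for i k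
  have T: "T i k = - T k i" for i k
  proof (cases "i = k")
    case False
    have "set_row (set_row A i (H i k)) k v = set_row (set_row A k v) i (H k i)"
      using False assms[of i k] by (vector set_row_nth)
    with False show ?thesis by (simp add: T_def det_set_two_rows[of i k])
  qed (simp add: T_def)
  have "(\<Sum>i\<in>UNIV. \<Sum>k\<in>UNIV. T i k) = (\<Sum>k\<in>UNIV. \<Sum>i\<in>UNIV. T i k)" by (rule sum.swap)
  also have "\<dots> = - (\<Sum>k\<in>UNIV. \<Sum>i\<in>UNIV. T k i)" by (subst T) (simp add: sum_negf)
  finally have "(\<Sum>i\<in>UNIV. \<Sum>k\<in>UNIV. T i k) = 0" by simp
  moreover have "(\<Sum>k\<in>UNIV. T i k) = (\<Sum>k\<in>UNIV-{i}. det (set_row (set_row A i v) k (H i k)))" for i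
    by (subst sum.remove[of _ i]) (auto simp: T_def intro!: sum.cong)
  ultimately show ?thesis by simp
qed

lemma cramer_sum_invertible:
  fixes A :: "real^'n^'n"
  assumes "det A \<noteq> 0"
  shows "(\<Sum>i\<in>UNIV. det (set_row A i v) * A$i$j) = det A * v$j"
proof -
  have "invertible (transpose A)" using assms by (simp add: invertible_det_nz)
  then obtain x where x: "transpose A *v x = v"
    by (metis invertible_def matrix_vector_mul_assoc matrix_vector_mul_lid)
  have v: "v = (\<Sum>i\<in>UNIV. x$i *s A$i)"
    unfolding x[symmetric] by (vector matrix_vector_mult_def transpose_def sum_component mult.commute)
  have "det (set_row A i v) = x$i * det A" for i
    proof -
    have row: "row k A = A$k" for k by (simp add: row_def vec_nth_inverse)
    show ?thesis
      using cramer_lemma_transpose[of i x A] unfolding set_row_def row v[symmetric] .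
  qed
  moreover have "v$j = (\<Sum>i\<in>UNIV. x$i * A$i$j)"
    using arg_cong[OF v, of "\<lambda>u. u$j"] by (simp add: sum_component)
  ultimately show ?thesis by (simp add: sum_distrib_left mult_ac)
qed

lemma mat_eq: "mat e = e *\<^sub>R (mat 1 :: real^'n^'n)"
  by (simp add: vec_eq_iff mat_def)

lemma exists_bound_det_add_mat_nonzero:
  fixes A :: "real^'n^'n"
  obtains B :: real where "\<And>e. e > B \<Longrightarrow> det (A + mat e) \<noteq> 0"
proof -
  obtain B where B: "\<And>x. norm (A *v x) \<le> norm x * B" 
    using bounded_linear.bounded[OF matrix_vector_mul_bounded_linear[of A]] by blast
  show ?thesis
  proof (rule that[of "max B 0"])
    fix e :: real assume e: "e > max B 0"
    have "x = 0" if "(A + mat e) *v x = 0" for x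
    proof (rule ccontr)
      assume "x \<noteq> 0"
      have "A *v x = - (e *\<^sub>R x)"
        using that scaleR_matrix_vector_assoc[of e "mat 1" x]
        by (simp add: matrix_vector_mult_add_rdistrib eq_neg_iff_add_eq_0 mat_eq[of e])
      then have "e * norm x \<le> norm x * B" using B[of x] e by simp
      with \<open>x \<noteq> 0\<close> e show False by simp
    qed
    then have "inj ((*v) (A + mat e))"
      using linear_injective_0[OF matrix_vector_mul_linear] by blast
    then show "det (A + mat e) \<noteq> 0" using det_nz_iff_inj[OF matrix_vector_mul_linear[of "A + mat e"]]
      by (simp add: matrix_of_matrix_vector_mul)
  qed
qed

lemma polynomial_zero_if_eventually_zero:
  fixes f :: "real \<Rightarrow> real"
  assumes "real_polynomial_function f" "\<And>e. e > B \<Longrightarrow> f e = 0"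
  shows "f x = 0"
proof -
  obtain a n where f: "f = (\<lambda>x. \<Sum>i\<le>n. a i * x^i)"
    using assms(1) unfolding real_polynomial_function_iff_sum by blast
  have "\<not> finite {x. f x = 0}"
    using infinite_Ioi[of B] assms(2) finite_subset[of "{B<..}" "{x. f x = 0}"] by auto
  then have "a i = 0" if "i \<le> n" for i
    using polyfun_rootbound_finite[of n a] that unfolding f by metis
  then show ?thesis unfolding f by simp
qed

lemma real_polynomial_det:
  assumes "\<And>i j. real_polynomial_function (\<lambda>x. A x $i$j)"
  shows "real_polynomial_function (\<lambda>x. det (A x :: real^'n^'n))"
proof -
  have "real_polynomial_function (\<lambda>x. of_int (sign p) * (\<Prod>i\<in>UNIV. A x $i$p i))" for p :: "'n \<Rightarrow> 'n"
    by (rule real_polynomial_function.intros(4)[OF real_polynomial_function.intros(2)])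
       (rule real_polynomial_function_prod, simp, rule assms)
  then show ?thesis
    unfolding det_def by (intro real_polynomial_function_sum) (simp_all add: finite_permutations)
qed

text \<open>Cramer's rule for a possibly singular matrix.  With \<open>A + mat e\<close> in place of \<open>A\<close>, both sides are
polynomials in \<open>e\<close>; they agree for all large \<open>e\<close>, where the matrix is invertible, and therefore
also for \<open>e = 0\<close>.\<close>

lemma cramer_sum:
  fixes A :: "real^'n^'n"
  shows "(\<Sum>i\<in>UNIV. det (set_row A i v) * A$i$j) = det A * v$j"
proof -
  obtain B where B: "\<And>e. e > B \<Longrightarrow> det (A + mat e) \<noteq> 0"
    by (rule exists_bound_det_add_mat_nonzero[of A]) blast
  define G where "G e = (\<Sum>i\<in>UNIV. det (set_row (A + mat e) i v) * (A + mat e)$i$j)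
      - det (A + mat e) * v$j" for e
  have entry: "real_polynomial_function (\<lambda>e. (A + mat e)$i$j)" for i j
    using real_polynomial_function.intros(3)[OF real_polynomial_function.intros(2)[of "A$i$j"]
        real_polynomial_function.intros(1)[OF bounded_linear_ident]]
    by (cases "i = j") (auto simp: mat_def real_polynomial_function.intros(2))
  have row: "real_polynomial_function (\<lambda>e. set_row (A + mat e) i v $k$l)" for i k l
    by (cases "k = i")
       (simp_all add: set_row_nth entry real_polynomial_function.intros(2) del: vector_add_component)
  have "real_polynomial_function G"
    unfolding G_def
    by (rule real_polynomial_function_diff, rule real_polynomial_function_sum, simp)
       (rule real_polynomial_function.intros(4) real_polynomial_det entry row
          real_polynomial_function.intros(2))+
  moreover have "G e = 0" if "e > B" for e
    using cramer_sum_invertible[OF B[OF that]] by (simp add: G_def)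
  ultimately have "G 0 = 0" by (rule polynomial_zero_if_eventually_zero)
  then show ?thesis by (simp add: G_def mat_def zero_vec_def[symmetric])
qed

section \<open>The density of the degree and its flux\<close>

text \<open>Any nonnegative bump function supported in the unit ball would do; the square makes this one
continuously differentiable at the boundary of its support.\<close>

definition bump :: "real^'n \<Rightarrow> real"
  where "bump y = (max 0 (1 - y \<bullet> y))\<^sup>2"

definition grad_bump :: "real^'n \<Rightarrow> real^'n"
  where "grad_bump y = (- 4 * max 0 (1 - y \<bullet> y)) *\<^sub>R y"

lemma bump_eq_0: "1 \<le> norm y \<Longrightarrow> bump y = 0" "1 \<le> norm y \<Longrightarrow> grad_bump y = 0"
  using power_mono[of 1 "norm y" 2]
  by (auto simp: bump_def grad_bump_def dot_square_norm)

lemma continuous_bump: "continuous_on S bump" "continuous_on S grad_bump"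
  unfolding bump_def grad_bump_def by (intro continuous_intros)+

lemma max_0_square_deriv:
  "((\<lambda>s. (max 0 s)\<^sup>2) has_real_derivative 2 * max 0 t) (at (t::real))"
proof (cases t "0::real" rule: linorder_cases)
  case less
  have "((\<lambda>s::real. 0) has_real_derivative 0) (at t)" by simp
  then have "((\<lambda>s. (max 0 s)\<^sup>2) has_real_derivative 0) (at t)"
    by (rule has_field_derivative_transform_within_open[where S="{..<0}"]) (use less in auto)
  with less show ?thesis by simp
next
  case greater
  have "((\<lambda>s::real. s\<^sup>2) has_real_derivative 2 * t) (at t)" by (auto intro!: derivative_eq_intros)
  then have "((\<lambda>s. (max 0 s)\<^sup>2) has_real_derivative 2 * t) (at t)"
    by (rule has_field_derivative_transform_within_open[where S="{0<..}"]) (use greater in auto)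
  with greater show ?thesis by simp
next
  case equal
  have "((\<lambda>h::real. \<bar>h\<bar>) \<longlongrightarrow> 0) (at 0)" by (rule tendsto_rabs_zero) (rule tendsto_ident_at)
  then have "((\<lambda>h::real. (max 0 h)\<^sup>2 / h) \<longlongrightarrow> 0) (at 0)"
    by (rule Lim_null_comparison[rotated]) (auto simp: power2_eq_square max_def)
  then show ?thesis using equal by (simp add: DERIV_def)
qed

lemma bump_deriv:
  assumes "\<And>j. ((\<lambda>s. y s $ j) has_real_derivative y' $ j) (at t)"
  shows "((\<lambda>s. bump (y s)) has_real_derivative (grad_bump (y t) \<bullet> y')) (at t)"
proof -
  have "((\<lambda>s. y s \<bullet> y s) has_real_derivative (\<Sum>j\<in>UNIV. 2 * (y t $ j * y' $ j))) (at t)"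
    unfolding inner_vec_def
    by (auto intro!: derivative_eq_intros assms sum.cong)
  from DERIV_diff[OF DERIV_const[of 1] this]
  have "((\<lambda>s. 1 - y s \<bullet> y s) has_real_derivative - 2 * (y t \<bullet> y')) (at t)"
    by (simp add: inner_vec_def sum_distrib_left sum_negf)
  from DERIV_chain2[OF max_0_square_deriv this]
  show ?thesis by (simp add: bump_def grad_bump_def mult_ac)
qed

abbreviation poly_map :: "(real^'n \<Rightarrow> real^'n) \<Rightarrow> bool"
  where "poly_map p \<equiv> \<forall>j. real_polynomial_function (\<lambda>x. p x $ j)"

text \<open>The transpose of the Jacobian matrix: row \<open>i\<close> is the partial derivative of \<open>p\<close> in direction \<open>i\<close>,
so that derivatives in direction \<open>i\<close> correspond to replacing row \<open>i\<close>.\<close>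

definition jac :: "(real^'n \<Rightarrow> real^'n) \<Rightarrow> real^'n \<Rightarrow> real^'n^'n"
  where "jac p x = (\<chi> i j. partial (\<lambda>x. p x $ j) i x)"

lemma jac_nth: "jac p x $ i $ j = partial (\<lambda>x. p x $ j) i x"
  by (simp add: jac_def)

text \<open>When \<open>g\<close> moves with velocity \<open>v\<close>, the density \<open>bump (g x) * det (jac g x)\<close> satisfies a
conservation law, and this is component \<open>i\<close> of the corresponding flux.\<close>

definition flux :: "(real^'n \<Rightarrow> real^'n) \<Rightarrow> (real^'n \<Rightarrow> real^'n) \<Rightarrow> 'n \<Rightarrow> real^'n \<Rightarrow> real"
  where "flux g v i x = bump (g x) * det (set_row (jac g x) i (v x))"

text \<open>The partial derivative of \<open>flux g v i\<close> in direction \<open>i\<close>, written out by the product rule.\<close>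

definition dflux :: "(real^'n \<Rightarrow> real^'n) \<Rightarrow> (real^'n \<Rightarrow> real^'n) \<Rightarrow> 'n \<Rightarrow> real^'n \<Rightarrow> real"
  where "dflux g v i x = 
     (grad_bump (g x) \<bullet> jac g x $ i) * det (set_row (jac g x) i (v x)) +
     bump (g x) * (det (set_row (jac g x) i (jac v x $ i)) +
       (\<Sum>k\<in>UNIV-{i}. det (set_row (set_row (jac g x) i (v x)) k
            (\<chi> j. partial (partial (\<lambda>x. g x $ j) k) i x))))"

lemma set_row_same: "set_row (set_row A i v) i w = set_row A i w"
  by (vector set_row_nth)

lemma real_polynomial_deriv_axis0:
  assumes "real_polynomial_function p"
  shows "((\<lambda>s. p (x + s *\<^sub>R axis i 1)) has_real_derivative partial p i x) (at 0)"
  using real_polynomial_deriv_axis[OF assms, of x i 0] by simp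

lemma flux_deriv:
  assumes g: "poly_map g" and v: "poly_map v"
  shows "((\<lambda>s. flux g v i (x + s *\<^sub>R axis i 1)) has_real_derivative dflux g v i x) (at 0)"
proof -
  let ?x = "\<lambda>s. x + s *\<^sub>R axis i 1"
  define A' where "A' = (\<chi> k. if k = i then jac v x $ i else \<chi> j. partial (partial (\<lambda>x. g x $ j) k) i x)"
  have "((\<lambda>s. bump (g (?x s))) has_real_derivative (grad_bump (g (?x 0)) \<bullet> jac g x $ i)) (at 0)"
    by (rule bump_deriv) (use g in \<open>auto simp: jac_nth intro!: real_polynomial_deriv_axis0\<close>)
  moreover have "((\<lambda>s. det (set_row (jac g (?x s)) i (v (?x s)))) has_real_derivative
      (\<Sum>k\<in>UNIV. det (set_row (set_row (jac g (?x 0)) i (v (?x 0))) k (A' $ k)))) (at 0)"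
  proof (rule det_has_real_derivative)
    fix k j
    show "((\<lambda>s. set_row (jac g (?x s)) i (v (?x s)) $ k $ j) has_real_derivative A' $ k $ j) (at 0)"
      by (cases "k = i")
         (use g v in \<open>auto simp: set_row_nth A'_def jac_nth
             intro!: real_polynomial_deriv_axis0 real_polynomial_partial\<close>)
  qed
  moreover have "(\<Sum>k\<in>UNIV. det (set_row (set_row (jac g x) i (v x)) k (A' $ k))) =
      det (set_row (jac g x) i (jac v x $ i)) +
       (\<Sum>k\<in>UNIV-{i}. det (set_row (set_row (jac g x) i (v x)) k
            (\<chi> j. partial (partial (\<lambda>x. g x $ j) k) i x)))"
    by (subst sum.remove[of _ i]) (auto simp: A'_def set_row_same intro!: sum.cong)
  ultimately show ?thesis
    unfolding flux_def dflux_def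
    by (auto intro!: derivative_eq_intros)
qed

definition degree_density :: "(real^'n \<Rightarrow> real^'n) \<Rightarrow> real^'n \<Rightarrow> real"
  where "degree_density g x = bump (g x) * det (jac g x)"

lemma real_polynomial_cmult: "real_polynomial_function p \<Longrightarrow> real_polynomial_function (\<lambda>x. c * p x)"
  by (rule real_polynomial_function.intros(4)[OF real_polynomial_function.intros(2)])

lemma partial_cmult:
  assumes "real_polynomial_function p" shows "partial (\<lambda>x. c * p x) i = (\<lambda>x. c * partial p i x)"
  using partial_mult[OF real_polynomial_function.intros(2) assms, of c i] by (simp add: partial_const)

lemma poly_map_add_scaleR:
  assumes "poly_map p" "poly_map v" shows "poly_map (\<lambda>x. p x + t *\<^sub>R v x)"
  using assms by (simp add: real_polynomial_cmult real_polynomial_function.intros(3))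

lemma jac_add_scaleR:
  assumes "poly_map p" "poly_map v"
  shows "jac (\<lambda>x. p x + t *\<^sub>R v x) x $ i $ j = jac p x $ i $ j + t * jac v x $ i $ j"
  using assms partial_mult[OF real_polynomial_function.intros(2)[of t], of "\<lambda>x. v x $ j" i]
  by (simp add: jac_nth partial_add partial_const real_polynomial_cmult)

text \<open>The conservation law.  In the divergence of the flux, the terms with second derivatives of \<open>g\<close>
cancel by \<open>sum_det_set_two_rows\<close>, those with the gradient of the bump function combine by
\<open>cramer_sum\<close>, and the remaining ones form the derivative of the determinant.\<close>

lemma degree_density_deriv:
  fixes p v :: "real^'n \<Rightarrow> real^'n"
  assumes p: "poly_map p" and v: "poly_map v"
  shows "((\<lambda>t. degree_density (\<lambda>x. p x + t *\<^sub>R v x) x) has_real_derivative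
      (\<Sum>i\<in>UNIV. dflux (\<lambda>x. p x + t *\<^sub>R v x) v i x)) (at t)"
proof -
  define g where "g = (\<lambda>x. p x + t *\<^sub>R v x)"
  have g: "poly_map g"
    using p v unfolding g_def by (rule poly_map_add_scaleR)
  have "((\<lambda>t. bump (p x + t *\<^sub>R v x)) has_real_derivative (grad_bump (g x) \<bullet> v x)) (at t)"
    unfolding g_def by (rule bump_deriv) (auto intro!: derivative_eq_intros)
  moreover have "((\<lambda>t. det (jac (\<lambda>x. p x + t *\<^sub>R v x) x)) has_real_derivative
      (\<Sum>i\<in>UNIV. det (set_row (jac g x) i (jac v x $ i)))) (at t)"
    unfolding g_def
    by (rule det_has_real_derivative) (auto simp: jac_add_scaleR[OF p v] intro!: derivative_eq_intros)
  ultimately have "((\<lambda>t. degree_density (\<lambda>x. p x + t *\<^sub>R v x) x) has_real_derivative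
     ((grad_bump (g x) \<bullet> v x) * det (jac g x) +
      bump (g x) * (\<Sum>i\<in>UNIV. det (set_row (jac g x) i (jac v x $ i))))) (at t)"
    unfolding degree_density_def g_def by (auto intro!: derivative_eq_intros)
  also have "(grad_bump (g x) \<bullet> v x) * det (jac g x) +
      bump (g x) * (\<Sum>i\<in>UNIV. det (set_row (jac g x) i (jac v x $ i))) = (\<Sum>i\<in>UNIV. dflux g v i x)"
  proof -
    have "(\<Sum>i\<in>UNIV. (grad_bump (g x) \<bullet> jac g x $ i) * det (set_row (jac g x) i (v x)))
       = (\<Sum>j\<in>UNIV. grad_bump (g x) $ j * (\<Sum>i\<in>UNIV. det (set_row (jac g x) i (v x)) * jac g x $ i $ j))"
      by (simp add: inner_vec_def sum_distrib_left sum_distrib_right mult_ac) (rule sum.swap)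
    also have "\<dots> = (grad_bump (g x) \<bullet> v x) * det (jac g x)"
      by (simp only: cramer_sum inner_vec_def sum_distrib_right) (simp add: mult_ac)
    finally have 1: "(\<Sum>i\<in>UNIV. (grad_bump (g x) \<bullet> jac g x $ i) * det (set_row (jac g x) i (v x)))
       = (grad_bump (g x) \<bullet> v x) * det (jac g x)" .
    have 2: "(\<Sum>i\<in>UNIV. \<Sum>k\<in>UNIV-{i}. det (set_row (set_row (jac g x) i (v x)) k
            (\<chi> j. partial (partial (\<lambda>x. g x $ j) k) i x))) = 0"
      using g by (intro sum_det_set_two_rows) (simp add: vec_eq_iff, metis partial_commute)
    show ?thesis
      unfolding dflux_def using 1 2 by (simp add: sum.distrib flip: sum_distrib_left)
  qed
  finally show ?thesis unfolding g_def .
qed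

section \<open>Homotopy invariance of the degree integral\<close>

lemma has_integral_cbox_of_support:
  fixes F :: "'a::euclidean_space \<Rightarrow> real"
  assumes "continuous_on UNIV F" "\<And>x. x \<notin> cbox a b \<Longrightarrow> F x = 0"
  shows "(F has_integral integral (cbox a b) F) UNIV"
proof -
  have "(F has_integral integral (cbox a b) F) (cbox a b)"
    using integrable_continuous[of a b F] assms(1) continuous_on_subset by blast
  then show ?thesis
    using has_integral_on_superset[of F _ "cbox a b" UNIV] assms(2) by auto
qed

text \<open>By translation invariance the integral of \<open>\<lambda>x. F (x + s *\<^sub>R e)\<close> does not depend on \<open>s\<close>;
differentiate under the integral sign at \<open>s = 0\<close>.\<close>

lemma integral_directional_derivative_eq_0:
  fixes F F' :: "'a::euclidean_space \<Rightarrow> real"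
  assumes F: "continuous_on UNIV F" and F': "continuous_on UNIV F'"
    and deriv: "\<And>x. ((\<lambda>s. F (x + s *\<^sub>R e)) has_real_derivative F' x) (at 0)"
    and supp: "\<And>x. x \<notin> cbox a b \<Longrightarrow> F x = 0" "\<And>x. x \<notin> cbox a b \<Longrightarrow> F' x = 0"
  shows "integral UNIV F' = 0"
proof -
  \<comment> \<open>a larger box that contains all translates of the support by \<open>s *\<^sub>R e\<close> with \<open>\<bar>s\<bar> \<le> 1\<close>\<close>
  define c where "c = a - (\<Sum>i\<in>Basis. norm e *\<^sub>R i)"
  define d where "d = b + (\<Sum>i\<in>Basis. norm e *\<^sub>R i)"
  have e: "\<bar>e \<bullet> i\<bar> \<le> norm e" if "i \<in> Basis" for i using that by (rule Basis_le_norm)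
  have shift: "x \<in> cbox c d" if "x + s *\<^sub>R e \<in> cbox a b" "\<bar>s\<bar> \<le> 1" for x s
  proof -
    have "\<bar>s * (e \<bullet> i)\<bar> \<le> norm e" if "i \<in> Basis" for i
      using mult_mono[OF \<open>\<bar>s\<bar> \<le> 1\<close> e[OF that]] by (simp add: abs_mult)
    then show ?thesis
      using that(1) by (fastforce simp: mem_box c_def d_def algebra_simps abs_le_iff)
  qed
  have ab: "cbox a b \<subseteq> cbox c d" using shift[of _ 0] by auto
  define \<Phi> where "\<Phi> s = integral (cbox c d) (\<lambda>x. F (x + s *\<^sub>R e))" for s
  have shiftF: "continuous_on S (\<lambda>x. F (x + s *\<^sub>R e))" for s S
    by (rule continuous_on_compose2[OF F]) (auto intro!: continuous_intros)
  have const: "\<Phi> s = integral UNIV F" if "\<bar>s\<bar> \<le> 1" for s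
  proof -
    have "((\<lambda>x. F (x + s *\<^sub>R e)) has_integral \<Phi> s) UNIV"
      unfolding \<Phi>_def by (rule has_integral_cbox_of_support[OF shiftF]) (use supp(1) shift that in blast)
    moreover have "((\<lambda>x. F (x + s *\<^sub>R e)) has_integral integral UNIV F) UNIV"
    proof -
      have "(F has_integral integral UNIV F) (cbox a b)"
        using has_integral_cbox_of_support[OF F supp(1)] integrable_integral integrable_continuous[of a b F]
          F continuous_on_subset by (metis integral_unique subset_UNIV)
      from has_integral_affinity'[OF this, of 1 "s *\<^sub>R e"]
      have "((\<lambda>x. F (x + s *\<^sub>R e)) has_integral integral UNIV F) (cbox (a - s *\<^sub>R e) (b - s *\<^sub>R e))"
        by simp
      moreover have "x + s *\<^sub>R e \<notin> cbox a b" if "x \<notin> cbox (a - s *\<^sub>R e) (b - s *\<^sub>R e)" for x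
        using that by (auto simp: mem_box algebra_simps)
      ultimately show ?thesis
        using has_integral_on_superset[of _ _ _ UNIV] supp(1) by (metis subset_UNIV)
    qed
    ultimately show ?thesis by (rule has_integral_unique)
  qed
  have "(\<Phi> has_real_derivative integral (cbox c d) (\<lambda>x. F' (x + 0 *\<^sub>R e))) (at 0 within {-1..1})"
    unfolding \<Phi>_def
  proof (rule leibniz_rule_field_derivative)
    show "((\<lambda>s. F (x + s *\<^sub>R e)) has_real_derivative F' (x + s *\<^sub>R e)) (at s within {-1..1})" for s x
      using deriv[of "x + s *\<^sub>R e"] DERIV_shift[of "\<lambda>s. F (x + s *\<^sub>R e)" _ 0 s]
      by (auto simp: algebra_simps intro: has_field_derivative_at_within)
    show "continuous_on ({-1..1} \<times> cbox c d) (\<lambda>(s, x). F' (x + s *\<^sub>R e))"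
      unfolding split_beta by (rule continuous_on_compose2[OF F']) (auto intro!: continuous_intros)
  qed (auto intro!: integrable_continuous shiftF)
  then have "(\<Phi> has_real_derivative integral (cbox c d) F') (at 0)"
    by (simp add: at_within_Icc_at)
  moreover have "(\<Phi> has_real_derivative 0) (at 0)"
    by (rule has_field_derivative_transform_within_open[OF DERIV_const[of "integral UNIV F"], where S="{-1<..<1}"])
       (auto simp: const)
  ultimately have "integral (cbox c d) F' = 0" by (rule DERIV_unique)
  moreover have "(F' has_integral integral (cbox c d) F') UNIV"
    by (rule has_integral_cbox_of_support[OF F']) (use supp(2) ab in blast)
  ultimately show ?thesis by (simp add: integral_unique)
qed

definition degree_integral :: "(real^'n \<Rightarrow> real^'n) \<Rightarrow> (real^'n) set \<Rightarrow> real"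
  where "degree_integral g D = integral UNIV (\<lambda>x. if x \<in> D then degree_density g x else 0)"

lemma continuous_on_restrict_0:
  fixes G :: "'b::topological_space \<Rightarrow> 'a::topological_space \<Rightarrow> real"
  assumes "open D" "closed T" "continuous_on (T \<times> closure D) (\<lambda>(t, x). G t x)"
    and "\<And>t x. t \<in> T \<Longrightarrow> x \<in> frontier D \<Longrightarrow> G t x = 0"
  shows "continuous_on (T \<times> UNIV) (\<lambda>(t, x). if x \<in> D then G t x else 0)"
proof -
  have "continuous_on (T \<times> closure D \<union> T \<times> (- D)) (\<lambda>z. if snd z \<in> D then (\<lambda>(t, x). G t x) z else 0)"
  proof (rule continuous_on_cases)
    show "closed (T \<times> closure D)" "closed (T \<times> (- D))"
      using assms(1,2) by (auto intro!: closed_Times)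
    show "\<forall>x. x \<in> T \<times> closure D \<and> snd x \<notin> D \<or> x \<in> T \<times> - D \<and> snd x \<in> D \<longrightarrow> (case x of (t, x) \<Rightarrow> G t x) = 0"
      using assms(4) interior_open[OF assms(1)] by (auto simp: frontier_def)
  qed (use assms(3) in auto)
  moreover have "T \<times> closure D \<union> T \<times> (- D) = T \<times> UNIV" using closure_subset by auto
  ultimately show ?thesis by (simp only: case_prod_unfold)
qed

lemma continuous_on_restrict_0':
  fixes G :: "'a::topological_space \<Rightarrow> real"
  assumes "open D" "continuous_on (closure D) G" "\<And>x. x \<in> frontier D \<Longrightarrow> G x = 0"
  shows "continuous_on UNIV (\<lambda>x. if x \<in> D then G x else 0)"
proof -
  have "continuous_on (closure D \<union> - D) (\<lambda>x. if x \<in> D then G x else 0)"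
    by (rule continuous_on_cases)
       (use assms interior_open[OF assms(1)] in \<open>auto simp: frontier_def\<close>)
  moreover have "closure D \<union> - D = UNIV" using closure_subset by auto
  ultimately show ?thesis by simp
qed

lemma continuous_on_set_row:
  fixes A :: "'a::topological_space \<Rightarrow> real^'n^'m"
  assumes "continuous_on S A" "continuous_on S v"
  shows "continuous_on S (\<lambda>x. set_row (A x) i (v x))"
  unfolding set_row_def
proof (rule continuous_on_vec_lambda)
  show "continuous_on S (\<lambda>x. if k = i then v x else A x $ k)" for k
    by (cases "k = i") (use assms in \<open>auto intro!: continuous_intros\<close>)
qed

lemma continuous_on_det:
  fixes A :: "'a::topological_space \<Rightarrow> real^'n^'n"
  assumes "continuous_on S A"
  shows "continuous_on S (\<lambda>x. det (A x))"
  unfolding det_def by (intro continuous_intros assms)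

lemma continuous_on_real_polynomial: "real_polynomial_function p \<Longrightarrow> continuous_on S p"
  by (simp add: real_polynomial_function_eq continuous_on_polymonial_function)

lemma continuous_on_poly_map: "poly_map p \<Longrightarrow> continuous_on S p"
  using continuous_on_vec_lambda[of S "\<lambda>j x. p x $ j"] continuous_on_real_polynomial by auto

lemma continuous_on_jac: "poly_map p \<Longrightarrow> continuous_on S (jac p)"
  unfolding jac_def
  by (intro continuous_on_vec_lambda continuous_on_real_polynomial real_polynomial_partial) auto

lemma continuous_on_second_partials:
  "poly_map p \<Longrightarrow> continuous_on S (\<lambda>x. \<chi> j. partial (partial (\<lambda>x. p x $ j) k) i x)"
  by (intro continuous_on_vec_lambda continuous_on_real_polynomial real_polynomial_partial) auto

lemma continuous_on_dflux:
  assumes p: "poly_map p" and v: "poly_map v"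
  shows "continuous_on S (\<lambda>(t, x). dflux (\<lambda>x. p x + t *\<^sub>R v x) v i x)"
proof -
  have jac: "jac (\<lambda>x. p x + t *\<^sub>R v x) x = jac p x + t *\<^sub>R jac v x" for t x
    by (simp add: vec_eq_iff jac_add_scaleR[OF p v])
  have second: "(\<chi> j. partial (partial (\<lambda>x. (p x + t *\<^sub>R v x) $ j) k) i x) =
     (\<chi> j. partial (partial (\<lambda>x. p x $ j) k) i x) + t *\<^sub>R (\<chi> j. partial (partial (\<lambda>x. v x $ j) k) i x)"
    for t k x
  proof -
    have "partial (\<lambda>x. (p x + t *\<^sub>R v x) $ j) k =
        (\<lambda>x. partial (\<lambda>x. p x $ j) k x + t * partial (\<lambda>x. v x $ j) k x)" for j
      using jac_add_scaleR[OF p v, of t _ k j] by (auto simp: jac_nth)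
    then show ?thesis
      using p v by (simp add: vec_eq_iff partial_add partial_cmult real_polynomial_cmult real_polynomial_partial)
  qed
  note [continuous_intros] = continuous_bump[THEN continuous_on_compose2, OF _ subset_UNIV]
    continuous_on_det continuous_on_set_row
    continuous_on_poly_map[OF p, THEN continuous_on_compose2, OF _ subset_UNIV]
    continuous_on_poly_map[OF v, THEN continuous_on_compose2, OF _ subset_UNIV]
    continuous_on_jac[OF p, THEN continuous_on_compose2, OF _ subset_UNIV]
    continuous_on_jac[OF v, THEN continuous_on_compose2, OF _ subset_UNIV]
    continuous_on_second_partials[OF p, THEN continuous_on_compose2, OF _ subset_UNIV]
    continuous_on_second_partials[OF v, THEN continuous_on_compose2, OF _ subset_UNIV]
  show ?thesis
    unfolding dflux_def jac second split_beta by (intro continuous_intros)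
qed

lemma continuous_on_dflux':
  assumes g: "poly_map g" and v: "poly_map v"
  shows "continuous_on S (dflux g v i)"
  unfolding dflux_def
  by (intro continuous_intros continuous_bump[THEN continuous_on_compose2, OF _ subset_UNIV]
      continuous_on_det continuous_on_set_row continuous_on_poly_map[OF g] continuous_on_poly_map[OF v]
      continuous_on_jac[OF g] continuous_on_jac[OF v] continuous_on_second_partials[OF g])

lemma continuous_on_flux:
  assumes g: "poly_map g" and v: "poly_map v"
  shows "continuous_on S (flux g v i)"
  unfolding flux_def
  by (intro continuous_intros continuous_bump[THEN continuous_on_compose2, OF _ subset_UNIV]
      continuous_on_det continuous_on_set_row continuous_on_poly_map[OF g] continuous_on_poly_map[OF v]
      continuous_on_jac[OF g])

lemma continuous_on_density:
  assumes g: "poly_map g"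
  shows "continuous_on S (degree_density g)"
  unfolding degree_density_def
  by (intro continuous_intros continuous_bump[THEN continuous_on_compose2, OF _ subset_UNIV]
      continuous_on_det continuous_on_poly_map[OF g] continuous_on_jac[OF g])

text \<open>Near a frontier point the function vanishes on both sides, because \<open>g\<close> is larger than 1 there;
hence cutting off at the frontier of \<open>D\<close> does not destroy differentiability.\<close>

lemma restrict_0_deriv:
  fixes G :: "'a::real_normed_vector \<Rightarrow> real"
  assumes D: "open D" and g: "continuous_on UNIV g"
    and bdry: "\<And>x. x \<in> frontier D \<Longrightarrow> 1 < norm (g x)"
    and G0: "\<And>x. 1 \<le> norm (g x) \<Longrightarrow> G x = 0" "1 \<le> norm (g x) \<Longrightarrow> G' = 0"
    and G: "((\<lambda>s. G (x + s *\<^sub>R e)) has_real_derivative G') (at 0)"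
  shows "((\<lambda>s. if x + s *\<^sub>R e \<in> D then G (x + s *\<^sub>R e) else 0) has_real_derivative
      (if x \<in> D then G' else 0)) (at 0)"
proof -
  have vimage: "open ((\<lambda>s. x + s *\<^sub>R e) -` S)" if "open S" for S
    by (rule open_vimage[OF that]) (intro continuous_intros)
  consider "x \<in> D" | "x \<in> frontier D" "x \<notin> D" | "x \<in> - closure D"
    using interior_open[OF D] by (auto simp: frontier_def)
  then show ?thesis
  proof cases
    case 1
    then show ?thesis
      using has_field_derivative_transform_within_open[OF G vimage[OF D]] by simp
  next
    case 2
    let ?S = "{x. 1 < norm (g x)}"
    have "open ?S" by (rule open_Collect_less) (intro continuous_intros g)+
    then have "((\<lambda>s. if x + s *\<^sub>R e \<in> D then G (x + s *\<^sub>R e) else 0) has_real_derivative 0) (at 0)"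
      by (intro has_field_derivative_transform_within_open[OF DERIV_const[of 0] vimage[of ?S]])
         (use 2 bdry G0(1) in auto)
    with 2 show ?thesis by simp
  next
    case 3
    have "((\<lambda>s. if x + s *\<^sub>R e \<in> D then G (x + s *\<^sub>R e) else 0) has_real_derivative 0) (at 0)"
      by (intro has_field_derivative_transform_within_open[OF DERIV_const[of 0] vimage[of "- closure D"]])
         (use 3 closure_subset in auto)
    with 3 closure_subset show ?thesis by auto
  qed
qed

lemma integral_dflux_eq_0:
  fixes g v :: "real^'n \<Rightarrow> real^'n"
  assumes D: "open D" "bounded D" and g: "poly_map g" and v: "poly_map v"
    and bdry: "\<And>x. x \<in> frontier D \<Longrightarrow> 1 < norm (g x)"
  shows "integral UNIV (\<lambda>x. if x \<in> D then dflux g v i x else 0) = 0"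
proof -
  obtain a b where ab: "D \<subseteq> cbox a b" using bounded_subset_cbox_symmetric[OF D(2)] by metis
  have dflux: "continuous_on S (dflux g v i)" for S
    by (rule continuous_on_dflux'[OF g v])
  have vanish: "flux g v i x = 0" "dflux g v i x = 0" if "1 \<le> norm (g x)" for x
    using that by (auto simp: flux_def dflux_def bump_eq_0)
  show ?thesis
  proof (rule integral_directional_derivative_eq_0[where e="axis i 1"])
    show "continuous_on UNIV (\<lambda>x. if x \<in> D then flux g v i x else 0)"
      by (rule continuous_on_restrict_0'[OF D(1) continuous_on_flux[OF g v]])
         (use bdry vanish in \<open>auto simp: less_imp_le\<close>)
    show "continuous_on UNIV (\<lambda>x. if x \<in> D then dflux g v i x else 0)"
      by (rule continuous_on_restrict_0'[OF D(1) dflux])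
         (use bdry vanish in \<open>auto simp: less_imp_le\<close>)
    show "((\<lambda>s. if x + s *\<^sub>R axis i 1 \<in> D then flux g v i (x + s *\<^sub>R axis i 1) else 0)
       has_real_derivative (if x \<in> D then dflux g v i x else 0)) (at 0)" for x
      by (rule restrict_0_deriv[OF D(1) continuous_on_poly_map[OF g] bdry _ _ flux_deriv[OF g v]])
         (use vanish in auto)
  qed (use ab in auto)
qed

text \<open>The derivative of the integral with respect to \<open>t\<close> is the integral of a divergence, which vanishes
since \<open>g\<close> leaves the support of the bump function before it reaches the frontier.\<close>

lemma degree_integral_homotopy:
  fixes p v :: "real^'n \<Rightarrow> real^'n"
  assumes D: "open D" "bounded D" and p: "poly_map p" and v: "poly_map v"
    and bdry: "\<And>t x. t \<in> {0..1} \<Longrightarrow> x \<in> frontier D \<Longrightarrow> 1 < norm (p x + t *\<^sub>R v x)"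
  shows "degree_integral (\<lambda>x. p x + v x) D = degree_integral p D"
proof -
  obtain a b where ab: "D \<subseteq> cbox a b" using bounded_subset_cbox_symmetric[OF D(2)] by metis
  define g where "g t x = p x + t *\<^sub>R v x" for t x
  have g: "poly_map (g t)" for t unfolding g_def by (rule poly_map_add_scaleR[OF p v])
  define G where "G t x = (if x \<in> D then degree_density (g t) x else 0)" for t x
  define G' where "G' t x = (if x \<in> D then (\<Sum>i\<in>UNIV. dflux (g t) v i x) else 0)" for t x
  have bdry': "1 \<le> norm (g t x)" if "t \<in> {0..1}" "x \<in> frontier D" for t x
    using bdry[OF that] by (simp add: g_def)
  have contG: "continuous_on UNIV (G t)" if "t \<in> {0..1}" for t
    unfolding G_def
    by (rule continuous_on_restrict_0'[OF D(1) continuous_on_density[OF g]])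
       (use bdry'[OF that] in \<open>simp add: degree_density_def bump_eq_0\<close>)
  have contG': "continuous_on ({0..1} \<times> UNIV) (\<lambda>(t, x). G' t x)"
    unfolding G'_def
  proof (rule continuous_on_restrict_0[OF D(1)])
    show "continuous_on ({0..1} \<times> closure D) (\<lambda>(t, x). \<Sum>i\<in>UNIV. dflux (g t) v i x)"
      using continuous_on_sum[of UNIV _ "\<lambda>i (t, x). dflux (g t) v i x"] continuous_on_dflux[OF p v]
      unfolding g_def split_beta by blast
  qed (use bdry' in \<open>auto simp: dflux_def bump_eq_0\<close>)
  have int: "integral (cbox a b) F = integral UNIV F" if "continuous_on UNIV F" "\<And>x. x \<notin> D \<Longrightarrow> F x = 0"
    for F :: "real^'n \<Rightarrow> real"
    by (rule integral_unique[symmetric], rule has_integral_cbox_of_support) (use that ab in auto)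
  have "((\<lambda>t. integral (cbox a b) (G t)) has_real_derivative 0) (at t within {0..1})"
    if t: "t \<in> {0..1}" for t
  proof -
    have "((\<lambda>t. integral (cbox a b) (G t)) has_real_derivative integral (cbox a b) (G' t)) (at t within {0..1})"
    proof (rule leibniz_rule_field_derivative)
      show "((\<lambda>t. G t x) has_real_derivative G' t x) (at t within {0..1})" for t x
        using degree_density_deriv[OF p v, of x t]
        by (auto simp: G_def G'_def g_def[abs_def] intro: has_field_derivative_at_within)
      show "G t integrable_on cbox a b" if "t \<in> {0..1}" for t
        using contG[OF that] continuous_on_subset integrable_continuous by blast
      show "continuous_on ({0..1} \<times> cbox a b) (\<lambda>(t, x). G' t x)"
        using contG' continuous_on_subset by (metis Sigma_mono order_refl subset_UNIV)
    qed (use t in auto)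
    moreover have "integral (cbox a b) (G' t) = 0"
    proof -
      have cont: "continuous_on UNIV (\<lambda>x. if x \<in> D then dflux (g t) v i x else 0)" for i
        by (rule continuous_on_restrict_0'[OF D(1) continuous_on_dflux'[OF g v]])
           (use bdry'[OF t] in \<open>simp add: dflux_def bump_eq_0\<close>)
      have "G' t = (\<lambda>x. \<Sum>i\<in>UNIV. if x \<in> D then dflux (g t) v i x else 0)"
        by (auto simp: G'_def)
      then have "integral (cbox a b) (G' t) = (\<Sum>i\<in>UNIV. integral (cbox a b) (\<lambda>x. if x \<in> D then dflux (g t) v i x else 0))"
        by (simp, intro integral_sum) (auto intro!: integrable_continuous continuous_on_subset[OF cont])
      also have "\<dots> = 0"
        using integral_dflux_eq_0[OF D g v] bdry[OF t] int[OF cont] by (simp add: g_def)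
      finally show ?thesis .
    qed
    ultimately show ?thesis by simp
  qed
  then have "integral (cbox a b) (G 1) = integral (cbox a b) (G 0)"
    using has_field_derivative_zero_constant[of "{0..1}" "\<lambda>t. integral (cbox a b) (G t)"]
    by (metis atLeastAtMost_iff convex_real_interval(5) order_refl zero_le_one)
  moreover have "integral (cbox a b) (G t) = degree_integral (g t) D" if "t \<in> {0..1}" for t
    using int[OF contG[OF that]] by (simp add: degree_integral_def G_def[abs_def])
  ultimately show ?thesis by (simp add: g_def[abs_def])
qed

section \<open>The degree of a continuous map\<close>

text \<open>The map is first scaled to have norm at least 3 on the frontier and then approximated up to an
error of 1.  Then a segment between two approximants keeps distance at least 2 from the
origin over the frontier, which is outside the support of the bump function.\<close>

definition approximates :: "(real^'n \<Rightarrow> real^'n) \<Rightarrow> (real^'n) set \<Rightarrow> (real^'n \<Rightarrow> real^'n) \<Rightarrow> bool"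
  where "approximates f D p \<longleftrightarrow> poly_map p \<and>
    (\<exists>c>0. (\<forall>x\<in>frontier D. 3 \<le> c * norm (f x)) \<and> (\<forall>x\<in>closure D. norm (p x - c *\<^sub>R f x) \<le> 1))"

text \<open>The denominator makes the degree of the identity equal to 1.  The values are real numbers; that
they are integers for maps with regular zeros is a consequence of \<open>mapping_degree_eq_sum_sgn\<close>.\<close>

definition mapping_degree :: "(real^'n \<Rightarrow> real^'n) \<Rightarrow> (real^'n) set \<Rightarrow> real"
  where "mapping_degree f D =
    degree_integral (SOME p. approximates f D p) D / integral UNIV (bump :: real^'n \<Rightarrow> real)"

definition degree_defined :: "(real^'n \<Rightarrow> real^'n) \<Rightarrow> (real^'n) set \<Rightarrow> bool"
  where "degree_defined f D \<longleftrightarrow>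
    open D \<and> bounded D \<and> continuous_on (closure D) f \<and> (\<forall>x\<in>frontier D. f x \<noteq> 0)"

lemma poly_map_diff:
  assumes "poly_map p" "poly_map q" shows "poly_map (\<lambda>x. p x - q x)"
  using assms by (simp add: real_polynomial_function_diff)

lemma exists_poly_map_near:
  assumes "compact S" "continuous_on S f" "0 < e"
  obtains p :: "real^'n \<Rightarrow> real^'n" where "poly_map p" "\<And>x. x \<in> S \<Longrightarrow> norm (p x - f x) \<le> e"
proof -
  obtain p where p: "polynomial_function p" "\<And>x. x \<in> S \<Longrightarrow> norm (f x - p x) < e"
    using Stone_Weierstrass_polynomial_function[OF assms] by blast
  have "poly_map p"
    using p(1) bounded_linear_vec_nth unfolding polynomial_function_def by (auto simp: o_def)
  then show ?thesis using p(2) by (intro that[of p]) (auto simp: norm_minus_commute less_imp_le)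
qed

lemma exists_scale_ge_3:
  fixes f :: "'a::topological_space \<Rightarrow> 'b::real_normed_vector"
  assumes "compact K" "continuous_on K f" "\<And>x. x \<in> K \<Longrightarrow> f x \<noteq> 0"
  obtains c where "c > 0" "\<And>x. x \<in> K \<Longrightarrow> 3 \<le> c * norm (f x)"
proof (cases "K = {}")
  case True then show ?thesis using that[of 1] by simp
next
  case False
  then obtain x0 where x0: "x0 \<in> K" "\<And>x. x \<in> K \<Longrightarrow> norm (f x0) \<le> norm (f x)"
    using continuous_attains_inf[OF assms(1), of "\<lambda>x. norm (f x)"] assms(2) continuous_on_norm by blast
  have "norm (f x0) > 0" using assms(3) x0(1) by simp
  then show ?thesis
    using x0(2) by (intro that[of "3 / norm (f x0)"]) (auto simp: field_simps)
qed

text \<open>In the applications \<open>K\<close> is the complement in the closure of \<open>D\<close> of small balls about the zeros of \<open>f\<close>,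
so that the density of \<open>p\<close> vanishes outside these balls.\<close>

lemma exists_common_approximation:
  assumes "degree_defined f D" "compact K" "K \<subseteq> closure D" "frontier D \<subseteq> K" "\<And>x. x \<in> K \<Longrightarrow> f x \<noteq> 0"
  shows "\<exists>c>0. \<exists>p. poly_map p \<and> (\<forall>x\<in>K. 3 \<le> c * norm (f x)) \<and>
    (\<forall>x\<in>closure D. norm (p x - c *\<^sub>R f x) \<le> 1)"
proof -
  have f: "continuous_on (closure D) f" "compact (closure D)"
    using assms(1) by (auto simp: degree_defined_def)
  obtain c where c: "c > 0" "\<And>x. x \<in> K \<Longrightarrow> 3 \<le> c * norm (f x)"
    using exists_scale_ge_3[OF assms(2) continuous_on_subset[OF f(1) assms(3)] assms(5)] by blast
  obtain p where "poly_map p" "\<And>x. x \<in> closure D \<Longrightarrow> norm (p x - c *\<^sub>R f x) \<le> 1"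
    using exists_poly_map_near[OF f(2) continuous_on_scaleR[OF continuous_on_const f(1)] zero_less_one]
    by blast
  with c show ?thesis by blast
qed

lemma frontier_subset_closure: "frontier D \<subseteq> closure D"
  by (auto simp: frontier_def)

lemma degree_integral_segment:
  assumes D: "open D" "bounded D" and p: "poly_map p" and q: "poly_map q"
    and bdry: "\<And>t x. t \<in> {0..1} \<Longrightarrow> x \<in> frontier D \<Longrightarrow>
      \<exists>z. 3 \<le> norm z \<and> norm ((1 - t) *\<^sub>R p x + t *\<^sub>R q x - z) \<le> 1"
  shows "degree_integral p D = degree_integral q D"
proof -
  have "1 < norm (p x + t *\<^sub>R (q x - p x))" if "t \<in> {0..1}" "x \<in> frontier D" for t x
  proof -
    have "p x + t *\<^sub>R (q x - p x) = (1 - t) *\<^sub>R p x + t *\<^sub>R q x" by (simp add: algebra_simps)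
    moreover obtain z where "3 \<le> norm z" "norm ((1 - t) *\<^sub>R p x + t *\<^sub>R q x - z) \<le> 1"
      using bdry[OF \<open>t \<in> {0..1}\<close> \<open>x \<in> frontier D\<close>] by blast
    ultimately show ?thesis
      using norm_triangle_ineq4[of "(1 - t) *\<^sub>R p x + t *\<^sub>R q x" "(1 - t) *\<^sub>R p x + t *\<^sub>R q x - z"] by simp
  qed
  from degree_integral_homotopy[OF D p poly_map_diff[OF q p] this]
  show ?thesis by simp
qed

lemma convex_combination_near:
  fixes p q f g :: "'a::real_normed_vector"
  assumes "t \<in> {0..1}" "norm (p - f) \<le> 1" "norm (q - g) \<le> 1"
  shows "norm ((1 - t) *\<^sub>R p + t *\<^sub>R q - ((1 - t) *\<^sub>R f + t *\<^sub>R g)) \<le> 1"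
proof -
  have "norm ((1 - t) *\<^sub>R p + t *\<^sub>R q - ((1 - t) *\<^sub>R f + t *\<^sub>R g))
      = norm ((1 - t) *\<^sub>R (p - f) + t *\<^sub>R (q - g))" by (simp add: algebra_simps)
  also have "\<dots> \<le> (1 - t) * norm (p - f) + t * norm (q - g)"
    using norm_triangle_ineq[of "(1 - t) *\<^sub>R (p - f)" "t *\<^sub>R (q - g)"] assms(1) by simp
  also have "\<dots> \<le> 1" using assms by (intro convex_bound_le) auto
  finally show ?thesis .
qed

lemma degree_integral_unique:
  assumes f: "degree_defined f D" and p: "approximates f D p" and q: "approximates f D q"
  shows "degree_integral p D = degree_integral q D"
proof -
  obtain c where c: "c > 0" "\<And>x. x \<in> frontier D \<Longrightarrow> 3 \<le> c * norm (f x)"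
    "\<And>x. x \<in> closure D \<Longrightarrow> norm (p x - c *\<^sub>R f x) \<le> 1" using p by (auto simp: approximates_def)
  obtain d where d: "d > 0" "\<And>x. x \<in> frontier D \<Longrightarrow> 3 \<le> d * norm (f x)"
    "\<And>x. x \<in> closure D \<Longrightarrow> norm (q x - d *\<^sub>R f x) \<le> 1" using q by (auto simp: approximates_def)
  show ?thesis
  proof (rule degree_integral_segment)
    fix t :: real and x assume t: "t \<in> {0..1}" and x: "x \<in> frontier D"
    let ?z = "(1 - t) *\<^sub>R (c *\<^sub>R f x) + t *\<^sub>R (d *\<^sub>R f x)"
    have "?z = ((1 - t) * c + t * d) *\<^sub>R f x" by (simp add: algebra_simps)
    moreover have "0 \<le> (1 - t) * c + t * d" using t c(1) d(1) by simp
    ultimately have "norm ?z = ((1 - t) * c + t * d) * norm (f x)" by (simp only: norm_scaleR abs_of_nonneg)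
    then have "norm ?z = (1 - t) * (c * norm (f x)) + t * (d * norm (f x))" by (simp add: algebra_simps)
    also have "\<dots> \<ge> (1 - t) * 3 + t * 3"
      using t c(2)[OF x] d(2)[OF x] by (intro add_mono mult_left_mono) auto
    finally have "3 \<le> norm ?z" by simp
    moreover have "norm ((1 - t) *\<^sub>R p x + t *\<^sub>R q x - ?z) \<le> 1"
      using convex_combination_near[OF t c(3) d(3)] x by (auto simp: frontier_def)
    ultimately show "\<exists>z. 3 \<le> norm z \<and> norm ((1 - t) *\<^sub>R p x + t *\<^sub>R q x - z) \<le> 1" by blast
  qed (use f p q in \<open>auto simp: degree_defined_def approximates_def\<close>)
qed

lemma mapping_degree_eq:
  fixes f :: "real^'n \<Rightarrow> real^'n"
  assumes "degree_defined f D" "approximates f D p"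
  shows "mapping_degree f D = degree_integral p D / integral UNIV (bump :: real^'n \<Rightarrow> real)"
  unfolding mapping_degree_def
  using degree_integral_unique[OF assms(1) someI[of "approximates f D", OF assms(2)] assms(2)] by simp

lemma mapping_degree_cong:
  assumes "\<And>x. x \<in> closure D \<Longrightarrow> f x = g x"
  shows "mapping_degree f D = mapping_degree g D"
proof -
  have "approximates f D = approximates g D"
  proof
    have "f x = g x" if "x \<in> frontier D" for x using assms that frontier_subset_closure by blast
    then show "approximates f D p = approximates g D p" for p
      using assms by (simp add: approximates_def)
  qed
  then show ?thesis by (simp add: mapping_degree_def)
qed

text \<open>One scaling factor serves all maps of the segment, by compactness; then approximants of the two
end points are joined by a segment of approximants.\<close>

lemma mapping_degree_segment:
  assumes f: "degree_defined f D" and g: "degree_defined g D"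
    and bdry: "\<And>t x. t \<in> {0..1} \<Longrightarrow> x \<in> frontier D \<Longrightarrow> (1 - t) *\<^sub>R f x + t *\<^sub>R g x \<noteq> 0"
  shows "mapping_degree f D = mapping_degree g D"
proof -
  have D: "open D" "bounded D" and cont: "continuous_on (closure D) f" "continuous_on (closure D) g"
    using f g by (auto simp: degree_defined_def)
  let ?K = "{0..1::real} \<times> frontier D" and ?h = "\<lambda>z. (1 - fst z) *\<^sub>R f (snd z) + fst z *\<^sub>R g (snd z)"
  have K: "compact ?K" using D(2) by (intro compact_Times) (auto simp: compact_frontier_bounded)
  have h: "continuous_on ?K ?h"
    by (intro continuous_intros continuous_on_compose2[OF cont(1)] continuous_on_compose2[OF cont(2)])
       (auto simp: frontier_def)
  have "?h z \<noteq> 0" if "z \<in> ?K" for z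
    using bdry[of "fst z" "snd z"] that by auto
  from exists_scale_ge_3[OF K h this]
  obtain c where c: "c > 0" "\<And>z. z \<in> ?K \<Longrightarrow> 3 \<le> c * norm (?h z)" by blast
  obtain p where p: "poly_map p" "\<And>x. x \<in> closure D \<Longrightarrow> norm (p x - c *\<^sub>R f x) \<le> 1"
    using exists_poly_map_near[OF compact_closure[THEN iffD2, OF D(2)]
        continuous_on_scaleR[OF continuous_on_const cont(1)] zero_less_one] by blast
  obtain q where q: "poly_map q" "\<And>x. x \<in> closure D \<Longrightarrow> norm (q x - c *\<^sub>R g x) \<le> 1"
    using exists_poly_map_near[OF compact_closure[THEN iffD2, OF D(2)]
        continuous_on_scaleR[OF continuous_on_const cont(2)] zero_less_one] by blast
  have "approximates f D p"
    unfolding approximates_def using p c(1) c(2)[of "(0, _)"] by auto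
  moreover have "approximates g D q"
    unfolding approximates_def using q c(1) c(2)[of "(1, _)"] by auto
  moreover have "degree_integral p D = degree_integral q D"
  proof (rule degree_integral_segment[OF D p(1) q(1)])
    fix t :: real and x assume t: "t \<in> {0..1}" and x: "x \<in> frontier D"
    let ?z = "(1 - t) *\<^sub>R (c *\<^sub>R f x) + t *\<^sub>R (c *\<^sub>R g x)"
    have "?z = c *\<^sub>R ?h (t, x)" by (simp add: algebra_simps)
    then have "3 \<le> norm ?z" using c(1) c(2)[of "(t, x)"] t x by simp
    moreover have "norm ((1 - t) *\<^sub>R p x + t *\<^sub>R q x - ?z) \<le> 1"
      using convex_combination_near[OF t p(2) q(2)] x by (auto simp: frontier_def)
    ultimately show "\<exists>z. 3 \<le> norm z \<and> norm ((1 - t) *\<^sub>R p x + t *\<^sub>R q x - z) \<le> 1" by blast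
  qed
  ultimately show ?thesis by (simp add: mapping_degree_eq[OF f] mapping_degree_eq[OF g])
qed

text \<open>By uniform continuity the homotopy can be divided into finitely many steps that are so short that
each of them may be replaced by a segment.\<close>

lemma mapping_degree_homotopy:
  fixes h :: "real \<Rightarrow> real^'n \<Rightarrow> real^'n"
  assumes D: "open D" "bounded D"
    and h: "continuous_on ({0..1} \<times> closure D) (\<lambda>(t, x). h t x)"
    and bdry: "\<And>t x. t \<in> {0..1} \<Longrightarrow> x \<in> frontier D \<Longrightarrow> h t x \<noteq> 0"
  shows "mapping_degree (h 0) D = mapping_degree (h 1) D"
proof -
  have cont: "continuous_on (closure D) (h t)" if "t \<in> {0..1}" for t
  proof -
    have "continuous_on (closure D) (\<lambda>x. (\<lambda>(t, x). h t x) (t, x))"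
      by (rule continuous_on_compose2[OF h]) (use that in \<open>auto intro!: continuous_intros\<close>)
    then show ?thesis by simp
  qed
  then have defined: "degree_defined (h t) D" if "t \<in> {0..1}" for t
    using D bdry that by (auto simp: degree_defined_def)
  have K: "compact ({0..1::real} \<times> frontier D)"
    using D(2) by (intro compact_Times) (auto simp: compact_frontier_bounded)
  have h': "continuous_on ({0..1} \<times> frontier D) (\<lambda>(t, x). h t x)"
    using h by (rule continuous_on_subset) (auto simp: frontier_def)
  have "(\<lambda>(t, x). h t x) z \<noteq> 0" if "z \<in> {0..1} \<times> frontier D" for z
    using bdry[of "fst z" "snd z"] that by auto
  from exists_scale_ge_3[OF K h' this] obtain c where c: "c > 0"
    "\<And>z. z \<in> {0..1} \<times> frontier D \<Longrightarrow> 3 \<le> c * norm ((\<lambda>(t, x). h t x) z)" by blast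
  have "uniformly_continuous_on ({0..1} \<times> closure D) (\<lambda>(t, x). h t x)"
    by (rule compact_uniformly_continuous[OF h]) (use D(2) in \<open>auto intro!: compact_Times\<close>)
  then obtain d where d: "d > 0" "\<And>z z'. z \<in> {0..1} \<times> closure D \<Longrightarrow> z' \<in> {0..1} \<times> closure D \<Longrightarrow>
      dist z' z < d \<Longrightarrow> dist ((\<lambda>(t, x). h t x) z') ((\<lambda>(t, x). h t x) z) < 1 / c"
    using c(1) unfolding uniformly_continuous_on_def by (metis zero_less_divide_1_iff)
  have step: "mapping_degree (h s) D = mapping_degree (h t) D"
    if s: "s \<in> {0..1}" and t: "t \<in> {0..1}" and st: "\<bar>s - t\<bar> < d" for s t
  proof (rule mapping_degree_segment[OF defined[OF s] defined[OF t]])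
    fix u :: real and x assume u: "u \<in> {0..1}" and x: "x \<in> frontier D"
    have "dist (h t x) (h s x) < 1 / c"
      using d(2)[of "(s, x)" "(t, x)"] s t st x frontier_subset_closure[of D]
      by (auto simp: dist_Pair_Pair dist_real_def abs_minus_commute)
    then have "u * norm (h t x - h s x) < 1 / c"
      using u mult_left_le_one_le[of "norm (h t x - h s x)" u] by (simp add: dist_norm)
    moreover have "3 / c \<le> norm (h s x)"
      using c(1) c(2)[of "(s, x)"] s x by (simp add: field_simps)
    moreover have "1 / c \<le> 3 / c" using c(1) by (simp add: field_simps)
    ultimately have "norm (u *\<^sub>R (h t x - h s x)) < norm (h s x)" using u by simp
    then have "h s x + u *\<^sub>R (h t x - h s x) \<noteq> 0"
      by (metis add_eq_0_iff norm_minus_cancel less_irrefl)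
    then show "(1 - u) *\<^sub>R h s x + u *\<^sub>R h t x \<noteq> 0" by (simp add: algebra_simps)
  qed
  obtain n :: nat where n: "1 / d < real n" using reals_Archimedean2 by blast
  then have "n > 0" using d(1) by (metis gr0I of_nat_0 not_less_iff_gr_or_eq zero_less_divide_1_iff)
  have "mapping_degree (h 0) D = mapping_degree (h (real k / real n)) D" if "k \<le> n" for k
    using that
  proof (induction k)
    case (Suc k)
    have "\<bar>real k / real n - real (Suc k) / real n\<bar> = 1 / real n"
      using \<open>n > 0\<close> by (simp add: field_simps)
    moreover have "1 / real n < d" using n d(1) \<open>n > 0\<close> by (simp add: field_simps)
    ultimately show ?case
      using Suc step[of "real k / real n" "real (Suc k) / real n"] \<open>n > 0\<close> by simp
  qed simp
  from this[of n] \<open>n > 0\<close> show ?thesis by simp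
qed

section \<open>The degree as a signed count of zeros\<close>

lemma has_integral_restrict_density:
  fixes p :: "real^'n \<Rightarrow> real^'n"
  assumes "open D" "bounded D" "poly_map p" "\<And>x. x \<in> frontier D \<Longrightarrow> 1 \<le> norm (p x)"
  shows "((\<lambda>x. if x \<in> D then degree_density p x else 0) has_integral degree_integral p D) UNIV"
proof -
  obtain a b where ab: "D \<subseteq> cbox a b" using bounded_subset_cbox_symmetric[OF assms(2)] by metis
  have "continuous_on UNIV (\<lambda>x. if x \<in> D then degree_density p x else 0)"
    by (rule continuous_on_restrict_0'[OF assms(1) continuous_on_density[OF assms(3)]])
       (use assms(4) in \<open>simp add: degree_density_def bump_eq_0\<close>)
  from has_integral_cbox_of_support[OF this, of a b] ab show ?thesis
    unfolding degree_integral_def by (metis (no_types, lifting) integral_unique subsetD)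
qed

text \<open>If a polynomial map approximates \<open>f\<close> and is larger than 1 outside the balls, the density
vanishes there, and the integral splits into the integrals over the balls.\<close>

lemma mapping_degree_additive:
  fixes f :: "real^'n \<Rightarrow> real^'n"
  assumes f: "degree_defined f D" and X: "finite X" "0 < r"
    and balls: "\<And>x. x \<in> X \<Longrightarrow> cball x r \<subseteq> D"
      "\<And>x y. x \<in> X \<Longrightarrow> y \<in> X \<Longrightarrow> x \<noteq> y \<Longrightarrow> ball x r \<inter> ball y r = {}"
    and zeros: "\<And>x. x \<in> D \<Longrightarrow> f x = 0 \<Longrightarrow> x \<in> (\<Union>a\<in>X. ball a r)"
  shows "mapping_degree f D = (\<Sum>a\<in>X. mapping_degree f (ball a r))"
proof -
  have D: "open D" "bounded D" "continuous_on (closure D) f" "\<And>x. x \<in> frontier D \<Longrightarrow> f x \<noteq> 0"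
    using f by (auto simp: degree_defined_def)
  define K where "K = closure D - (\<Union>a\<in>X. ball a r)"
  have frontier_ball: "frontier (ball a r) \<subseteq> K" if "a \<in> X" for a
  proof
    fix x assume "x \<in> frontier (ball a r)"
    then have ax: "dist a x = r" using X(2) by (simp add: frontier_ball sphere_def)
    have "x \<notin> ball b r" if "b \<in> X" for b
    proof
      assume x: "x \<in> ball b r"
      with ax have "a \<noteq> b" by auto
      then have "ball a r \<inter> ball b r = {}" using balls(2) \<open>a \<in> X\<close> \<open>b \<in> X\<close> by blast
      then have "closure (ball a r) \<inter> ball b r = {}" by (simp add: open_Int_closure_eq_empty inf_commute)
      moreover have "x \<in> closure (ball a r)" using ax X(2) by simp
      ultimately show False using x by blast
    qed
    moreover have "x \<in> closure D" using balls(1)[OF that] ax closure_subset by fastforce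
    ultimately show "x \<in> K" by (auto simp: K_def)
  qed
  have K: "compact K" unfolding K_def using D(2) by (intro compact_diff) auto
  have frontier_D: "frontier D \<subseteq> K"
  proof
    fix x assume "x \<in> frontier D"
    then have "x \<in> closure D" "x \<notin> D" using interior_open[OF D(1)] by (auto simp: frontier_def)
    moreover have "ball a r \<subseteq> D" if "a \<in> X" for a using balls(1)[OF that] ball_subset_cball by blast
    ultimately show "x \<in> K" unfolding K_def by blast
  qed
  have K_closure: "K \<subseteq> closure D" unfolding K_def by blast
  have fK: "f x \<noteq> 0" if "x \<in> K" for x
    using that zeros[of x] D(4)[of x] interior_open[OF D(1)] by (auto simp: K_def frontier_def)
  obtain c p where c: "c > 0" and p: "poly_map p" and cK: "\<forall>x\<in>K. 3 \<le> c * norm (f x)"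
    and near: "\<forall>x\<in>closure D. norm (p x - c *\<^sub>R f x) \<le> 1"
    using exists_common_approximation[OF f K K_closure frontier_D fK] by blast
  have pK: "1 \<le> norm (p x)" if "x \<in> K" for x
    using norm_triangle_ineq2[of "c *\<^sub>R f x" "c *\<^sub>R f x - p x"] c bspec[OF cK that] bspec[OF near, of x] that
    by (auto simp: K_def norm_minus_commute)
  have ball_D: "closure (ball a r) \<subseteq> closure D" if "a \<in> X" for a
    using balls(1)[OF that] closure_subset X(2) by fastforce
  have "degree_integral p D = (\<Sum>a\<in>X. degree_integral p (ball a r))"
  proof -
    have "((\<lambda>x. \<Sum>a\<in>X. if x \<in> ball a r then degree_density p x else 0) has_integral
        (\<Sum>a\<in>X. degree_integral p (ball a r))) UNIV"
      by (intro has_integral_sum X(1) has_integral_restrict_density) (use p pK frontier_ball in auto)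
    moreover have "(\<Sum>a\<in>X. if x \<in> ball a r then degree_density p x else 0) =
        (if x \<in> D then degree_density p x else 0)" for x
    proof (cases "x \<in> (\<Union>a\<in>X. ball a r)")
      case True
      then obtain a where a: "a \<in> X" "x \<in> ball a r" by blast
      then have "x \<notin> ball b r" if "b \<in> X - {a}" for b using balls(2)[of a b] that by blast
      then have "(\<Sum>b\<in>X. if x \<in> ball b r then degree_density p x else 0) = degree_density p x"
        using a X(1) by (subst sum.remove[of _ a]) (auto intro!: sum.neutral)
      moreover have "x \<in> D" using a balls(1) ball_subset_cball by blast
      ultimately show ?thesis by simp
    next
      case False
      then have "x \<in> D \<Longrightarrow> degree_density p x = 0"
        using pK[of x] closure_subset[of D] by (auto simp: K_def degree_density_def bump_eq_0)
      with False show ?thesis by (auto intro!: sum.neutral)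
    qed
    ultimately have "((\<lambda>x. if x \<in> D then degree_density p x else 0) has_integral
        (\<Sum>a\<in>X. degree_integral p (ball a r))) UNIV" by (simp only:)
    moreover have "((\<lambda>x. if x \<in> D then degree_density p x else 0) has_integral degree_integral p D) UNIV"
      by (rule has_integral_restrict_density[OF D(1,2) p]) (use pK frontier_D in blast)
    ultimately show ?thesis by (rule has_integral_unique[symmetric])
  qed
  moreover have "approximates f D p"
    unfolding approximates_def using c p cK near frontier_D by blast
  moreover have "approximates f (ball a r) p" if "a \<in> X" for a
    unfolding approximates_def using c p cK near frontier_ball[OF that] ball_D[OF that] by blast
  moreover have "degree_defined f (ball a r)" if "a \<in> X" for a
    unfolding degree_defined_def
    using frontier_ball[OF that] fK continuous_on_subset[OF D(3) ball_D[OF that]] by auto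
  ultimately show ?thesis
    using f by (simp add: mapping_degree_eq[of f _ p] sum_divide_distrib)
qed

lemma bump_integral_linear:
  fixes B :: "real^'n::{finite,wellorder}^'n::{finite,wellorder}"
  assumes det: "det B \<noteq> 0"
  shows "(\<lambda>x. bump (B *v (x - a))) integrable_on UNIV \<and> 
     \<bar>det B\<bar> * integral UNIV (\<lambda>x. bump (B *v (x - a))) = integral UNIV (bump :: real^'n::{finite,wellorder} \<Rightarrow> real)"
proof -
  let ?g = "\<lambda>x. B *v (x - a)" and ?f = "\<lambda>y::real^'n::_. (\<chi> i::1. bump y) :: real^1"
  have "bump integrable_on (UNIV :: (real^'n::_) set)"
  proof -
    obtain c d :: "real^'n::_" where cd: "ball 0 1 \<subseteq> cbox c d"
      using bounded_subset_cbox_symmetric[OF bounded_ball] by metis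
    show ?thesis
      using has_integral_cbox_of_support[OF continuous_bump(1), of c d] cd bump_eq_0(1)
      by (metis has_integral_integrable mem_ball_0 not_less subsetD)
  qed
  then have bump_abs: "bump absolutely_integrable_on (UNIV :: (real^'n::_) set)"
    by (rule nonnegative_absolutely_integrable_1) (simp add: bump_def)
  have abs: "?f absolutely_integrable_on UNIV"
  proof (rule absolutely_integrable_componentwise)
    fix b :: "real^1" assume "b \<in> Basis"
    then have "b = axis 1 1" by (auto simp: Basis_vec_def)
    then have "?f x \<bullet> b = bump x" for x by (simp add: inner_axis)
    with bump_abs show "(\<lambda>x. ?f x \<bullet> b) absolutely_integrable_on UNIV"
      by (simp only:)
  qed
  have inj: "inj ((*v) B)" using det det_nz_iff_inj[OF matrix_vector_mul_linear[of B]] by simp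
  then have "surj ((*v) B)" using linear_injective_imp_surjective[OF matrix_vector_mul_linear] by blast
  then have surj: "range ?g = UNIV"
    using surj_plus_right unfolding surj_def by (metis add_diff_cancel_right')
  have "(\<lambda>x. \<bar>det (matrix ((*v) B))\<bar> *\<^sub>R ?f (?g x)) absolutely_integrable_on UNIV \<and>
      integral UNIV (\<lambda>x. \<bar>det (matrix ((*v) B))\<bar> *\<^sub>R ?f (?g x)) = integral UNIV ?f"
  proof (subst has_absolute_integral_change_of_variables)
    show "(?g has_derivative (*v) B) (at x within UNIV)" for x
      by (auto intro!: derivative_eq_intros bounded_linear.has_derivative[OF matrix_vector_mul_bounded_linear]
          simp: matrix_vector_mult_diff_distrib)
    show "inj ?g" using injD[OF inj] by (metis (no_types, lifting) injI diff_add_cancel)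
  qed (use abs surj in auto)
  then have h: "(\<lambda>x. \<bar>det B\<bar> *\<^sub>R ?f (?g x)) integrable_on UNIV"
      "integral UNIV (\<lambda>x. \<bar>det B\<bar> *\<^sub>R ?f (?g x)) = integral UNIV ?f"
    by (auto simp: absolutely_integrable_on_def)
  have 1: "(\<lambda>x. (\<bar>det B\<bar> *\<^sub>R ?f (?g x)) $ 1) integrable_on UNIV"
    using integrable_linear[OF h(1) bounded_linear_vec_nth[of 1]] by (simp only: o_def)
  have "(\<lambda>x. bump (?g x)) integrable_on UNIV"
    using integrable_on_cmult_left[OF 1, of "1 / \<bar>det B\<bar>"] det by simp
  moreover have "integral UNIV (\<lambda>x. \<bar>det B\<bar> * bump (?g x)) = integral UNIV (\<lambda>y. ?f y $ 1)"
    using arg_cong[OF h(2), of "\<lambda>v. v $ 1"] abs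
    unfolding integral_component_eq_cart[OF h(1), symmetric]
    by (subst integral_component_eq_cart) (auto simp: absolutely_integrable_on_def)
  ultimately show ?thesis by simp
qed

lemma bump_integral_pos: "0 < integral UNIV (bump :: real^'n \<Rightarrow> real)"
proof -
  obtain a b :: "real^'n" where ab: "ball 0 1 \<subseteq> cbox a b" 
    using bounded_subset_cbox_symmetric[OF bounded_ball] by metis
  have "(bump has_integral integral (cbox a b) bump) (UNIV :: (real^'n) set)"
    by (rule has_integral_cbox_of_support[OF continuous_bump(1)])
       (use ab bump_eq_0(1) in \<open>metis mem_ball_0 not_less subsetD\<close>)
  moreover have "integral (cbox a b) (bump :: real^'n \<Rightarrow> real) \<noteq> 0"
  proof
    assume "integral (cbox a b) (bump :: real^'n \<Rightarrow> real) = 0"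
    moreover have "0 \<in> box a b"
      using interior_mono[OF ab] by (auto simp: interior_cbox)
    moreover from this have "box a b \<noteq> {}" "0 \<in> cbox a b" using box_subset_cbox by blast+
    ultimately have "bump (0 :: real^'n) = 0"
      using integral_cbox_eq_0_iff[of a b bump, OF continuous_bump(1)] by (auto simp: bump_def)
    then show False by (simp add: bump_def)
  qed
  moreover have "0 \<le> integral (cbox a b) (bump :: real^'n \<Rightarrow> real)"
    by (rule integral_nonneg) (auto simp: bump_def intro!: integrable_continuous continuous_bump(1)[unfolded bump_def])
  ultimately show ?thesis by (simp add: integral_unique)
qed

lemma matrix_lower_bound:
  fixes A :: "real^'n^'n"
  assumes "det A \<noteq> 0"
  obtains m where "0 < m" "\<And>h. m * norm h \<le> norm (A *v h)"
proof -
  have "inj ((*v) A)" using assms det_nz_iff_inj[OF matrix_vector_mul_linear[of A]] by simp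
  from linear_inj_bounded_below_pos[OF matrix_vector_mul_linear this] that
  show ?thesis by (metis mult.commute)
qed

lemma det_scaleR: "det (c *\<^sub>R A :: real^'n^'n) = c ^ CARD('n) * det A"
  by (simp add: det_def prod.distrib sum_distrib_left mult_ac)

text \<open>After scaling, \<open>bump (B *v (x - a))\<close> is supported in the ball, so that the integral may be taken
over the whole space and computed by a linear change of variables.\<close>

lemma mapping_degree_linear:
  fixes A :: "real^'n::{finite,wellorder}^'n::{finite,wellorder}"
  assumes A: "det A \<noteq> 0" and r: "0 < r"
  shows "degree_defined (\<lambda>x. A *v (x - a)) (ball a r)"
    and "mapping_degree (\<lambda>x. A *v (x - a)) (ball a r) = sgn (det A)"
proof -
  let ?f = "\<lambda>x. A *v (x - a)" and ?c = "integral UNIV (bump :: real^'n::_ \<Rightarrow> real)"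
  obtain m where m: "0 < m" "\<And>h. m * norm h \<le> norm (A *v h)" by (rule matrix_lower_bound[OF A]) blast
  have "continuous_on S ?f" for S
    by (intro continuous_intros bounded_linear.continuous_on[OF matrix_vector_mul_bounded_linear])
  moreover have "?f x \<noteq> 0" if "x \<in> frontier (ball a r)" for x
  proof
    assume "?f x = 0"
    then have "m * dist x a \<le> 0" using m(2)[of "x - a"] by (simp add: dist_norm)
    with that m(1) r show False by (simp add: dist_commute mult_le_0_iff)
  qed
  ultimately show defined: "degree_defined ?f (ball a r)" by (auto simp: degree_defined_def)
  define c where "c = 3 / (m * r)"
  have c: "0 < c" using m(1) r by (simp add: c_def)
  \<comment> \<open>the factor \<open>c\<close> makes \<open>B *v (x - a)\<close> at least 3 outside the ball\<close>
  define B where "B = c *\<^sub>R A"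
  have Bv: "B *v x = c *\<^sub>R (A *v x)" for x by (simp add: B_def scaleR_matrix_vector_assoc)
  have large: "3 \<le> norm (B *v (x - a))" if "r \<le> dist a x" for x
  proof -
    have "3 = c * (m * r)" using m(1) r by (simp add: c_def)
    also have "\<dots> \<le> c * (m * norm (x - a))"
      using that m(1) c by (intro mult_left_mono) (auto simp: dist_norm norm_minus_commute)
    also have "\<dots> \<le> norm (B *v (x - a))" using m(2)[of "x - a"] c by (simp add: Bv)
    finally show ?thesis .
  qed
  have lin: "real_polynomial_function (\<lambda>x. (B *v x) $ j)" for j
    by (intro real_polynomial_function.intros(1) bounded_linear_compose[OF bounded_linear_vec_nth]
        matrix_vector_mul_bounded_linear)
  have const: "real_polynomial_function (\<lambda>x. - ((B *v a) $ j))" for j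
    by (rule real_polynomial_function.intros(2))
  have split: "(B *v (x - a)) $ j = (B *v x) $ j + - ((B *v a) $ j)" for x j
    by (simp add: matrix_vector_mult_diff_distrib)
  have poly: "poly_map (\<lambda>x. B *v (x - a))"
    unfolding split using lin const real_polynomial_function.intros(3) by blast
  have "jac (\<lambda>x. B *v (x - a)) x = transpose B" for x
  proof -
    have pc: "partial (\<lambda>x. (B *v x) $ j) i = (\<lambda>x. B$j$i)" for i j
      using partial_linear[OF bounded_linear_compose[OF bounded_linear_vec_nth matrix_vector_mul_bounded_linear]]
      by (simp add: matrix_vector_mul_component inner_axis)
    show ?thesis
      unfolding vec_eq_iff jac_nth split partial_add[OF lin const] pc partial_const
      by (simp add: transpose_def)
  qed
  then have dens: "degree_density (\<lambda>x. B *v (x - a)) x = det B * bump (B *v (x - a))" for x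
    by (simp add: degree_density_def)
  have "approximates ?f (ball a r) (\<lambda>x. B *v (x - a))"
    unfolding approximates_def using poly c r large
    by (intro conjI exI[of _ c]) (auto simp: Bv)
  from mapping_degree_eq[OF defined this]
  have "mapping_degree ?f (ball a r) = degree_integral (\<lambda>x. B *v (x - a)) (ball a r) / ?c" .
  moreover have "degree_integral (\<lambda>x. B *v (x - a)) (ball a r) = sgn (det B) * ?c"
  proof -
    have "(if x \<in> ball a r then degree_density (\<lambda>x. B *v (x - a)) x else 0) = det B * bump (B *v (x - a))" for x
      using large[of x] bump_eq_0(1)[of "B *v (x - a)"] by (auto simp: dens not_less)
    then have "degree_integral (\<lambda>x. B *v (x - a)) (ball a r) = det B * integral UNIV (\<lambda>x. bump (B *v (x - a)))"
      by (simp add: degree_integral_def)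
    also have "\<dots> = sgn (det B) * (\<bar>det B\<bar> * integral UNIV (\<lambda>x. bump (B *v (x - a))))"
      by (simp add: mult.assoc[symmetric] sgn_mult_abs)
    also have "\<dots> = sgn (det B) * ?c"
      using bump_integral_linear[of B a] A c by (simp add: B_def det_scaleR)
    finally show ?thesis .
  qed
  moreover have "sgn (det B) = sgn (det A)"
    using c by (simp add: B_def det_scaleR sgn_mult)
  ultimately show "mapping_degree ?f (ball a r) = sgn (det A)"
    using bump_integral_pos[where 'n='n] by simp
qed

text \<open>In a small ball the remainder of the linear approximation is smaller than the linear part, so
the segment from \<open>f\<close> to its linear part has no zero other than \<open>a\<close>.\<close>

lemma mapping_degree_regular_zero:
  fixes A :: "real^'n::{finite,wellorder}^'n::{finite,wellorder}"
  assumes f: "(f has_derivative (*v) A) (at a)" "f a = 0" and A: "det A \<noteq> 0"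
  shows "\<exists>e>0. (\<forall>x. dist a x < e \<longrightarrow> f x = 0 \<longrightarrow> x = a) \<and>
    (\<forall>r. 0 < r \<longrightarrow> r < e \<longrightarrow> continuous_on (cball a r) f \<longrightarrow> mapping_degree f (ball a r) = sgn (det A))"
proof -
  obtain m where m: "0 < m" "\<And>h. m * norm h \<le> norm (A *v h)" by (rule matrix_lower_bound[OF A]) blast
  have "\<forall>e>0. \<exists>d>0. \<forall>x. norm (x - a) < d \<longrightarrow> norm (f x - f a - A *v (x - a)) \<le> e * norm (x - a)"
    using f(1) by (simp add: has_derivative_at_alt)
  then obtain e where e: "0 < e" "\<And>x. norm (x - a) < e \<Longrightarrow> norm (f x - A *v (x - a)) \<le> m/2 * norm (x - a)"
    using m(1) f(2) by (metis diff_zero half_gt_zero)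
  have nz: "(1 - t) *\<^sub>R f x + t *\<^sub>R (A *v (x - a)) \<noteq> 0" if "t \<in> {0..1}" "x \<noteq> a" "dist a x < e" for t x
  proof
    assume "(1 - t) *\<^sub>R f x + t *\<^sub>R (A *v (x - a)) = 0"
    then have "A *v (x - a) = - ((1 - t) *\<^sub>R (f x - A *v (x - a)))"
      by (simp add: algebra_simps eq_neg_iff_add_eq_0)
    then have "norm (A *v (x - a)) = (1 - t) * norm (f x - A *v (x - a))"
      using that(1) by (metis abs_of_nonneg atLeastAtMost_iff diff_ge_0_iff_ge norm_minus_cancel norm_scaleR)
    also have "\<dots> \<le> norm (f x - A *v (x - a))" using that(1) by (simp add: mult_left_le_one_le)
    also have "\<dots> \<le> m/2 * norm (x - a)" using e(2)[of x] that(3) by (simp add: dist_commute flip: dist_norm)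
    also have "\<dots> < m * norm (x - a)" using m(1) that(2) by simp
    finally show False using m(2)[of "x - a"] by simp
  qed
  show ?thesis
  proof (intro exI[of _ e] conjI allI impI)
    show "0 < e" by (rule e(1))
    show "x = a" if "dist a x < e" "f x = 0" for x using nz[of 0 x] that by auto
    fix r assume r: "0 < r" "r < e" and cont: "continuous_on (cball a r) f"
    have "degree_defined f (ball a r)"
      using nz[of 0] r cont by (force simp: degree_defined_def)
    moreover have "(1 - t) *\<^sub>R f x + t *\<^sub>R (A *v (x - a)) \<noteq> 0" if "t \<in> {0..1}" "x \<in> frontier (ball a r)" for t x
      using nz[OF that(1), of x] that(2) r by auto
    ultimately show "mapping_degree f (ball a r) = sgn (det A)"
      using mapping_degree_segment[of f "ball a r" "\<lambda>x. A *v (x - a)"] mapping_degree_linear[OF A r(1), of a] by simp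
  qed
qed

text \<open>Regular zeros are isolated, hence finite in number by compactness; separate them by small balls and
use additivity.  Only differentiability at the zeros themselves is assumed, which suits gradients of
functions that are \<open>C\<^sup>2\<close> merely near their critical points.\<close>

theorem mapping_degree_eq_sum_sgn:
  fixes f :: "real^'n::{finite,wellorder} \<Rightarrow> real^'n::{finite,wellorder}"
  assumes f: "degree_defined f D"
    and reg: "\<And>x. x \<in> D \<Longrightarrow> f x = 0 \<Longrightarrow> (f has_derivative (*v) (A x)) (at x) \<and> det (A x) \<noteq> 0"
  shows "finite {x\<in>D. f x = 0}"
    and "mapping_degree f D = (\<Sum>x | x \<in> D \<and> f x = 0. sgn (det (A x)))"
proof -
  let ?Z = "{x\<in>D. f x = 0}"
  have D: "open D" "bounded D" "continuous_on (closure D) f" "\<And>x. x \<in> frontier D \<Longrightarrow> f x \<noteq> 0"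
    using f by (auto simp: degree_defined_def)
  have "\<forall>a\<in>?Z. \<exists>e>0. (\<forall>x. dist a x < e \<longrightarrow> f x = 0 \<longrightarrow> x = a) \<and>
     (\<forall>r. 0 < r \<longrightarrow> r < e \<longrightarrow> continuous_on (cball a r) f \<longrightarrow> mapping_degree f (ball a r) = sgn (det (A a)))"
  proof
    fix a assume a: "a \<in> ?Z"
    then have "(f has_derivative (*v) (A a)) (at a)" "f a = 0" "det (A a) \<noteq> 0" using reg by auto
    then show "\<exists>e>0. (\<forall>x. dist a x < e \<longrightarrow> f x = 0 \<longrightarrow> x = a) \<and>
     (\<forall>r. 0 < r \<longrightarrow> r < e \<longrightarrow> continuous_on (cball a r) f \<longrightarrow> mapping_degree f (ball a r) = sgn (det (A a)))"
      by (rule mapping_degree_regular_zero)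
  qed
  then obtain e where "\<forall>a\<in>?Z. 0 < e a \<and> (\<forall>x. dist a x < e a \<longrightarrow> f x = 0 \<longrightarrow> x = a) \<and>
     (\<forall>r. 0 < r \<longrightarrow> r < e a \<longrightarrow> continuous_on (cball a r) f \<longrightarrow> mapping_degree f (ball a r) = sgn (det (A a)))"
    by (rule bchoice[THEN exE])
  then have e: "\<And>a. a \<in> ?Z \<Longrightarrow> 0 < e a"
    "\<And>a x. a \<in> ?Z \<Longrightarrow> dist a x < e a \<Longrightarrow> f x = 0 \<Longrightarrow> x = a"
    "\<And>a r. a \<in> ?Z \<Longrightarrow> 0 < r \<Longrightarrow> r < e a \<Longrightarrow> continuous_on (cball a r) f \<Longrightarrow>
       mapping_degree f (ball a r) = sgn (det (A a))"
    by (simp_all only: Ball_def)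
  have "?Z = {x\<in>closure D. f x = 0}"
    using D(4) closure_subset interior_open[OF D(1)] by (fastforce simp: frontier_def)
  moreover have "closed {x\<in>closure D. f x = 0}"
    using continuous_closed_preimage_constant[OF D(3)] by simp
  moreover have "bounded ?Z" using D(2) by (rule bounded_subset) auto
  ultimately have "compact ?Z" by (simp only: compact_eq_bounded_closed)
  moreover have "\<not> a islimpt ?Z" if "a \<in> ?Z" for a
    using e(1)[OF that] e(2)[OF that] unfolding islimpt_approachable by (auto simp: dist_commute)
  ultimately show fin: "finite ?Z"
    using finite_not_islimpt_in_compact[of ?Z ?Z] by simp
  show "mapping_degree f D = (\<Sum>x | x \<in> D \<and> f x = 0. sgn (det (A x)))"
  proof (cases "?Z = {}")
    case True
    then have "mapping_degree f D = 0" using mapping_degree_additive[OF f, of "{}" 1] by auto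
    with True show ?thesis by (simp only: sum.empty)
  next
    case False
    obtain d where d: "\<And>a. a \<in> ?Z \<Longrightarrow> 0 < d a \<and> ball a (d a) \<subseteq> D"
      using D(1) unfolding open_contains_ball by (metis (no_types, lifting) mem_Collect_eq)
    \<comment> \<open>the factor 1/2 keeps closed balls inside \<open>D\<close> and balls about different zeros disjoint\<close>
    define r where "r = Min ((\<lambda>a. min (e a) (d a)) ` ?Z) / 2"
    have "0 < Min ((\<lambda>a. min (e a) (d a)) ` ?Z)"
      using fin False e(1) d by (subst Min_gr_iff) auto
    moreover have "2 * r \<le> min (e a) (d a)" if "a \<in> ?Z" for a
      unfolding r_def using Min_le[of "(\<lambda>a. min (e a) (d a)) ` ?Z" "min (e a) (d a)"] fin that by simp
    ultimately have r: "0 < r" "\<And>a. a \<in> ?Z \<Longrightarrow> 2 * r \<le> e a" "\<And>a. a \<in> ?Z \<Longrightarrow> 2 * r \<le> d a"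
      by (auto simp: r_def)
    have cball: "cball a r \<subseteq> D" if "a \<in> ?Z" for a
    proof -
      have "cball a r \<subseteq> ball a (d a)" using r(1) r(3)[OF that] by auto
      then show ?thesis using d[OF that] by blast
    qed
    have "mapping_degree f D = (\<Sum>a\<in>?Z. mapping_degree f (ball a r))"
    proof (rule mapping_degree_additive[OF f fin r(1) cball])
      fix a b assume a: "a \<in> ?Z" and b: "b \<in> ?Z" and "a \<noteq> b"
      then have "2 * r \<le> dist a b" using e(2)[OF a, of b] r(2)[OF a] by force
      show "ball a r \<inter> ball b r = {}"
      proof (rule ccontr)
        assume "ball a r \<inter> ball b r \<noteq> {}"
        then obtain x where "dist a x < r" "dist b x < r" by auto
        with dist_triangle2[of a b x] \<open>2 * r \<le> dist a b\<close> show False by simp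
      qed
    qed (use r(1) in auto)
    also have "\<dots> = (\<Sum>a\<in>?Z. sgn (det (A a)))"
    proof (rule sum.cong[OF refl])
      fix a assume a: "a \<in> ?Z"
      have "continuous_on (cball a r) f"
        using continuous_on_subset[OF D(3)] cball[OF a] closure_subset by blast
      then show "mapping_degree f (ball a r) = sgn (det (A a))"
        using e(3)[OF a, of r] r(1) r(2)[OF a] by simp
    qed
    finally show ?thesis .
  qed
qed

lemma continuous_on_vecI:
  assumes "\<And>i. continuous_on S (\<lambda>x. f x $ i)" shows "continuous_on S f"
  using continuous_on_vec_lambda[of S "\<lambda>i x. f x $ i", OF assms] by simp

lemma has_derivative_vecI:
  fixes f :: "'a::real_normed_vector \<Rightarrow> real^'n"
  assumes "\<And>i. ((\<lambda>x. f x $ i) has_derivative (\<lambda>h. f' h $ i)) (at x)"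
  shows "(f has_derivative f') (at x)"
proof (subst has_derivative_componentwise_within, rule ballI)
  fix b :: "real^'n" assume "b \<in> Basis"
  then obtain i where "b = axis i 1" by (auto simp: Basis_vec_def)
  then show "((\<lambda>x. f x \<bullet> b) has_derivative (\<lambda>h. f' h \<bullet> b)) (at x)"
    using assms[of i] by (simp add: inner_axis)
qed

lemma has_derivative_matrix:
  fixes f' :: "real^'n \<Rightarrow> real^'m"
  assumes "(f has_derivative f') F"
  shows "(f has_derivative (*v) (matrix f')) F"
  using assms matrix_vector_mul(2)[OF has_derivative_linear[OF assms]] by simp

lemma mapping_degree_eq_sum:
  fixes f :: "real^'n::{finite,wellorder} \<Rightarrow> real^'n::{finite,wellorder}"
  assumes f: "degree_defined f D"
    and reg: "\<And>x. x \<in> D \<Longrightarrow> f x = 0 \<Longrightarrow>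
      \<exists>f'. (f has_derivative f') (at x) \<and> det (matrix f') \<noteq> 0 \<and> sgn (det (matrix f')) = \<sigma> x"
  shows "finite {x\<in>D. f x = 0}" and "mapping_degree f D = (\<Sum>x | x \<in> D \<and> f x = 0. \<sigma> x)"
proof -
  have "\<forall>x. \<exists>A. x \<in> D \<longrightarrow> f x = 0 \<longrightarrow> (f has_derivative (*v) A) (at x) \<and> det A \<noteq> 0 \<and> sgn (det A) = \<sigma> x"
    using reg has_derivative_matrix by blast
  then obtain A where A: "\<forall>x. x \<in> D \<longrightarrow> f x = 0 \<longrightarrow>
      (f has_derivative (*v) (A x)) (at x) \<and> det (A x) \<noteq> 0 \<and> sgn (det (A x)) = \<sigma> x"
    by (rule choice[THEN exE])
  then have 1: "(f has_derivative (*v) (A x)) (at x) \<and> det (A x) \<noteq> 0" if "x \<in> D" "f x = 0" for x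
    using that by blast
  show "finite {x\<in>D. f x = 0}" by (rule mapping_degree_eq_sum_sgn(1)[OF f 1])
  have "mapping_degree f D = (\<Sum>x | x \<in> D \<and> f x = 0. sgn (det (A x)))"
    by (rule mapping_degree_eq_sum_sgn(2)[OF f 1])
  also have "\<dots> = (\<Sum>x | x \<in> D \<and> f x = 0. \<sigma> x)" using A by (intro sum.cong) auto
  finally show "mapping_degree f D = (\<Sum>x | x \<in> D \<and> f x = 0. \<sigma> x)" .
qed

section \<open>Symmetric operators and the Morse index\<close>

lemma real_quadratic_nonneg_imp_linear_coeff_0:
  fixes a b :: real
  assumes "\<And>t. 0 \<le> t * a + t\<^sup>2 * b"
  shows "a = 0"
proof (rule ccontr)
  assume "a \<noteq> 0"
  define c where "c = \<bar>b\<bar> + 1"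
  have c: "0 < c" "b < c" by (auto simp: c_def)
  have "(- (a / c)) * a + (- (a / c))\<^sup>2 * b = a\<^sup>2 * (b - c) / c\<^sup>2"
    using c by (simp add: field_simps power2_eq_square)
  also have "\<dots> < 0" using \<open>a \<noteq> 0\<close> c by (intro divide_neg_pos mult_pos_neg) auto
  finally show False using assms[of "- (a / c)"] by simp
qed

text \<open>At a maximum point \<open>u\<close> of the quadratic form on the unit sphere of \<open>S\<close>, the nonnegative function
\<open>\<mu> * (x \<bullet> x) - x \<bullet> f x\<close> on \<open>S\<close> attains its minimum 0, so its derivative vanishes there.\<close>

lemma symmetric_exists_eigenvector:
  fixes f :: "'a::euclidean_space \<Rightarrow> 'a"
  assumes f: "linear f" and sym: "\<And>x y. f x \<bullet> y = x \<bullet> f y"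
    and S: "subspace S" "f ` S \<subseteq> S" "S \<noteq> {0}"
  obtains u \<mu> where "u \<in> S" "norm u = 1" "f u = \<mu> *\<^sub>R u"
proof -
  let ?K = "S \<inter> sphere 0 1"
  obtain w where "w \<in> S" "w \<noteq> 0" using S(1,3) subspace_0 by blast
  then have "(1 / norm w) *\<^sub>R w \<in> ?K" using S(1) by (auto simp: subspace_scale)
  then have "?K \<noteq> {}" by blast
  moreover have "compact ?K" using closed_subspace[OF S(1)] by (intro closed_Int_compact) auto
  moreover have "continuous_on ?K (\<lambda>x. x \<bullet> f x)"
    by (intro continuous_intros linear_continuous_on linear_conv_bounded_linear[THEN iffD1, OF f])
  ultimately obtain u where u: "u \<in> ?K" and max: "\<And>x. x \<in> ?K \<Longrightarrow> x \<bullet> f x \<le> u \<bullet> f u"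
    using continuous_attains_sup[of ?K "\<lambda>x. x \<bullet> f x"] by blast
  define \<mu> where "\<mu> = u \<bullet> f u"
  have max': "x \<bullet> f x \<le> \<mu> * (x \<bullet> x)" if "x \<in> S" for x
  proof (cases "x = 0")
    case False
    then have "(1 / norm x) *\<^sub>R x \<in> ?K" using that S(1) by (auto simp: subspace_scale)
    from max[OF this] have "(x \<bullet> f x) / (norm x)\<^sup>2 \<le> \<mu>"
      using f by (simp add: \<mu>_def linear_scale power2_eq_square)
    then show ?thesis using False by (simp add: field_simps power2_norm_eq_inner)
  qed (use f in \<open>simp add: linear_0\<close>)
  have uu: "u \<bullet> u = 1" using u by (simp add: norm_eq_1)
  have orth: "(\<mu> *\<^sub>R u - f u) \<bullet> v = 0" if v: "v \<in> S" for v
  proof -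
    \<comment> \<open>the form at \<open>u + t *\<^sub>R v\<close>, a quadratic polynomial in \<open>t\<close> without constant term\<close>
    have "0 \<le> t * (2 * ((\<mu> *\<^sub>R u - f u) \<bullet> v)) + t\<^sup>2 * (\<mu> * (v \<bullet> v) - v \<bullet> f v)" for t
    proof -
      have "u + t *\<^sub>R v \<in> S" using u v S(1) by (auto simp: subspace_add subspace_scale)
      from max'[OF this] have "0 \<le> \<mu> * ((u + t *\<^sub>R v) \<bullet> (u + t *\<^sub>R v)) - (u + t *\<^sub>R v) \<bullet> f (u + t *\<^sub>R v)" by simp
      also have "\<dots> = t * (2 * ((\<mu> *\<^sub>R u - f u) \<bullet> v)) + t\<^sup>2 * (\<mu> * (v \<bullet> v) - v \<bullet> f v)"
      proof -
        have "(u + t *\<^sub>R v) \<bullet> (u + t *\<^sub>R v) = 1 + 2 * t * (u \<bullet> v) + t\<^sup>2 * (v \<bullet> v)"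
          using inner_commute[of v u] by (simp add: inner_add_left inner_add_right uu power2_eq_square distrib_left)
        moreover have "(u + t *\<^sub>R v) \<bullet> f (u + t *\<^sub>R v) = \<mu> + 2 * t * (f u \<bullet> v) + t\<^sup>2 * (v \<bullet> f v)"
          unfolding linear_add[OF f] linear_scale[OF f] inner_add_left inner_add_right
          using inner_commute[of v "f u"]
          by (simp add: \<mu>_def power2_eq_square distrib_left flip: sym[of u v])
        ultimately show ?thesis by (simp add: inner_diff_left algebra_simps)
      qed
      finally show ?thesis .
    qed
    then show ?thesis using real_quadratic_nonneg_imp_linear_coeff_0 by fastforce
  qed
  have "\<mu> *\<^sub>R u - f u \<in> S" using u S(1,2) by (auto simp: subspace_diff subspace_scale)
  from orth[OF this] have "f u = \<mu> *\<^sub>R u" by simp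
  with u that show ?thesis by auto
qed

text \<open>The orthogonal complement of an eigenvector in \<open>S\<close> is again invariant.\<close>

lemma symmetric_eigenbasis_subspace:
  fixes f :: "'a::euclidean_space \<Rightarrow> 'a"
  assumes f: "linear f" and sym: "\<And>x y. f x \<bullet> y = x \<bullet> f y"
    and "subspace S" "f ` S \<subseteq> S"
  shows "\<exists>B. B \<subseteq> S \<and> span B = S \<and> pairwise orthogonal B \<and> (\<forall>b\<in>B. norm b = 1 \<and> (\<exists>\<mu>. f b = \<mu> *\<^sub>R b))"
  using assms(3,4)
proof (induction "dim S" arbitrary: S rule: less_induct)
  case less
  show ?case
  proof (cases "S = {0}")
    case True
    then show ?thesis by (intro exI[of _ "{}"]) auto
  next
    case False
    obtain u \<mu> where u: "u \<in> S" "norm u = 1" "f u = \<mu> *\<^sub>R u"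
      using symmetric_exists_eigenvector[OF f sym less.prems False] by metis
    define S' where "S' = {x \<in> S. u \<bullet> x = 0}"
    have sub: "subspace S'"
      using less.prems(1) by (auto simp: S'_def subspace_def inner_add_right)
    have "f ` S' \<subseteq> S'"
    proof clarify
      fix x assume x: "x \<in> S'"
      then have "u \<bullet> f x = 0" using sym[of u x] u(3) by (simp add: S'_def)
      with x less.prems(2) show "f x \<in> S'" by (auto simp: S'_def)
    qed
    moreover have "dim S' < dim S"
    proof (rule dim_psubset)
      have "u \<notin> S'" using u(2) by (auto simp: S'_def norm_eq_1)
      moreover have "S' \<subseteq> S" by (auto simp: S'_def)
      ultimately have "S' \<subset> S" using u(1) by blast
      then show "span S' \<subset> span S"
        using sub less.prems(1) by (simp only: span_eq_iff[THEN iffD2])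
    qed
    ultimately obtain B where B: "B \<subseteq> S'" "span B = S'" "pairwise orthogonal B"
      "\<forall>b\<in>B. norm b = 1 \<and> (\<exists>\<mu>. f b = \<mu> *\<^sub>R b)"
      using less.hyps[OF _ sub] by blast
    have "insert u B \<subseteq> S" using B(1) u(1) by (auto simp: S'_def)
    moreover have "span (insert u B) = S"
    proof
      show "span (insert u B) \<subseteq> S" using \<open>insert u B \<subseteq> S\<close> less.prems(1) by (rule span_minimal)
      show "S \<subseteq> span (insert u B)"
      proof
        fix x assume x: "x \<in> S"
        have "x - (u \<bullet> x) *\<^sub>R u \<in> S'"
          using x u less.prems(1)
          by (auto simp: S'_def subspace_diff subspace_scale inner_diff_right norm_eq_1)
        then show "x \<in> span (insert u B)" using B(2) span_breakdown_eq by blast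
      qed
    qed
    moreover have "pairwise orthogonal (insert u B)"
      using B(1,3) by (auto simp: pairwise_insert orthogonal_def S'_def inner_commute)
    ultimately show ?thesis using B(4) u(2,3) by (intro exI[of _ "insert u B"]) auto
  qed
qed

lemma symmetric_eigenbasis:
  fixes f :: "'a::euclidean_space \<Rightarrow> 'a"
  assumes f: "linear f" and sym: "\<And>x y. f x \<bullet> y = x \<bullet> f y"
  obtains B l where "finite B" "card B = DIM('a)" "span B = UNIV" "pairwise orthogonal B" "independent B"
    "\<And>b. b \<in> B \<Longrightarrow> norm b = 1" "\<And>b. b \<in> B \<Longrightarrow> f b = l b *\<^sub>R b"
proof -
  obtain B where B: "span B = UNIV" "pairwise orthogonal B" "\<forall>b\<in>B. norm b = 1 \<and> (\<exists>\<mu>. f b = \<mu> *\<^sub>R b)"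
    using symmetric_eigenbasis_subspace[OF f sym subspace_UNIV] by auto
  then obtain l where l: "\<And>b. b \<in> B \<Longrightarrow> f b = l b *\<^sub>R b" by metis
  have "0 \<notin> B" using B(3) by force
  then have ind: "independent B" using B(2) pairwise_orthogonal_independent by blast
  have "card B = DIM('a)" using dim_eq_card[of B UNIV] B(1) ind by (simp add: dim_UNIV)
  with B l ind that show ?thesis using independent_imp_finite by metis
qed

lemma orthonormal_expansion:
  fixes B :: "'a::euclidean_space set"
  assumes "finite B" "span B = UNIV" "pairwise orthogonal B" "\<And>b. b \<in> B \<Longrightarrow> norm b = 1"
  shows "v = (\<Sum>b\<in>B. (v \<bullet> b) *\<^sub>R b)"
proof -
  have 1: "b \<bullet> c = (if b = c then 1 else 0)" if "b \<in> B" "c \<in> B" for b c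
    using assms(3,4) that by (auto simp: pairwise_def orthogonal_def norm_eq_1)
  have "(v - (\<Sum>b\<in>B. (v \<bullet> b) *\<^sub>R b)) \<bullet> c = 0" if "c \<in> B" for c
  proof -
    have "(\<Sum>b\<in>B. (v \<bullet> b) * (b \<bullet> c)) = (\<Sum>b\<in>B. if b = c then v \<bullet> c else 0)"
      using 1 that by (intro sum.cong) auto
    then show ?thesis using that assms(1) by (simp add: inner_diff_left inner_sum_left)
  qed
  then have "orthogonal (v - (\<Sum>b\<in>B. (v \<bullet> b) *\<^sub>R b)) x" if "x \<in> span B" for x
    using orthogonal_to_span[OF that] by (simp add: orthogonal_def)
  from this[of "v - (\<Sum>b\<in>B. (v \<bullet> b) *\<^sub>R b)"] assms(2) show ?thesis by (simp add: orthogonal_def)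
qed

lemma mem_spectrum_iff:
  assumes "linear (f :: 'a::euclidean_space \<Rightarrow> 'a)"
  shows "\<mu> \<in> spectrum f \<longleftrightarrow> (\<exists>v. v \<noteq> 0 \<and> f v = \<mu> *\<^sub>R v)"
proof -
  let ?g = "\<lambda>v. f v - \<mu> *\<^sub>R v"
  have lin: "linear ?g" using assms by (intro linear_compose_sub linear_compose_scale_right linear_ident)
  then have "bij ?g \<longleftrightarrow> inj ?g" using linear_injective_imp_surjective by (auto simp: bij_def)
  then show ?thesis using linear_injective_0[OF lin] by (auto simp: spectrum_def)
qed

lemma morse_index_eq_card:
  fixes f :: "'a::euclidean_space \<Rightarrow> 'a"
  assumes f: "linear f" and B: "finite B" "span B = UNIV" "pairwise orthogonal B" "independent B"
    "\<And>b. b \<in> B \<Longrightarrow> norm b = 1" and l: "\<And>b. b \<in> B \<Longrightarrow> f b = l b *\<^sub>R b"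
  shows "morse_index f = card {b\<in>B. l b < 0}"
proof -
  have eig: "{v. f v = \<mu> *\<^sub>R v} = span {b\<in>B. l b = \<mu>}" for \<mu>
  proof
    show "span {b\<in>B. l b = \<mu>} \<subseteq> {v. f v = \<mu> *\<^sub>R v}"
      using l by (intro span_minimal)
        (auto simp: subspace_def linear_0[OF f] linear_add[OF f] linear_scale[OF f] scaleR_add_right)
    show "{v. f v = \<mu> *\<^sub>R v} \<subseteq> span {b\<in>B. l b = \<mu>}"
    proof clarify
      fix v assume v: "f v = \<mu> *\<^sub>R v"
      have exp: "x = (\<Sum>b\<in>B. (x \<bullet> b) *\<^sub>R b)" for x
        by (rule orthonormal_expansion[OF B(1,2,3)]) (rule B(5))
      have "f v = f (\<Sum>b\<in>B. (v \<bullet> b) *\<^sub>R b)" by (rule arg_cong[OF exp])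
      also have "\<dots> = (\<Sum>b\<in>B. ((v \<bullet> b) * l b) *\<^sub>R b)"
        unfolding linear_sum[OF f] linear_scale[OF f] by (simp add: l)
      finally have fv: "f v = (\<Sum>b\<in>B. ((v \<bullet> b) * l b) *\<^sub>R b)" .
      have "(v \<bullet> b) * l b = \<mu> * (v \<bullet> b)" if b: "b \<in> B" for b
      proof -
        have "f v \<bullet> b = (\<Sum>c\<in>B. if c = b then (v \<bullet> b) * l b else 0)"
          unfolding fv inner_sum_left using B(3,5) b
          by (intro sum.cong) (auto simp: pairwise_def orthogonal_def norm_eq_1)
        moreover have "f v \<bullet> b = \<mu> * (v \<bullet> b)" by (simp add: v)
        ultimately show ?thesis using b B(1) by auto
      qed
      then have "v \<bullet> b = 0" if "b \<in> B" "l b \<noteq> \<mu>" for b using that by force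
      then have "(\<Sum>b\<in>B. (v \<bullet> b) *\<^sub>R b) = (\<Sum>b\<in>{b\<in>B. l b = \<mu>}. (v \<bullet> b) *\<^sub>R b)"
        using B(1) by (intro sum.mono_neutral_right) auto
      then have "v = (\<Sum>b\<in>{b\<in>B. l b = \<mu>}. (v \<bullet> b) *\<^sub>R b)"
        using exp[of v] by (rule trans[rotated])
      then show "v \<in> span {b\<in>B. l b = \<mu>}"
        by (metis (no_types, lifting) span_base span_scale span_sum)
    qed
  qed
  have dim: "dim {v. f v = \<mu> *\<^sub>R v} = card {b\<in>B. l b = \<mu>}" for \<mu>
    unfolding eig dim_span using B(4) by (intro dim_eq_card_independent independent_mono[OF B(4)]) auto
  have spec: "spectrum f = l ` B"
  proof -
    have "\<mu> \<in> spectrum f \<longleftrightarrow> {b\<in>B. l b = \<mu>} \<noteq> {}" for \<mu>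
    proof -
      have "\<mu> \<in> spectrum f \<longleftrightarrow> \<not> {v. f v = \<mu> *\<^sub>R v} \<subseteq> {0}"
        using mem_spectrum_iff[OF f] by auto
      also have "\<dots> \<longleftrightarrow> dim {v. f v = \<mu> *\<^sub>R v} \<noteq> 0" by (simp add: dim_eq_0)
      also have "\<dots> \<longleftrightarrow> {b\<in>B. l b = \<mu>} \<noteq> {}" using B(1) by (simp add: dim)
      finally show ?thesis .
    qed
    then show ?thesis by auto
  qed
  have fin: "finite {\<mu> \<in> spectrum f. \<mu> < 0}" using B(1) by (simp add: spec)
  have "morse_index f = (\<Sum>\<mu> | \<mu> \<in> spectrum f \<and> \<mu> < 0. card {b\<in>B. l b = \<mu>})"
    by (simp add: morse_index_def dim)
  also have "\<dots> = card (\<Union>\<mu>\<in>{\<mu> \<in> spectrum f. \<mu> < 0}. {b\<in>B. l b = \<mu>})"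
    using fin B(1) by (intro card_UN_disjoint[symmetric]) auto
  also have "(\<Union>\<mu>\<in>{\<mu> \<in> spectrum f. \<mu> < 0}. {b\<in>B. l b = \<mu>}) = {b\<in>B. l b < 0}"
    by (auto simp: spec)
  finally show ?thesis .
qed

lemma det_eq_prod_eigenvalues:
  fixes f :: "real^'n \<Rightarrow> real^'n"
  assumes f: "linear f" and B: "finite B" "card B = CARD('n)" "pairwise orthogonal B"
    "\<And>b. b \<in> B \<Longrightarrow> norm b = 1" and l: "\<And>b. b \<in> B \<Longrightarrow> f b = l b *\<^sub>R b"
  shows "det (matrix f) = (\<Prod>b\<in>B. l b)"
proof -
  obtain e :: "'n \<Rightarrow> real^'n" where e: "bij_betw e UNIV B"
    using finite_same_card_bij[of "UNIV :: 'n set" B] B(1,2) by auto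
  have eB: "e i \<in> B" for i using e by (auto simp: bij_betw_def)
  define Q :: "real^'n^'n" where "Q = (\<chi> i j. e j $ i)"
  define L :: "real^'n^'n" where "L = (\<chi> i j. if i = j then l (e j) else 0)"
  have col: "column j Q = e j" for j by (simp add: column_def Q_def vec_eq_iff)
  have "orthogonal_matrix Q"
    unfolding orthogonal_matrix_orthonormal_columns col
    using B(3,4) eB bij_betw_imp_inj_on[OF e] by (auto simp: pairwise_def inj_eq)
  then have "det Q \<noteq> 0" using det_orthogonal_matrix[of Q] by auto
  have "matrix f ** Q = Q ** L"
  proof -
    have "(matrix f ** Q) $ i $ j = (Q ** L) $ i $ j" for i j
    proof -
      have "(matrix f ** Q) $ i $ j = (matrix f *v column j Q) $ i"
        by (simp add: matrix_matrix_mult_def matrix_vector_mult_def column_def)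
      also have "\<dots> = f (e j) $ i" using f by (simp add: col matrix_works linear_matrix_vector_mul_eq)
      also have "\<dots> = l (e j) * e j $ i" by (simp add: l[OF eB])
      also have "\<dots> = (Q ** L) $ i $ j"
        by (simp add: matrix_matrix_mult_def Q_def L_def if_distrib sum.delta mult.commute cong: if_cong)
      finally show ?thesis .
    qed
    then show ?thesis by (simp add: vec_eq_iff)
  qed
  then have "det (matrix f) * det Q = det Q * det L" by (metis det_mul)
  then have "det (matrix f) = det L" using \<open>det Q \<noteq> 0\<close> by simp
  also have "\<dots> = (\<Prod>i\<in>UNIV. l (e i))" by (subst det_diagonal) (auto simp: L_def)
  also have "\<dots> = (\<Prod>b\<in>B. l b)" by (rule prod.reindex_bij_betw[OF e])
  finally show ?thesis .
qed

text \<open>In an orthonormal basis of eigenvectors the determinant is the product of the eigenvalues, and the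
Morse index is the number of negative ones.\<close>

lemma sgn_det_eq_morse_index:
  fixes f :: "real^'n \<Rightarrow> real^'n"
  assumes f: "linear f" and sym: "\<And>x y. f x \<bullet> y = x \<bullet> f y" and det: "det (matrix f) \<noteq> 0"
  shows "sgn (det (matrix f)) = (-1) ^ morse_index f"
proof -
  obtain B l where B: "finite B" "card B = DIM(real^'n)" "span B = UNIV" "pairwise orthogonal B" "independent B"
    "\<And>b. b \<in> B \<Longrightarrow> norm b = 1" and l: "\<And>b. b \<in> B \<Longrightarrow> f b = l b *\<^sub>R b"
    by (rule symmetric_eigenbasis[OF f sym]) (rule that, assumption+)
  have d: "det (matrix f) = (\<Prod>b\<in>B. l b)"
    by (rule det_eq_prod_eigenvalues[OF f B(1) _ B(4) B(6) l]) (use B(2) in auto)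
  then have nz: "\<And>b. b \<in> B \<Longrightarrow> l b \<noteq> 0" using det B(1) by auto
  have "sgn (det (matrix f)) = (\<Prod>b\<in>B. sgn (l b))"
    unfolding d using B(1) by (induction B rule: finite_induct) (simp_all add: sgn_mult)
  also have "\<dots> = (\<Prod>b\<in>B. if l b < 0 then -1 else 1)" using nz by (intro prod.cong) (auto simp: sgn_if)
  also have "\<dots> = (-1) ^ card {b\<in>B. l b < 0}"
    using B(1) by (simp add: prod.If_cases Int_def)
  also have "\<dots> = (-1) ^ morse_index f" by (simp add: morse_index_eq_card[OF f B(1,3-6) l])
  finally show ?thesis .
qed

lemma morse_index_conj:
  fixes f :: "'a::euclidean_space \<Rightarrow> 'a"
  assumes f: "linear f" and R: "linear R" and S: "linear S"
    and inv: "\<And>v. S (R v) = v" "\<And>v. R (S v) = v"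
  shows "morse_index (\<lambda>v. R (f (S v))) = morse_index f"
proof -
  have inj: "inj R" using inv(1) by (rule inj_on_inverseI)
  have eig: "{v. R (f (S v)) = \<mu> *\<^sub>R v} = R ` {v. f v = \<mu> *\<^sub>R v}" for \<mu>
  proof (rule Set.set_eqI, rule iffI)
    fix v assume "v \<in> {v. R (f (S v)) = \<mu> *\<^sub>R v}"
    then have "S (R (f (S v))) = S (\<mu> *\<^sub>R v)" by simp
    then have "f (S v) = \<mu> *\<^sub>R S v" by (simp add: inv linear_scale[OF S])
    then show "v \<in> R ` {v. f v = \<mu> *\<^sub>R v}" by (intro image_eqI[of _ _ "S v"]) (simp_all add: inv)
  qed (auto simp: inv linear_scale[OF R])
  have "linear (\<lambda>v. R (f (S v)))"
    using linear_compose[OF linear_compose[OF S f] R] by (simp add: o_def)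
  then have *: "\<mu> \<in> spectrum (\<lambda>v. R (f (S v))) \<longleftrightarrow> (\<exists>v\<in>R ` {v. f v = \<mu> *\<^sub>R v}. v \<noteq> 0)" for \<mu>
    by (auto simp: mem_spectrum_iff simp flip: eig)
  have spec: "\<mu> \<in> spectrum (\<lambda>v. R (f (S v))) \<longleftrightarrow> \<mu> \<in> spectrum f" for \<mu>
  proof -
    have "R v \<noteq> 0 \<longleftrightarrow> v \<noteq> 0" for v using inv(1) linear_0[OF R] linear_0[OF S] by metis
    then show ?thesis using * by (auto simp: mem_spectrum_iff[OF f])
  qed
  have "dim {v. R (f (S v)) = \<mu> *\<^sub>R v} = dim {v. f v = \<mu> *\<^sub>R v}" for \<mu>
    unfolding eig using dim_image_eq[OF R] inj by (simp add: inj_on_subset)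
  then show ?thesis using spec by (simp add: morse_index_def)
qed

text \<open>The operator is changed only on the line spanned by \<open>t\<close>, where the eigenvalue 0 becomes 1.  This
makes the Hessian at a point of a critical circle invertible without changing its Morse index.\<close>

lemma morse_index_add_kernel:
  fixes f :: "'a::euclidean_space \<Rightarrow> 'a"
  assumes f: "linear f" and sym: "\<And>x y. f x \<bullet> y = x \<bullet> f y" and t: "f t = 0" "norm t = 1"
  shows "morse_index (\<lambda>v. f v + (t \<bullet> v) *\<^sub>R t) = morse_index f"
proof -
  let ?g = "\<lambda>v. f v + (t \<bullet> v) *\<^sub>R t"
  have g: "linear ?g"
    by (rule linearI) (simp_all add: linear_add[OF f] linear_scale[OF f] inner_add_right algebra_simps)
  have eig: "{v. ?g v = \<mu> *\<^sub>R v} = {v. f v = \<mu> *\<^sub>R v}" if "\<mu> < 0" for \<mu>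
  proof -
    have "t \<bullet> v = 0" if "f v = \<mu> *\<^sub>R v" for v
      using sym[of t v] that t(1) \<open>\<mu> < 0\<close> by simp
    moreover have "t \<bullet> v = 0" if "?g v = \<mu> *\<^sub>R v" for v
    proof -
      have "t \<bullet> ?g v = t \<bullet> v" using sym[of t v] t by (simp add: inner_add_right norm_eq_1)
      then have "t \<bullet> v = \<mu> * (t \<bullet> v)" using that by simp
      moreover have "\<mu> * (t \<bullet> v) = t \<bullet> v \<Longrightarrow> (1 - \<mu>) * (t \<bullet> v) = 0" by (simp add: algebra_simps)
      ultimately show ?thesis using \<open>\<mu> < 0\<close> by simp
    qed
    ultimately have "?g v = \<mu> *\<^sub>R v \<longleftrightarrow> f v = \<mu> *\<^sub>R v" for v
      by (metis add.right_neutral scaleR_zero_left)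
    then show ?thesis by simp
  qed
  moreover have "\<mu> \<in> spectrum ?g \<longleftrightarrow> \<mu> \<in> spectrum f" if "\<mu> < 0" for \<mu>
    using eig[OF that] unfolding mem_spectrum_iff[OF f] mem_spectrum_iff[OF g] by blast
  then have "{\<mu> \<in> spectrum ?g. \<mu> < 0} = {\<mu> \<in> spectrum f. \<mu> < 0}" by auto
  ultimately show ?thesis unfolding morse_index_def by (intro sum.cong) auto
qed

section \<open>Second derivatives\<close>

text \<open>The mean value theorem in direction \<open>u\<close> turns the second difference into a difference of first
derivatives, to which differentiability of \<open>f'\<close> at the single point \<open>x\<close> applies.\<close>

lemma second_difference_tendsto:
  fixes f :: "'a::real_normed_vector \<Rightarrow> real"
  assumes W: "open W" "x \<in> W" and f: "\<And>y. y \<in> W \<Longrightarrow> (f has_derivative f' y) (at y)"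
    and G: "((\<lambda>y. f' y u) has_derivative G) (at x)"
  shows "((\<lambda>t. (f (x + t *\<^sub>R u + t *\<^sub>R v) - f (x + t *\<^sub>R u) - f (x + t *\<^sub>R v) + f x) / t\<^sup>2)
      \<longlongrightarrow> G v) (at_right 0)"
proof (rule tendstoI)
  fix \<epsilon> :: real assume \<epsilon>: "0 < \<epsilon>"
  \<comment> \<open>the summand 1 keeps \<open>K\<close> positive when \<open>u\<close> and \<open>v\<close> vanish\<close>
  define K where "K = norm u + norm v + 1"
  have K: "0 < K" "norm u \<le> K" "norm u + norm v \<le> K" by (auto simp: K_def intro: add_nonneg_pos)
  have "0 < \<epsilon> / (4 * K)" using \<epsilon> K by simp
  then obtain d where d: "0 < d"
    "\<And>y. norm (y - x) < d \<Longrightarrow> norm (f' y u - f' x u - G (y - x)) \<le> \<epsilon> / (4 * K) * norm (y - x)"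
    using G by (metis has_derivative_at_alt)
  obtain r where r: "0 < r" "ball x r \<subseteq> W" using W open_contains_ball by blast
  have lin: "linear G" using G by (rule has_derivative_linear)
  have "dist ((f (x + t *\<^sub>R u + t *\<^sub>R v) - f (x + t *\<^sub>R u) - f (x + t *\<^sub>R v) + f x) / t\<^sup>2) (G v) < \<epsilon>"
    if t: "0 < t" "t < min d r / K" for t
  proof -
    have tK: "t * K < d" "t * K < r" using t K(1) by (auto simp: field_simps)
    have small: "norm (s *\<^sub>R u + c *\<^sub>R v) \<le> t * K" if "0 \<le> s" "s \<le> t" "0 \<le> c" "c \<le> t" for s c
    proof -
      have "norm (s *\<^sub>R u + c *\<^sub>R v) \<le> s * norm u + c * norm v"
        using norm_triangle_ineq[of "s *\<^sub>R u" "c *\<^sub>R v"] that by simp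
      also have "\<dots> \<le> t * norm u + t * norm v" using that by (intro add_mono mult_right_mono) auto
      also have "\<dots> \<le> t * K" using t(1) K(3) by (simp flip: distrib_left)
      finally show ?thesis .
    qed
    have mem: "x + s *\<^sub>R u + c *\<^sub>R v \<in> W" if "0 \<le> s" "s \<le> t" "0 \<le> c" "c \<le> t" for s c
    proof -
      have "dist x (x + s *\<^sub>R u + c *\<^sub>R v) = norm (s *\<^sub>R u + c *\<^sub>R v)"
        by (metis add.assoc add_diff_cancel_left' dist_commute dist_norm)
      then show ?thesis using small[OF that] tK(2) r(2) by auto
    qed
    define \<phi> where "\<phi> s = f (x + s *\<^sub>R u + t *\<^sub>R v) - f (x + s *\<^sub>R u)" for s
    have deriv: "((\<lambda>s. f (x + s *\<^sub>R u + c *\<^sub>R v)) has_real_derivative f' (x + s *\<^sub>R u + c *\<^sub>R v) u) (at s)"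
      if "0 \<le> s" "s \<le> t" "0 \<le> c" "c \<le> t" for s c
    proof -
      have "((\<lambda>s. x + s *\<^sub>R u + c *\<^sub>R v) has_derivative (\<lambda>s. s *\<^sub>R u)) (at s)"
        by (auto intro!: derivative_eq_intros)
      from has_derivative_compose[OF this f[OF mem[OF that]]]
      show ?thesis
        using linear_scale[OF has_derivative_linear[OF f[OF mem[OF that]]]]
        by (simp add: has_field_derivative_def mult_commute_abs)
    qed
    have "\<exists>z. 0 < z \<and> z < t \<and> \<phi> t - \<phi> 0 =
        (t - 0) * (f' (x + z *\<^sub>R u + t *\<^sub>R v) u - f' (x + z *\<^sub>R u) u)"
      unfolding \<phi>_def using deriv[of _ t] deriv[of _ 0] t(1)
      by (intro MVT2 DERIV_diff) auto
    then obtain z where z: "0 < z" "z < t"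
      "\<phi> t - \<phi> 0 = t * (f' (x + z *\<^sub>R u + t *\<^sub>R v) u - f' (x + z *\<^sub>R u) u)" by auto
    define a where "a = f' (x + z *\<^sub>R u + t *\<^sub>R v) u - f' x u - G (z *\<^sub>R u + t *\<^sub>R v)"
    define b where "b = f' (x + z *\<^sub>R u) u - f' x u - G (z *\<^sub>R u)"
    have bound: "\<epsilon> / (4 * K) * norm w \<le> \<epsilon> / 4 * t" if "norm w \<le> t * K" for w :: 'a
    proof -
      have "\<epsilon> / (4 * K) * norm w \<le> \<epsilon> / (4 * K) * (t * K)"
        using that \<epsilon> K(1) by (intro mult_left_mono) auto
      then show ?thesis using K(1) by simp
    qed
    have near: "\<bar>f' (x + w) u - f' x u - G w\<bar> \<le> \<epsilon> / 4 * t" if w: "norm w \<le> t * K" for w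
    proof -
      have "norm (f' (x + w) u - f' x u - G w) \<le> \<epsilon> / (4 * K) * norm w"
        using d(2)[of "x + w"] w tK(1) by simp
      then show ?thesis using bound[OF w] by simp
    qed
    have "\<bar>a\<bar> \<le> \<epsilon> / 4 * t"
      using near[OF small[of z t]] z by (simp add: a_def add.assoc)
    moreover have "\<bar>b\<bar> \<le> \<epsilon> / 4 * t"
      using near[OF small[of z 0]] z t(1) by (simp add: b_def)
    ultimately have ab: "\<bar>a - b\<bar> \<le> \<epsilon> / 2 * t" by linarith
    have "\<phi> t - \<phi> 0 = t * (a - b) + t\<^sup>2 * G v"
      unfolding z(3) a_def b_def linear_add[OF lin] linear_scale[OF lin]
      by (simp add: algebra_simps power2_eq_square)
    then have "(\<phi> t - \<phi> 0) / t\<^sup>2 - G v = (a - b) / t"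
      using t(1) by (simp add: add_divide_distrib power2_eq_square)
    moreover have "\<bar>(a - b) / t\<bar> \<le> \<epsilon> / 2" using ab t(1) by (simp add: abs_divide pos_divide_le_eq)
    ultimately have "\<bar>(\<phi> t - \<phi> 0) / t\<^sup>2 - G v\<bar> \<le> \<epsilon> / 2" by (simp only:)
    moreover have "f (x + t *\<^sub>R u + t *\<^sub>R v) - f (x + t *\<^sub>R u) - f (x + t *\<^sub>R v) + f x = \<phi> t - \<phi> 0"
      by (simp add: \<phi>_def)
    ultimately show ?thesis using \<epsilon> by (simp add: dist_real_def)
  qed
  moreover have "0 < min d r / K" using d(1) r(1) K(1) by simp
  ultimately show "\<forall>\<^sub>F t in at_right 0. dist ((f (x + t *\<^sub>R u + t *\<^sub>R v) - f (x + t *\<^sub>R u) - f (x + t *\<^sub>R v) + f x) / t\<^sup>2) (G v) < \<epsilon>"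
    unfolding eventually_at_right_field by blast
qed

text \<open>The second difference is symmetric in \<open>u\<close> and \<open>v\<close>, hence so is its limit.\<close>

lemma second_derivative_symmetric:
  fixes f :: "'a::real_normed_vector \<Rightarrow> real"
  assumes W: "open W" "x \<in> W" and f: "\<And>y. y \<in> W \<Longrightarrow> (f has_derivative f' y) (at y)"
    and "((\<lambda>y. f' y u) has_derivative Gu) (at x)" "((\<lambda>y. f' y v) has_derivative Gv) (at x)"
  shows "Gu v = Gv u"
proof -
  have "((\<lambda>t. (f (x + t *\<^sub>R u + t *\<^sub>R v) - f (x + t *\<^sub>R u) - f (x + t *\<^sub>R v) + f x) / t\<^sup>2)
      \<longlongrightarrow> Gv u) (at_right 0)"
    using second_difference_tendsto[OF W f assms(5), of u]
    by (simp add: add.assoc add.commute[of "_ *\<^sub>R v"] diff_diff_eq add.commute[of "f (x + _ *\<^sub>R v)"])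
  from tendsto_unique[OF _ second_difference_tendsto[OF W f assms(4), of v] this]
  show ?thesis by simp
qed

lemma grad_eqI: "GDERIV \<phi> x :> g \<Longrightarrow> grad \<phi> x = g"
  unfolding grad_def
proof (rule the_equality)
  fix g' assume "GDERIV \<phi> x :> g" "GDERIV \<phi> x :> g'"
  then have "(\<lambda>h. h \<bullet> g) = (\<lambda>h. h \<bullet> g')" unfolding gderiv_def by (rule has_derivative_unique)
  then have "h \<bullet> (g' - g) = 0" for h by (metis inner_diff_right right_minus_eq)
  then show "g' = g" by (metis inner_eq_zero_iff right_minus_eq)
qed

lemma linear_real_eq_inner:
  fixes f :: "'a::euclidean_space \<Rightarrow> real"
  assumes "linear f" shows "f h = h \<bullet> (\<Sum>b\<in>Basis. f b *\<^sub>R b)"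
proof -
  have "f h = f (\<Sum>b\<in>Basis. (h \<bullet> b) *\<^sub>R b)" by (simp add: euclidean_representation)
  also have "\<dots> = (\<Sum>b\<in>Basis. (h \<bullet> b) * f b)" by (simp add: linear_sum[OF assms] linear_scale[OF assms])
  finally show ?thesis by (simp add: inner_sum_right mult.commute)
qed

lemma has_derivative_grad:
  fixes \<phi> :: "'a::euclidean_space \<Rightarrow> real"
  assumes "(\<phi> has_derivative f') (at x)"
  shows "GDERIV \<phi> x :> grad \<phi> x" and "grad \<phi> x = (\<Sum>b\<in>Basis. f' b *\<^sub>R b)" and "f' h = h \<bullet> grad \<phi> x"
proof -
  have "f' = (\<lambda>h. h \<bullet> (\<Sum>b\<in>Basis. f' b *\<^sub>R b))"
    using linear_real_eq_inner[OF has_derivative_linear[OF assms]] by (rule ext)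
  with assms have g: "GDERIV \<phi> x :> (\<Sum>b\<in>Basis. f' b *\<^sub>R b)" unfolding gderiv_def by simp
  then show 1: "grad \<phi> x = (\<Sum>b\<in>Basis. f' b *\<^sub>R b)" by (rule grad_eqI)
  then show "GDERIV \<phi> x :> grad \<phi> x" using g by simp
  show "f' h = h \<bullet> grad \<phi> x"
    unfolding 1 by (rule linear_real_eq_inner[OF has_derivative_linear[OF assms]])
qed

lemma hessian_of_C2:
  fixes \<phi> :: "'a::euclidean_space \<Rightarrow> real"
  assumes W: "open W" "x \<in> W" and C2: "C2_on W \<phi>"
  shows "(grad \<phi> has_derivative hessian \<phi> x) (at x)" and "hessian \<phi> x u \<bullet> v = u \<bullet> hessian \<phi> x v"
proof -
  obtain f' where f': "\<And>y. y \<in> W \<Longrightarrow> (\<phi> has_derivative blinfun_apply (f' y)) (at y)" and "C1_on W f'"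
    using C2 unfolding C2_on_def by blast
  then obtain f'' where f'': "(f' has_derivative blinfun_apply f'') (at x)"
    using W(2) unfolding C1_on_def by blast
  have comp: "((\<lambda>y. f' y h) has_derivative (\<lambda>k. f'' k h)) (at x)" for h
    by (rule bounded_linear.has_derivative[OF blinfun.bounded_linear_left f''])
  have "((\<lambda>y. \<Sum>b\<in>Basis. f' y b *\<^sub>R b) has_derivative (\<lambda>k. \<Sum>b\<in>Basis. f'' k b *\<^sub>R b)) (at x)"
    by (intro has_derivative_sum has_derivative_scaleR_left comp)
  then have g: "(grad \<phi> has_derivative (\<lambda>k. \<Sum>b\<in>Basis. f'' k b *\<^sub>R b)) (at x)"
    by (rule has_derivative_transform_within_open[OF _ W]) (simp add: has_derivative_grad(2)[OF f'])
  have h: "hessian \<phi> x = (\<lambda>k. \<Sum>b\<in>Basis. f'' k b *\<^sub>R b)"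
    unfolding hessian_def by (rule frechet_derivative_at[OF g, symmetric])
  show "(grad \<phi> has_derivative hessian \<phi> x) (at x)" unfolding h by (rule g)
  have inner: "k \<bullet> hessian \<phi> x u = f'' u k" for k u
    unfolding h by (rule linear_real_eq_inner[symmetric]) (rule bounded_linear.linear[OF blinfun.bounded_linear_right])
  have "f'' u v = f'' v u"
    by (rule second_derivative_symmetric[OF W f' comp comp])
  then show "hessian \<phi> x u \<bullet> v = u \<bullet> hessian \<phi> x v"
    using inner[of v u] inner[of u v] by (simp add: inner_commute[of _ v])
qed

text \<open>The derivative is again a combination of the same kind, now with coefficients in a space of bounded
linear maps.  Allowing coefficients in any normed space therefore lets this lemma be applied twice,
which gives \<open>C\<^sup>2\<close>.\<close>

lemma C1_on_polynomial_combination: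
  fixes p :: "'i \<Rightarrow> real^'n \<Rightarrow> real" and c :: "'i \<Rightarrow> 'b::real_normed_vector"
  assumes p: "\<And>a. a \<in> A \<Longrightarrow> real_polynomial_function (p a)"
  shows "((\<lambda>x. \<Sum>a\<in>A. p a x *\<^sub>R c a) has_derivative
      blinfun_apply (\<Sum>(a, i)\<in>A \<times> UNIV. partial (p a) i x *\<^sub>R Blinfun (\<lambda>h. h$i *\<^sub>R c a))) (at x)"
    and "C1_on S (\<lambda>x. \<Sum>a\<in>A. p a x *\<^sub>R c a)"
proof -
  have bl: "blinfun_apply (Blinfun (\<lambda>h. h$i *\<^sub>R c)) = (\<lambda>h. h$i *\<^sub>R c)" for i :: 'n and c :: 'b
    by (rule bounded_linear_Blinfun_apply) (intro bounded_linear_scaleR_left[THEN bounded_linear_compose] bounded_linear_vec_nth)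
  have apply_eq: "blinfun_apply (\<Sum>(a, i)\<in>A \<times> UNIV. partial (p a) i x *\<^sub>R Blinfun (\<lambda>h. h$i *\<^sub>R c a)) =
     (\<lambda>h. \<Sum>a\<in>A. (\<Sum>i\<in>UNIV. h$i * partial (p a) i x) *\<^sub>R c a)" for x
    unfolding sum.cartesian_product[symmetric]
    by (auto simp: blinfun.sum_left blinfun.scaleR_left bl scaleR_sum_left mult.commute intro!: ext)
  have d: "((\<lambda>x. \<Sum>a\<in>A. p a x *\<^sub>R c a) has_derivative
      blinfun_apply (\<Sum>(a, i)\<in>A \<times> UNIV. partial (p a) i x *\<^sub>R Blinfun (\<lambda>h. h$i *\<^sub>R c a))) (at x)" for x
    unfolding apply_eq
    by (intro has_derivative_sum has_derivative_scaleR_left real_polynomial_has_derivative_partial p)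
  then show "((\<lambda>x. \<Sum>a\<in>A. p a x *\<^sub>R c a) has_derivative
      blinfun_apply (\<Sum>(a, i)\<in>A \<times> UNIV. partial (p a) i x *\<^sub>R Blinfun (\<lambda>h. h$i *\<^sub>R c a))) (at x)" .
  have "continuous_on S (\<lambda>x. \<Sum>(a, i)\<in>A \<times> UNIV. partial (p a) i x *\<^sub>R Blinfun (\<lambda>h. h$i *\<^sub>R c a))"
    unfolding split_beta
    by (intro continuous_intros continuous_on_real_polynomial real_polynomial_partial p) auto
  with d show "C1_on S (\<lambda>x. \<Sum>a\<in>A. p a x *\<^sub>R c a)" unfolding C1_on_def by (intro exI conjI ballI)
qed

lemma C2_on_polynomial_combination:
  fixes p :: "'i \<Rightarrow> real^'n \<Rightarrow> real" and c :: "'i \<Rightarrow> 'b::real_normed_vector"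
  assumes p: "\<And>a. a \<in> A \<Longrightarrow> real_polynomial_function (p a)"
  shows "C2_on S (\<lambda>x. \<Sum>a\<in>A. p a x *\<^sub>R c a)"
  unfolding C2_on_def
proof (intro exI conjI ballI)
  show "((\<lambda>x. \<Sum>a\<in>A. p a x *\<^sub>R c a) has_derivative
      blinfun_apply (\<Sum>(a, i)\<in>A \<times> UNIV. partial (p a) i x *\<^sub>R Blinfun (\<lambda>h. h$i *\<^sub>R c a))) (at x)" for x
    by (rule C1_on_polynomial_combination(1)[OF p])
  show "C1_on S (\<lambda>x. \<Sum>(a, i)\<in>A \<times> UNIV. partial (p a) i x *\<^sub>R Blinfun (\<lambda>h. h$i *\<^sub>R c a))"
    unfolding split_beta
    by (rule C1_on_polynomial_combination(2)) (use p in \<open>auto intro!: real_polynomial_partial\<close>)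
qed

lemma C1_on_real_polynomial: "real_polynomial_function p \<Longrightarrow> C1_on S (p :: real^'n \<Rightarrow> real)"
  and C2_on_real_polynomial: "real_polynomial_function p \<Longrightarrow> C2_on S (p :: real^'n \<Rightarrow> real)"
  using C1_on_polynomial_combination(2)[of "{()}" "\<lambda>_. p" S "\<lambda>_. 1::real"]
    C2_on_polynomial_combination[of "{()}" "\<lambda>_. p" S "\<lambda>_. 1::real"] by simp_all

lemma C2_on_poly_map:
  assumes "poly_map g" shows "C2_on S g"
proof -
  have "C2_on S (\<lambda>x. \<Sum>j\<in>UNIV. g x $ j *\<^sub>R axis j (1::real))"
    using assms by (intro C2_on_polynomial_combination) auto
  moreover have "(\<Sum>j\<in>UNIV. g x $ j *\<^sub>R axis j (1::real)) = g x" for x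
    using basis_expansion[of "g x"] by (simp add: scalar_mult_eq_scaleR)
  ultimately show ?thesis by (simp only:)
qed

section \<open>The Brouwer degree\<close>

text \<open>On the frontier \<open>g\<close> is closer to \<open>f\<close> than the origin is, so the segment from \<open>f\<close> to \<open>g\<close> does not
meet the origin.\<close>

lemma brouwer_approx_sum_eq_degree:
  fixes f g :: "real^'n::{finite,wellorder} \<Rightarrow> real^'n::{finite,wellorder}"
  assumes f: "degree_defined f D" and g: "brouwer_approx f D 0 g"
  shows "(\<Sum>x | x \<in> D \<and> g x = 0. sgn (det (jacobian g (at x)))) = mapping_degree f D"
proof -
  have near: "norm (f x - g x) < norm (f x)" if "x \<in> frontier D" for x
  proof -
    have "dist (f x) (g x) < infdist 0 (f ` frontier D)"
      using g that by (auto simp: brouwer_approx_def frontier_def)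
    also have "\<dots> \<le> dist 0 (f x)" using that by (intro infdist_le) auto
    finally show ?thesis by (simp add: dist_norm)
  qed
  have seg: "(1 - t) *\<^sub>R f x + t *\<^sub>R g x \<noteq> 0" if t: "t \<in> {0..1}" and x: "x \<in> frontier D" for t x
  proof
    assume "(1 - t) *\<^sub>R f x + t *\<^sub>R g x = 0"
    then have "f x = t *\<^sub>R (f x - g x)" by (simp add: algebra_simps add_eq_0_iff)
    then have "norm (f x) = t * norm (f x - g x)" using t by (metis abs_of_nonneg atLeastAtMost_iff norm_scaleR)
    also have "\<dots> \<le> norm (f x - g x)" using t by (simp add: mult_left_le_one_le)
    finally show False using near[OF x] by simp
  qed
  have gD: "degree_defined g D"
    using f g seg[of 1] by (auto simp: degree_defined_def brouwer_approx_def)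
  have deg: "mapping_degree f D = mapping_degree g D"
    by (rule mapping_degree_segment[OF f gD seg])
  show ?thesis
    unfolding deg
  proof (rule mapping_degree_eq_sum_sgn(2)[OF gD, symmetric])
    fix x assume x: "x \<in> D" "g x = 0"
    obtain g' where "(g has_derivative blinfun_apply g') (at x)"
      using g x(1) unfolding brouwer_approx_def C2_on_def by blast
    then have "(g has_derivative frechet_derivative g (at x)) (at x)"
      using frechet_derivative_at by metis
    then have "(g has_derivative (*v) (jacobian g (at x))) (at x)"
      unfolding jacobian_def by (rule has_derivative_matrix)
    moreover have "det (jacobian g (at x)) \<noteq> 0" using g x by (auto simp: brouwer_approx_def)
    ultimately show "(g has_derivative (*v) (jacobian g (at x))) (at x) \<and> det (jacobian g (at x)) \<noteq> 0" ..
  qed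
qed

lemma brouwer_degree_eqI:
  fixes f g :: "real^'n::{finite,wellorder} \<Rightarrow> real^'n::{finite,wellorder}"
  assumes f: "degree_defined f D" and g: "brouwer_approx f D 0 g"
    and d: "real_of_int d = (\<Sum>x | x \<in> D \<and> g x = 0. sgn (det (jacobian g (at x))))"
  shows "brouwer_degree f D 0 = d"
  unfolding brouwer_degree_def
proof (rule the_equality)
  show "open D \<and> bounded D \<and> continuous_on (closure D) f \<and> 0 \<notin> f ` frontier D \<and>
    (\<exists>g. brouwer_approx f D 0 g \<and>
      real_of_int d = (\<Sum>x | x \<in> D \<and> g x = 0. sgn (det (jacobian g (at x)))))"
    using f g d by (auto simp: degree_defined_def)
next
  fix e assume "open D \<and> bounded D \<and> continuous_on (closure D) f \<and> 0 \<notin> f ` frontier D \<and>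
    (\<exists>g. brouwer_approx f D 0 g \<and>
      real_of_int e = (\<Sum>x | x \<in> D \<and> g x = 0. sgn (det (jacobian g (at x)))))"
  then have "real_of_int e = mapping_degree f D" using brouwer_approx_sum_eq_degree[OF f] by auto
  moreover have "real_of_int d = mapping_degree f D" using brouwer_approx_sum_eq_degree[OF f g] d by simp
  ultimately show "e = d" by simp
qed

section \<open>The potential and its perturbations\<close>

lemma vector_4:
  "(vector [a, b, c, d] :: 'a::zero^4) $ 1 = a" "(vector [a, b, c, d] :: 'a::zero^4) $ 2 = b"
  "(vector [a, b, c, d] :: 'a::zero^4) $ 3 = c" "(vector [a, b, c, d] :: 'a::zero^4) $ 4 = d"
  unfolding vector_def by simp_all

lemma vec_eq_4_iff: "x = (y :: 'a^4) \<longleftrightarrow> x$1 = y$1 \<and> x$2 = y$2 \<and> x$3 = y$3 \<and> x$4 = y$4"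
  by (simp add: vec_eq_iff forall_4)

lemma inner_4: "x \<bullet> (y :: real^4) = x$1 * y$1 + x$2 * y$2 + x$3 * y$3 + x$4 * y$4"
  by (simp add: inner_vec_def sum_4)

lemma det_4:
  fixes A :: "'a::comm_ring_1^4^4"
  shows "det A =
      A$1$1 * (A$2$2 * (A$3$3 * A$4$4 - A$3$4 * A$4$3) - A$2$3 * (A$3$2 * A$4$4 - A$3$4 * A$4$2)
        + A$2$4 * (A$3$2 * A$4$3 - A$3$3 * A$4$2))
    - A$1$2 * (A$2$1 * (A$3$3 * A$4$4 - A$3$4 * A$4$3) - A$2$3 * (A$3$1 * A$4$4 - A$3$4 * A$4$1)
        + A$2$4 * (A$3$1 * A$4$3 - A$3$3 * A$4$1))
    + A$1$3 * (A$2$1 * (A$3$2 * A$4$4 - A$3$4 * A$4$2) - A$2$2 * (A$3$1 * A$4$4 - A$3$4 * A$4$1)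
        + A$2$4 * (A$3$1 * A$4$2 - A$3$2 * A$4$1))
    - A$1$4 * (A$2$1 * (A$3$2 * A$4$3 - A$3$3 * A$4$2) - A$2$2 * (A$3$1 * A$4$3 - A$3$3 * A$4$1)
        + A$2$3 * (A$3$1 * A$4$2 - A$3$2 * A$4$1))"
proof -
  have f1234: "finite {2::4, 3, 4}" "1 \<notin> {2::4, 3, 4}" by auto
  have f234: "finite {3::4, 4}" "2 \<notin> {3::4, 4}" by auto
  have f34: "finite {4::4}" "3 \<notin> {4::4}" by auto
  show ?thesis
    unfolding det_def UNIV_4
    unfolding sum_over_permutations_insert[OF f1234]
    unfolding sum_over_permutations_insert[OF f234]
    unfolding sum_over_permutations_insert[OF f34]
    unfolding permutes_sing
    by (simp add: sign_swap_id permutation_swap_id sign_compose sign_id swap_id_eq permutation_compose algebra_simps)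
qed

text \<open>The gradient of \<open>-U - c x\<^sub>3\<close>.  For \<open>c > 0\<close> its zeros form the circle \<open>x\<^sub>1\<^sup>2 + x\<^sub>2\<^sup>2 = c\<close> in
\<open>x\<^sub>3 = x\<^sub>4 = 0\<close>, for \<open>c < 0\<close> they are two regular zeros in the plane \<open>x\<^sub>1 = x\<^sub>2 = 0\<close>.  The first case
serves for the equivariant degree, the second for the Brouwer degree.\<close>

definition pgrad :: "real \<Rightarrow> real^4 \<Rightarrow> real^4"
  where "pgrad c x = vector [2 * x$1 * x$3, 2 * x$2 * x$3,
    (x$1)\<^sup>2 + (x$2)\<^sup>2 - (x$3)\<^sup>2 + (x$4 - x$3) - c, x$3 - x$4]"

definition pgrad_jac :: "real^4 \<Rightarrow> real^4^4"
  where "pgrad_jac x = vector [vector [2 * x$3, 0, 2 * x$1, 0], vector [0, 2 * x$3, 2 * x$2, 0],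
    vector [2 * x$1, 2 * x$2, - 2 * x$3 - 1, 1], vector [0, 0, 1, -1]]"

abbreviation pot :: "real \<Rightarrow> real^4 \<Rightarrow> real"
  where "pot c x \<equiv> - pot_U x - c * x$3"

lemma pgrad_nth:
  "pgrad c x $ 1 = 2 * x$1 * x$3" "pgrad c x $ 2 = 2 * x$2 * x$3"
  "pgrad c x $ 3 = (x$1)\<^sup>2 + (x$2)\<^sup>2 - (x$3)\<^sup>2 + (x$4 - x$3) - c" "pgrad c x $ 4 = x$3 - x$4"
  by (simp_all add: pgrad_def vector_4)

lemma matrix_vector_mult_4:
  fixes A :: "real^4^4"
  shows "(A *v h) $ i = A$i$1 * h$1 + A$i$2 * h$2 + A$i$3 * h$3 + A$i$4 * h$4"
  by (simp add: matrix_vector_mult_def sum_4)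

lemma pgrad_jac_mult:
  "(pgrad_jac x *v h) $ 1 = 2 * x$3 * h$1 + 2 * x$1 * h$3"
  "(pgrad_jac x *v h) $ 2 = 2 * x$3 * h$2 + 2 * x$2 * h$3"
  "(pgrad_jac x *v h) $ 3 = 2 * x$1 * h$1 + 2 * x$2 * h$2 - (2 * x$3 + 1) * h$3 + h$4"
  "(pgrad_jac x *v h) $ 4 = h$3 - h$4"
  by (simp_all add: matrix_vector_mult_4 pgrad_jac_def vector_4 algebra_simps)

lemma det_pgrad_jac: 
  "det (pgrad_jac x) = 8 * (x$3)^3 + 8 * x$3 * ((x$1)\<^sup>2 + (x$2)\<^sup>2)"
  unfolding det_4 pgrad_jac_def vector_4 by (simp add: power2_eq_square power3_eq_cube algebra_simps)

lemma has_derivative_vec_nth: "((\<lambda>x. x $ i) has_derivative (\<lambda>h. h $ i)) F"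
  by (rule bounded_linear_imp_has_derivative[OF bounded_linear_vec_nth])

lemma GDERIV_pot: "GDERIV (pot c) x :> pgrad c x"
  unfolding gderiv_def pot_U_def
  by (auto intro!: derivative_eq_intros has_derivative_vec_nth
      simp: inner_4 pgrad_nth fun_eq_iff algebra_simps power2_eq_square)

lemma grad_pot: "grad (pot c) = pgrad c"
  using grad_eqI[OF GDERIV_pot] by auto

lemma grad_pot_U: "grad pot_U = (\<lambda>x. - pgrad 0 x)"
proof
  fix x
  have "GDERIV (\<lambda>x. - pot 0 x) x :> - pgrad 0 x" by (intro GDERIV_minus GDERIV_pot)
  then show "grad pot_U x = - pgrad 0 x" by (intro grad_eqI) simp
qed

lemma has_derivative_pgrad: "(pgrad c has_derivative (*v) (pgrad_jac x)) (at x)"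
proof (subst has_derivative_componentwise_within, rule ballI)
  fix b :: "real^4" assume "b \<in> Basis"
  then obtain i where "b = axis i 1" by (auto simp: Basis_vec_def)
  moreover have "((\<lambda>x. pgrad c x $ i) has_derivative (\<lambda>h. (pgrad_jac x *v h) $ i)) (at x)"
    using exhaust_4[of i]
    by (elim disjE)
       (auto simp: pgrad_nth pgrad_jac_mult fun_eq_iff algebra_simps
         intro!: derivative_eq_intros has_derivative_vec_nth)
  ultimately show "((\<lambda>x. pgrad c x \<bullet> b) has_derivative (\<lambda>h. (pgrad_jac x *v h) \<bullet> b)) (at x)"
    by (simp add: inner_axis)
qed

lemma continuous_on_pgrad: "continuous_on S (pgrad c)"
  using has_derivative_continuous[OF has_derivative_pgrad] continuous_at_imp_continuous_on by blast

lemma pgrad_eq_0_iff: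
  "pgrad c x = 0 \<longleftrightarrow> x$4 = x$3 \<and> (x$3 = 0 \<and> (x$1)\<^sup>2 + (x$2)\<^sup>2 = c \<or> x$1 = 0 \<and> x$2 = 0 \<and> (x$3)\<^sup>2 = - c)"
  by (auto simp: vec_eq_4_iff pgrad_nth)

lemma pgrad_0_eq_0_iff: "pgrad 0 x = 0 \<longleftrightarrow> x = 0"
  unfolding pgrad_eq_0_iff vec_eq_4_iff[of x 0] by (auto simp: sum_power2_eq_zero_iff)

lemma real_polynomial_vec_nth: "real_polynomial_function (\<lambda>x. x $ i)"
  by (rule real_polynomial_function.intros(1)[OF bounded_linear_vec_nth])

lemmas polynomial_intros = real_polynomial_function_diff real_polynomial_function_minus
  real_polynomial_function_power real_polynomial_function.intros(2-4) real_polynomial_vec_nth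

lemma poly_map_pgrad: "poly_map (pgrad c)"
  unfolding forall_4 pgrad_nth by (intro conjI polynomial_intros)

lemma real_polynomial_pot: "real_polynomial_function (pot c)"
  unfolding pot_U_def by (intro polynomial_intros)

lemma hessian_pot: "hessian (pot c) x = (*v) (pgrad_jac x)"
  unfolding hessian_def grad_pot by (rule frechet_derivative_at[OF has_derivative_pgrad, symmetric])

lemma spectrum_hessian_pot_U: "spectrum (hessian pot_U 0) = {0, 2}"
proof -
  have h: "hessian pot_U 0 = (\<lambda>h. - (pgrad_jac 0 *v h))"
    unfolding hessian_def grad_pot_U
    by (rule frechet_derivative_at[symmetric]) (intro has_derivative_minus has_derivative_pgrad)
  have lin: "linear (\<lambda>h. - (pgrad_jac 0 *v h))"
    by (intro linear_compose_neg matrix_vector_mul_linear)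
  have "\<mu> \<in> spectrum (hessian pot_U 0) \<longleftrightarrow> \<mu> = 0 \<or> \<mu> = 2" for \<mu>
  proof
    assume "\<mu> \<in> spectrum (hessian pot_U 0)"
    then obtain v where v: "v \<noteq> 0" "- (pgrad_jac 0 *v v) = \<mu> *\<^sub>R v"
      unfolding h mem_spectrum_iff[OF lin] by blast
    then have eqs: "\<mu> * v$1 = 0" "\<mu> * v$2 = 0" "\<mu> * v$3 = v$3 - v$4" "\<mu> * v$4 = v$4 - v$3"
      by (simp_all add: vec_eq_4_iff pgrad_jac_mult)
    show "\<mu> = 0 \<or> \<mu> = 2"
    proof (rule ccontr)
      assume \<mu>: "\<not> (\<mu> = 0 \<or> \<mu> = 2)"
      have "\<mu> * (v$3 + v$4) = 0" using eqs(3,4) by (simp add: distrib_left)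
      then have "v$4 = - v$3" using \<mu> by simp
      then have "(\<mu> - 2) * v$3 = 0" using eqs(3) by (simp add: left_diff_distrib)
      then have "v = 0" using \<mu> eqs(1,2) \<open>v$4 = - v$3\<close> by (simp add: vec_eq_4_iff)
      with v(1) show False by simp
    qed
  next
    assume "\<mu> = 0 \<or> \<mu> = 2"
    then have "\<exists>v. v \<noteq> 0 \<and> - (pgrad_jac 0 *v v) = \<mu> *\<^sub>R v"
    proof
      assume "\<mu> = 0"
      then show ?thesis
        by (intro exI[of _ "vector [1, 0, 0, 0]"]) (simp add: vec_eq_4_iff pgrad_jac_mult vector_4)
    next
      assume "\<mu> = 2"
      then show ?thesis
        by (intro exI[of _ "vector [0, 0, 1, -1]"]) (simp add: vec_eq_4_iff pgrad_jac_mult vector_4)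
    qed
    then show "\<mu> \<in> spectrum (hessian pot_U 0)" unfolding h mem_spectrum_iff[OF lin] .
  qed
  then show ?thesis by auto
qed

lemma jacobian_pgrad: "jacobian (pgrad c) (at x) = pgrad_jac x"
  unfolding jacobian_def frechet_derivative_at[OF has_derivative_pgrad, symmetric] by simp

lemma degree_defined_pgrad_0: "degree_defined (pgrad 0) (ball 0 1)"
  by (auto simp: degree_defined_def continuous_on_pgrad pgrad_0_eq_0_iff)

lemma norm_less_1_iff_4: "norm (x :: real^4) < 1 \<longleftrightarrow> (x$1)\<^sup>2 + (x$2)\<^sup>2 + (x$3)\<^sup>2 + (x$4)\<^sup>2 < 1"
  and norm_eq_1_iff_4: "norm (x :: real^4) = 1 \<longleftrightarrow> (x$1)\<^sup>2 + (x$2)\<^sup>2 + (x$3)\<^sup>2 + (x$4)\<^sup>2 = 1"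
  by (simp_all add: norm_eq_sqrt_inner inner_4 power2_eq_square)

text \<open>The perturbed gradient has the two zeros \<open>(0, 0, a, a)\<close> and \<open>(0, 0, -a, -a)\<close>, where the Jacobian
determinants \<open>8 a\<^sup>3\<close> and \<open>-8 a\<^sup>3\<close> have opposite signs.\<close>

lemma brouwer_degree_pot_U: "brouwer_degree (\<lambda>x. - grad pot_U x) (ball 0 1) 0 = 0"
proof -
  have "compact (pgrad 0 ` sphere 0 1)"
    by (intro compact_continuous_image continuous_on_pgrad) auto
  moreover have "0 \<notin> pgrad 0 ` sphere 0 1" by (auto simp: pgrad_0_eq_0_iff)
  moreover have "axis 1 1 \<in> sphere (0 :: real^4) 1" by simp
  ultimately have pos: "0 < infdist 0 (pgrad 0 ` sphere 0 1)"
    by (subst infdist_pos_not_in_closed) (auto intro: compact_imp_closed)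
  \<comment> \<open>small enough that \<open>a\<^sup>2\<close>, the size of the perturbation, is below the permitted distance, and that both zeros lie in the ball\<close>
  define a where "a = min (1/2) (infdist 0 (pgrad 0 ` sphere 0 1)) / 2"
  have a: "0 < a" "a < infdist 0 (pgrad 0 ` sphere 0 1)" "a \<le> 1/4" using pos by (auto simp: a_def)
  let ?g = "pgrad (- a\<^sup>2)"
  have zeros: "{x \<in> ball 0 1. ?g x = 0} = {vector [0, 0, a, a], vector [0, 0, -a, -a]}" (is "_ = {?p, ?q}")
  proof (rule Set.set_eqI, rule iffI)
    fix x assume "x \<in> {x \<in> ball 0 1. ?g x = 0}"
    then have g: "?g x = 0" by simp
    have "(x$1)\<^sup>2 + (x$2)\<^sup>2 \<noteq> - a\<^sup>2"
      using a(1) sum_power2_ge_zero[of "x$1" "x$2"] zero_less_power[of a 2] by linarith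
    then have "x$4 = x$3" "x$1 = 0" "x$2 = 0" "(x$3)\<^sup>2 = a\<^sup>2" using g by (auto simp: pgrad_eq_0_iff)
    then show "x \<in> {?p, ?q}" by (auto simp: vec_eq_4_iff vector_4 power2_eq_iff)
  next
    fix x assume x: "x \<in> {?p, ?q}"
    have "a\<^sup>2 \<le> (1/4)\<^sup>2" using a(1,3) by (intro power_mono) auto
    then have "norm x < 1" using x unfolding norm_less_1_iff_4 by (auto simp: vector_4 power2_eq_square)
    then show "x \<in> {x \<in> ball 0 1. ?g x = 0}" using x by (auto simp: pgrad_eq_0_iff vector_4)
  qed
  have "?p \<noteq> ?q" using a(1) by (simp add: vec_eq_4_iff vector_4)
  have det: "det (pgrad_jac ?p) = 8 * a^3" "det (pgrad_jac ?q) = - (8 * a^3)"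
    by (simp_all add: det_pgrad_jac vector_4)
  have "brouwer_approx (pgrad 0) (ball 0 1) 0 ?g"
    unfolding brouwer_approx_def
  proof (intro conjI ballI impI)
    show "continuous_on (closure (ball 0 1)) ?g" by (rule continuous_on_pgrad)
    show "C2_on (ball 0 1) ?g" by (rule C2_on_poly_map[OF poly_map_pgrad])
    show "dist (pgrad 0 x) (?g x) < infdist 0 (pgrad 0 ` frontier (ball 0 1))" for x
    proof -
      have "pgrad 0 x - ?g x = - (a\<^sup>2 *\<^sub>R axis 3 1)"
        by (simp add: vec_eq_4_iff pgrad_nth axis_def)
      then have "dist (pgrad 0 x) (?g x) = a * a" by (simp add: dist_norm power2_eq_square)
      also have "\<dots> \<le> 1 * a" using a by (intro mult_right_mono) auto
      also have "\<dots> < infdist 0 (pgrad 0 ` frontier (ball 0 1))" using a(2) by simp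
      finally show ?thesis .
    qed
    show "det (jacobian ?g (at x)) \<noteq> 0" if "x \<in> ball 0 1" "?g x = 0" for x
    proof -
      have "x \<in> {?p, ?q}" using that zeros by blast
      then show ?thesis using det a(1) by (auto simp: jacobian_pgrad)
    qed
  qed
  moreover have "real_of_int 0 = (\<Sum>x | x \<in> ball 0 1 \<and> ?g x = 0. sgn (det (jacobian ?g (at x))))"
    unfolding zeros jacobian_pgrad using \<open>?p \<noteq> ?q\<close> by (simp add: det sgn_minus)
  ultimately have "brouwer_degree (pgrad 0) (ball 0 1) 0 = 0"
    by (rule brouwer_degree_eqI[OF degree_defined_pgrad_0])
  then show ?thesis by (simp add: grad_pot_U)
qed

section \<open>The circle action\<close>

lemma rep_V_nth:
  "rep_V z x $ 1 = Re z * x$1 - Im z * x$2" "rep_V z x $ 2 = Im z * x$1 + Re z * x$2"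
  "rep_V z x $ 3 = x$3" "rep_V z x $ 4 = x$4"
  by (simp_all add: rep_V_def vector_4)

lemma rep_V_mult: "rep_V (z * w) x = rep_V z (rep_V w x)"
  by (simp add: vec_eq_4_iff rep_V_nth algebra_simps)

lemma rep_V_one: "rep_V 1 x = x"
  by (simp add: vec_eq_4_iff rep_V_nth)

lemma circle_mult_cnj: "z \<in> sphere 0 1 \<Longrightarrow> z * cnj z = 1" "z \<in> sphere 0 1 \<Longrightarrow> cnj z * z = 1"
  by (simp_all add: complex_norm_square[symmetric] mult.commute)

lemma rep_V_cnj:
  assumes "z \<in> sphere 0 1"
  shows "rep_V z (rep_V (cnj z) x) = x" "rep_V (cnj z) (rep_V z x) = x"
  by (simp_all only: rep_V_mult[symmetric] circle_mult_cnj[OF assms] rep_V_one)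

lemma linear_rep_V: "linear (rep_V z)"
  by (rule linearI) (simp_all add: vec_eq_4_iff rep_V_nth algebra_simps)

lemma inner_rep_V: "rep_V z x \<bullet> y = x \<bullet> rep_V (cnj z) y"
  by (simp add: inner_4 rep_V_nth algebra_simps)

lemma norm_rep_V: "z \<in> sphere 0 1 \<Longrightarrow> norm (rep_V z x) = norm x"
  by (simp add: norm_eq_sqrt_inner inner_rep_V rep_V_cnj)

lemma mult_circle: "z \<in> sphere 0 1 \<Longrightarrow> w \<in> sphere 0 1 \<Longrightarrow> z * w \<in> sphere (0::complex) 1"
  by (simp add: norm_mult)

lemma group_circle: "group circle_group"
proof (rule groupI)
  show "\<exists>y\<in>carrier circle_group. y \<otimes>\<^bsub>circle_group\<^esub> x = \<one>\<^bsub>circle_group\<^esub>"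
    if "x \<in> carrier circle_group" for x
    using that circle_mult_cnj(2)[of x] by (intro bexI[of _ "cnj x"]) (auto simp: circle_group_def)
qed (auto simp: circle_group_def norm_mult)

lemma group_action_rep_V: "group_action circle_group UNIV rep_V"
proof -
  have "group_hom circle_group (BijGroup UNIV) rep_V"
    unfolding group_hom_def group_hom_axioms_def
  proof (intro conjI group_circle group_BijGroup homI)
    show "rep_V z \<in> carrier (BijGroup UNIV)" if "z \<in> carrier circle_group" for z
    proof -
      have "z \<in> sphere 0 1" using that by (simp add: circle_group_def)
      then have "bij (rep_V z)" using rep_V_cnj by (intro bijI') metis+
      then show ?thesis by (simp add: BijGroup_def Bij_def)
    qed
    then show "rep_V (z \<otimes>\<^bsub>circle_group\<^esub> w) = rep_V z \<otimes>\<^bsub>BijGroup UNIV\<^esub> rep_V w"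
      if "z \<in> carrier circle_group" "w \<in> carrier circle_group" for z w
      using that by (auto simp: BijGroup_def circle_group_def rep_V_mult compose_def fun_eq_iff)
  qed
  then show ?thesis by (simp add: group_action_def)
qed

lemma orthogonal_rep_V: "orthogonal_rep rep_V"
  unfolding orthogonal_rep_def
proof (intro conjI ballI group_action_rep_V)
  show "orthogonal_transformation (rep_V z)" if "z \<in> sphere 0 1" for z
    using that by (simp add: orthogonal_transformation linear_rep_V norm_rep_V)
  have "continuous_on (sphere 0 1 \<times> UNIV) (\<lambda>(z, x). \<chi> i. rep_V z x $ i)"
    unfolding split_beta
  proof (rule continuous_on_vec_lambda)
    show "continuous_on (sphere 0 1 \<times> UNIV) (\<lambda>p. rep_V (fst p) (snd p) $ i)" for i
      using exhaust_4[of i] by (elim disjE) (auto simp: rep_V_nth intro!: continuous_intros)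
  qed
  then show "continuous_on (sphere 0 1 \<times> UNIV) (\<lambda>(z, x). rep_V z x)" by simp
qed

definition is_fixed :: "real^4 \<Rightarrow> bool"
  where "is_fixed x \<longleftrightarrow> x$1 = 0 \<and> x$2 = 0"

lemma orbit_rep_V: "orbit circle_group rep_V x = (\<lambda>z. rep_V z x) ` sphere 0 1"
  by (auto simp: orbit_def circle_group_def)

lemma rep_V_fixed: "is_fixed x \<Longrightarrow> rep_V z x = x"
  by (simp add: is_fixed_def vec_eq_4_iff rep_V_nth)

lemma rep_V_eq_self_imp:
  assumes "rep_V z x = x" "\<not> is_fixed x"
  shows "z = 1"
proof -
  have eqs: "(Re z - 1) * x$1 = Im z * x$2" "(Re z - 1) * x$2 = - (Im z * x$1)"
    using assms(1) by (auto simp: vec_eq_4_iff rep_V_nth algebra_simps)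
  have "((Re z - 1)\<^sup>2 + (Im z)\<^sup>2) * ((x$1)\<^sup>2 + (x$2)\<^sup>2) =
      ((Re z - 1) * x$1 - Im z * x$2)\<^sup>2 + ((Re z - 1) * x$2 + Im z * x$1)\<^sup>2"
    by (simp add: power2_eq_square algebra_simps)
  also have "\<dots> = 0" using eqs by simp
  finally have "(Re z - 1)\<^sup>2 + (Im z)\<^sup>2 = 0"
    using assms(2) by (auto simp: is_fixed_def sum_power2_eq_zero_iff)
  then show ?thesis by (simp add: sum_power2_eq_zero_iff complex_eq_iff)
qed

lemma is_fixed_rep_V: "z \<in> sphere 0 1 \<Longrightarrow> is_fixed (rep_V z x) \<longleftrightarrow> is_fixed x"
  using rep_V_fixed rep_V_cnj by metis

lemma mem_orbit_self: "x \<in> orbit circle_group rep_V x"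
  unfolding orbit_rep_V using rep_V_one[of x] by (intro image_eqI[of _ _ 1]) auto

lemma orbit_fixed: "is_fixed x \<Longrightarrow> orbit circle_group rep_V x = {x}"
  using mem_orbit_self[of x] by (auto simp: orbit_rep_V rep_V_fixed)

lemma orbit_eq:
  assumes "y \<in> orbit circle_group rep_V x"
  shows "orbit circle_group rep_V y = orbit circle_group rep_V x"
proof -
  obtain z where z: "z \<in> sphere 0 1" "y = rep_V z x" using assms by (auto simp: orbit_rep_V)
  have "rep_V w y \<in> orbit circle_group rep_V x" if "w \<in> sphere 0 1" for w
    using mult_circle[OF that z(1)] by (auto simp: orbit_rep_V z(2) rep_V_mult[symmetric] simp del: mem_sphere_0)
  moreover have "rep_V w x \<in> orbit circle_group rep_V y" if "w \<in> sphere 0 1" for w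
  proof -
    have "rep_V w x = rep_V (w * cnj z) y" by (simp add: z(2) rep_V_mult rep_V_cnj(2)[OF z(1)])
    moreover have "w * cnj z \<in> sphere 0 1" using that z(1) by (simp add: norm_mult)
    ultimately show ?thesis unfolding orbit_rep_V by blast
  qed
  ultimately show ?thesis by (auto simp: orbit_rep_V[of y] orbit_rep_V[of x])
qed

lemma orbit_dim_rep_V: "orbit_dim rep_V x = (if is_fixed x then 0 else 1)"
proof (cases "is_fixed x")
  case False
  have "rep_V (-1) x \<in> orbit circle_group rep_V x" by (auto simp: orbit_rep_V)
  moreover have "rep_V (-1) x \<noteq> x" using rep_V_eq_self_imp[of "-1" x] False by auto
  ultimately have "orbit circle_group rep_V x \<noteq> {x}" by blast
  with False show ?thesis by (simp add: orbit_dim_def)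
qed (simp add: orbit_dim_def orbit_fixed)

text \<open>The orbit is the circle of radius \<open>sqrt (x\<^sub>1\<^sup>2 + x\<^sub>2\<^sup>2)\<close> about the fixed plane.\<close>

lemma orbit_meets_slice:
  assumes x: "\<not> is_fixed x"
  shows "card {y \<in> orbit circle_group rep_V x. y$2 = 0} = 2"
proof -
  define r where "r = sqrt ((x$1)\<^sup>2 + (x$2)\<^sup>2)"
  have r: "0 < r" "r\<^sup>2 = (x$1)\<^sup>2 + (x$2)\<^sup>2"
    using x by (auto simp: r_def is_fixed_def sum_power2_gt_zero_iff)
  let ?p = "\<lambda>s. vector [s, 0, x$3, x$4] :: real^4"
  have "{y \<in> orbit circle_group rep_V x. y$2 = 0} = {?p r, ?p (- r)}"
  proof (rule Set.set_eqI, rule iffI)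
    fix y assume "y \<in> {y \<in> orbit circle_group rep_V x. y$2 = 0}"
    then obtain z where z: "z \<in> sphere 0 1" "y = rep_V z x" and y2: "y$2 = 0" by (auto simp: orbit_rep_V)
    have "(y$1)\<^sup>2 + (y$2)\<^sup>2 = ((Re z)\<^sup>2 + (Im z)\<^sup>2) * ((x$1)\<^sup>2 + (x$2)\<^sup>2)"
      by (simp add: z(2) rep_V_nth power2_eq_square algebra_simps)
    also have "(Re z)\<^sup>2 + (Im z)\<^sup>2 = 1" using z(1) by (simp flip: cmod_power2)
    finally have "(y$1)\<^sup>2 = r\<^sup>2" using y2 r(2) by simp
    then have "y$1 = r \<or> y$1 = - r" by (simp add: power2_eq_iff)
    then show "y \<in> {?p r, ?p (- r)}" using y2 by (auto simp: vec_eq_4_iff vector_4 z(2) rep_V_nth)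
  next
    fix y assume y: "y \<in> {?p r, ?p (- r)}"
    then obtain s where s: "y = ?p s" "s\<^sup>2 = (x$1)\<^sup>2 + (x$2)\<^sup>2" "s \<noteq> 0" using r by auto
    define z where "z = Complex (x$1 / s) (- (x$2 / s))"
    have "(Re z)\<^sup>2 + (Im z)\<^sup>2 = ((x$1)\<^sup>2 + (x$2)\<^sup>2) / s\<^sup>2"
      by (simp add: z_def power_divide add_divide_distrib)
    also have "\<dots> = 1" unfolding s(2)[symmetric] using s(3) by simp
    finally have "(Re z)\<^sup>2 + (Im z)\<^sup>2 = 1" .
    then have "z \<in> sphere 0 1" by (simp add: cmod_def)
    moreover have "y = rep_V z x"
    proof -
      have "Re z * x$1 - Im z * x$2 = ((x$1)\<^sup>2 + (x$2)\<^sup>2) / s"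
        by (simp add: z_def power2_eq_square add_divide_distrib)
      also have "\<dots> = s" unfolding s(2)[symmetric] using s(3) by (simp add: power2_eq_square)
      finally show ?thesis by (simp add: s(1) vec_eq_4_iff vector_4 rep_V_nth) (simp add: z_def)
    qed
    moreover have "y$2 = 0" by (simp add: s(1) vector_4)
    ultimately show "y \<in> {y \<in> orbit circle_group rep_V x. y$2 = 0}"
      unfolding orbit_rep_V by blast
  qed
  moreover have "?p r \<noteq> ?p (- r)" using r(1) by (simp add: vec_eq_4_iff vector_4)
  ultimately show ?thesis by simp
qed

lemma stabilizer_fixed: "is_fixed x \<Longrightarrow> stabilizer circle_group rep_V x = sphere 0 1"
  by (auto simp: stabilizer_def circle_group_def rep_V_fixed)

lemma stabilizer_not_fixed: "\<not> is_fixed x \<Longrightarrow> stabilizer circle_group rep_V x = {1}"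
  using rep_V_eq_self_imp rep_V_one by (auto simp: stabilizer_def circle_group_def)

definition full_circle :: circle_subgroup
  where "full_circle = Abs_circle_subgroup (sphere 0 1)"

lemma isotropy_fixed: "is_fixed x \<Longrightarrow> isotropy rep_V x = full_circle"
  by (simp add: isotropy_def stabilizer_fixed full_circle_def)

lemma isotropy_not_fixed: "\<not> is_fixed x \<Longrightarrow> isotropy rep_V x = cyclic_subgroup 1"
  by (simp add: isotropy_def stabilizer_not_fixed cyclic_subgroup_def)

lemma Rep_full_circle: "Rep_circle_subgroup full_circle = sphere 0 1"
proof -
  have "subgroup (sphere 0 1) circle_group"
    using group.subgroup_self[OF group_circle] by (simp add: circle_group_def)
  then show ?thesis unfolding full_circle_def by (intro Abs_circle_subgroup_inverse) simp
qed

lemma Rep_cyclic_1: "Rep_circle_subgroup (cyclic_subgroup 1) = {1}"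
proof -
  have "subgroup {1} circle_group"
    using group.triv_subgroup[OF group_circle] by (simp add: circle_group_def)
  then show ?thesis
    unfolding cyclic_subgroup_def by (subst Abs_circle_subgroup_inverse) auto
qed

lemma fixed_space_full: "fixed_space rep_V full_circle = {x. is_fixed x}"
proof -
  have "is_fixed x" if "\<forall>z\<in>sphere 0 1. rep_V z x = x" for x
  proof (rule ccontr)
    assume "\<not> is_fixed x"
    moreover have "rep_V (-1) x = x" using that by simp
    ultimately show False using rep_V_eq_self_imp[of "-1" x] by simp
  qed
  then show ?thesis by (auto simp: fixed_space_def Rep_full_circle rep_V_fixed)
qed

lemma fixed_space_trivial: "fixed_space rep_V (cyclic_subgroup 1) = UNIV"
  unfolding fixed_space_def Rep_cyclic_1 by (simp add: rep_V_one)

section \<open>Gradients of invariant functions\<close>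

definition invariant_C1 :: "(real^4) set \<Rightarrow> (real^4 \<Rightarrow> real) \<Rightarrow> bool"
  where "invariant_C1 N \<phi> \<longleftrightarrow> open N \<and> invariant_set rep_V N \<and> invariant_fun rep_V N \<phi> \<and> C1_on N \<phi>"

lemma invariant_C1_has_derivative:
  assumes "invariant_C1 N \<phi>" "x \<in> N"
  shows "(\<phi> has_derivative (\<lambda>h. h \<bullet> grad \<phi> x)) (at x)"
proof -
  obtain f' where "(\<phi> has_derivative f') (at x)"
    using assms unfolding invariant_C1_def C1_on_def by blast
  then show ?thesis using has_derivative_grad(1) by (simp add: gderiv_def)
qed

lemma grad_equivariant:
  assumes \<phi>: "invariant_C1 N \<phi>" and x: "x \<in> N" and z: "z \<in> sphere 0 1"
  shows "grad \<phi> (rep_V z x) = rep_V z (grad \<phi> x)"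
proof -
  have zx: "rep_V z x \<in> N" using \<phi> x z by (auto simp: invariant_C1_def invariant_set_def)
  have "(rep_V z has_derivative rep_V z) (at x)"
    using linear_rep_V by (intro bounded_linear_imp_has_derivative) (simp add: linear_conv_bounded_linear)
  from has_derivative_compose[OF this invariant_C1_has_derivative[OF \<phi> zx]]
  have "((\<lambda>x. \<phi> (rep_V z x)) has_derivative (\<lambda>h. rep_V z h \<bullet> grad \<phi> (rep_V z x))) (at x)" .
  moreover have "open N" using \<phi> by (simp add: invariant_C1_def)
  ultimately have "(\<phi> has_derivative (\<lambda>h. rep_V z h \<bullet> grad \<phi> (rep_V z x))) (at x)"
    by (rule has_derivative_transform_within_open[OF _ _ x])
       (use \<phi> z in \<open>auto simp: invariant_C1_def invariant_fun_def simp del: mem_sphere_0\<close>)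
  then have "GDERIV \<phi> x :> rep_V (cnj z) (grad \<phi> (rep_V z x))"
    by (simp add: gderiv_def inner_rep_V)
  then have "grad \<phi> x = rep_V (cnj z) (grad \<phi> (rep_V z x))" by (rule grad_eqI)
  then show ?thesis by (simp add: rep_V_cnj[OF z])
qed

text \<open>The group element \<open>-1\<close> fixes \<open>x\<close> and negates the first two coordinates of the gradient.\<close>

lemma grad_fixed:
  assumes \<phi>: "invariant_C1 N \<phi>" and x: "x \<in> N" "is_fixed x"
  shows "is_fixed (grad \<phi> x)"
proof -
  have "grad \<phi> x = rep_V (-1) (grad \<phi> x)"
    using grad_equivariant[OF \<phi> x(1), of "-1"] rep_V_fixed[OF x(2)] by simp
  then show ?thesis by (simp add: vec_eq_4_iff rep_V_nth is_fixed_def)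
qed

text \<open>The velocity of the orbit of \<open>x\<close>.\<close>

definition tangent :: "real^4 \<Rightarrow> real^4"
  where "tangent x = vector [- x$2, x$1, 0, 0]"

lemma orbit_curve_has_derivative:
  "((\<lambda>s. rep_V (cis s) x) has_derivative (\<lambda>s. s *\<^sub>R tangent x)) (at 0)"
proof (subst has_derivative_componentwise_within, rule ballI)
  fix b :: "real^4" assume "b \<in> Basis"
  then obtain i where "b = axis i 1" by (auto simp: Basis_vec_def)
  moreover have "((\<lambda>s. rep_V (cis s) x $ i) has_derivative (\<lambda>s. s * tangent x $ i)) (at 0)"
    using exhaust_4[of i]
    by (elim disjE)
       (auto simp: rep_V_nth tangent_def vector_4 fun_eq_iff intro!: derivative_eq_intros)
  ultimately show "((\<lambda>s. rep_V (cis s) x \<bullet> b) has_derivative (\<lambda>s. s *\<^sub>R tangent x \<bullet> b)) (at 0)"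
    by (simp add: inner_axis)
qed

lemma cis_in_circle: "cis s \<in> sphere 0 1" by simp

text \<open>Differentiate \<open>\<phi>\<close> along the orbit, where it is constant.\<close>

lemma grad_inner_tangent:
  assumes \<phi>: "invariant_C1 N \<phi>" and x: "x \<in> N"
  shows "tangent x \<bullet> grad \<phi> x = 0"
proof -
  have "rep_V (cis 0) x = x" by (simp add: rep_V_one)
  then have "(\<phi> has_derivative (\<lambda>h. h \<bullet> grad \<phi> x)) (at (rep_V (cis 0) x))"
    using invariant_C1_has_derivative[OF assms] by simp
  from has_derivative_compose[OF orbit_curve_has_derivative this]
  have "((\<lambda>s. \<phi> (rep_V (cis s) x)) has_derivative (\<lambda>s. s *\<^sub>R tangent x \<bullet> grad \<phi> x)) (at 0)" .
  moreover have "\<phi> (rep_V (cis s) x) = \<phi> x" for s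
    using \<phi> x cis_in_circle by (auto simp: invariant_C1_def invariant_fun_def simp del: norm_cis mem_sphere_0)
  ultimately have "((\<lambda>s::real. \<phi> x) has_derivative (\<lambda>s. s *\<^sub>R tangent x \<bullet> grad \<phi> x)) (at 0)" by simp
  from has_derivative_unique[OF this has_derivative_const]
  show ?thesis by (metis inner_scaleR_left mult_1 scaleR_one)
qed

text \<open>Differentiate the gradient along the orbit, where it vanishes.\<close>

lemma hessian_tangent_eq_0:
  assumes \<phi>: "invariant_C1 N \<phi>" and x: "x \<in> N" "grad \<phi> x = 0"
    and H: "(grad \<phi> has_derivative H) (at x)"
  shows "H (tangent x) = 0"
proof -
  have "rep_V (cis 0) x = x" by (simp add: rep_V_one)
  then have "(grad \<phi> has_derivative H) (at (rep_V (cis 0) x))" using H by simp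
  from has_derivative_compose[OF orbit_curve_has_derivative this]
  have "((\<lambda>s. grad \<phi> (rep_V (cis s) x)) has_derivative (\<lambda>s. H (s *\<^sub>R tangent x))) (at 0)" .
  moreover have "grad \<phi> (rep_V (cis s) x) = 0" for s
    using grad_equivariant[OF \<phi> x(1) cis_in_circle] linear_0[OF linear_rep_V] x(2) by simp
  ultimately have "((\<lambda>s::real. 0) has_derivative (\<lambda>s. H (s *\<^sub>R tangent x))) (at 0)" by simp
  from has_derivative_unique[OF this has_derivative_const]
  show ?thesis by (metis scaleR_one)
qed

lemma hessian_conj:
  assumes \<phi>: "invariant_C1 N \<phi>" and x: "x \<in> N" and z: "z \<in> sphere 0 1"
    and H: "(grad \<phi> has_derivative H) (at x)"
  shows "(grad \<phi> has_derivative (\<lambda>h. rep_V z (H (rep_V (cnj z) h)))) (at (rep_V z x))"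
proof -
  have bl: "bounded_linear (rep_V w)" for w using linear_rep_V by (simp add: linear_conv_bounded_linear)
  have N: "open N" "rep_V z x \<in> N" using \<phi> x z by (auto simp: invariant_C1_def invariant_set_def)
  have cz: "cnj z \<in> sphere 0 1" using z by simp
  have "(grad \<phi> has_derivative H) (at (rep_V (cnj z) (rep_V z x)))" using H by (simp add: rep_V_cnj[OF z])
  from bounded_linear.has_derivative[OF bl[of z] has_derivative_compose[OF bounded_linear_imp_has_derivative[OF bl[of "cnj z"]] this]]
  have "((\<lambda>y. rep_V z (grad \<phi> (rep_V (cnj z) y))) has_derivative (\<lambda>h. rep_V z (H (rep_V (cnj z) h)))) (at (rep_V z x))" .
  then show ?thesis
    by (rule has_derivative_transform_within_open[OF _ N])
       (use grad_equivariant[OF \<phi> _ cz] rep_V_cnj[OF z] in simp)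
qed

section \<open>Reduction to coordinate subspaces\<close>

definition proj :: "'n set \<Rightarrow> real^'n \<Rightarrow> real^'n"
  where "proj J x = (\<chi> i. if i \<in> J then x$i else 0)"

text \<open>The field \<open>g\<close> is restricted to the coordinate subspace of \<open>J\<close>, projected to that subspace, and
extended by the identity in the other coordinates.  The result is a field on the given space that
has the zeros and the degree of the restricted field.\<close>

definition reduced_map :: "'n set \<Rightarrow> (real^'n \<Rightarrow> real^'n) \<Rightarrow> real^'n \<Rightarrow> real^'n"
  where "reduced_map J g x = (\<chi> i. if i \<in> J then g (proj J x) $ i else x$i)"

lemma proj_nth: "proj J x $ i = (if i \<in> J then x$i else 0)"
  by (simp add: proj_def)

lemma reduced_nth: "reduced_map J g x $ i = (if i \<in> J then g (proj J x) $ i else x$i)"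
  by (simp add: reduced_map_def)

lemma proj_eq_self_iff: "proj J x = x \<longleftrightarrow> (\<forall>i. i \<notin> J \<longrightarrow> x$i = 0)"
  by (auto simp: vec_eq_iff proj_nth)

lemma reduced_eq_0_iff: "reduced_map J g x = 0 \<longleftrightarrow> proj J x = x \<and> (\<forall>i\<in>J. g x $ i = 0)"
proof
  assume 0: "reduced_map J g x = 0"
  then have "x$i = 0" if "i \<notin> J" for i using that reduced_nth[of J g x i] by simp
  then have proj: "proj J x = x" by (simp add: proj_eq_self_iff)
  moreover have "g x $ i = 0" if "i \<in> J" for i using that 0 reduced_nth[of J g x i] proj by simp
  ultimately show "proj J x = x \<and> (\<forall>i\<in>J. g x $ i = 0)" by blast
next
  assume "proj J x = x \<and> (\<forall>i\<in>J. g x $ i = 0)"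
  then have p: "proj J x = x" and 0: "\<forall>i\<in>J. g x $ i = 0" by blast+
  have "reduced_map J g x $ i = 0" for i
    using p[unfolded proj_eq_self_iff] 0 by (simp add: reduced_nth p)
  then show "reduced_map J g x = 0" by (simp add: vec_eq_iff)
qed

lemma norm_proj_le: "norm (proj J x) \<le> norm (x :: real^'n)"
  by (rule norm_le_componentwise_cart) (simp add: proj_nth)

lemma proj_mem_cball: "x \<in> cball 0 1 \<Longrightarrow> proj J x \<in> cball 0 1"
  using norm_proj_le[of J x] by auto

lemma bounded_linear_proj: "bounded_linear (proj J :: real^'n \<Rightarrow> real^'n)"
  unfolding linear_conv_bounded_linear[symmetric] by (rule linearI) (simp_all add: vec_eq_iff proj_nth)

lemma reduced_has_derivative:
  assumes g: "(g has_derivative H) (at x)" and x: "proj J x = x"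
  shows "(reduced_map J g has_derivative reduced_map J H) (at x)"
proof (rule has_derivative_vecI)
  fix i
  have "(g has_derivative H) (at (proj J x))" using g x by simp
  from has_derivative_compose[OF bounded_linear_imp_has_derivative[OF bounded_linear_proj] this]
  have "((\<lambda>x. g (proj J x) $ i) has_derivative (\<lambda>h. H (proj J h) $ i)) (at x)"
    by (rule bounded_linear.has_derivative[OF bounded_linear_vec_nth])
  then show "((\<lambda>x. reduced_map J g x $ i) has_derivative (\<lambda>h. reduced_map J H h $ i)) (at x)"
    by (cases "i \<in> J") (simp_all add: reduced_nth has_derivative_vec_nth)
qed

lemma continuous_on_reduced:
  assumes g: "continuous_on (T \<times> N) (\<lambda>(t, x). g t x)" and N: "cball 0 1 \<subseteq> N"
  shows "continuous_on (T \<times> cball 0 1) (\<lambda>(t, x). reduced_map J (g t) x)"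
proof -
  have "continuous_on (T \<times> cball 0 1) (\<lambda>p. (\<lambda>(t, x). g t x) (fst p, proj J (snd p)))"
  proof (rule continuous_on_compose2[OF g])
    show "continuous_on (T \<times> cball 0 1) (\<lambda>p. (fst p, proj J (snd p)))"
      by (intro continuous_intros bounded_linear.continuous_on[OF bounded_linear_proj])
    show "(\<lambda>p. (fst p, proj J (snd p))) ` (T \<times> cball 0 1) \<subseteq> T \<times> N"
      using subsetD[OF N proj_mem_cball] by auto
  qed
  then have c: "continuous_on (T \<times> cball 0 1) (\<lambda>p. g (fst p) (proj J (snd p)))" by simp
  show ?thesis
    unfolding split_beta
  proof (rule continuous_on_vecI)
    show "continuous_on (T \<times> cball 0 1) (\<lambda>p. reduced_map J (g (fst p)) (snd p) $ i)" for i
      by (cases "i \<in> J") (auto simp: reduced_nth intro!: continuous_intros c)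
  qed
qed

text \<open>The fixed plane, and the hyperplane \<open>x\<^sub>2 = 0\<close>, which meets every orbit.\<close>

definition fixed_coords :: "4 set" where "fixed_coords = {3, 4}"

definition slice_coords :: "4 set" where "slice_coords = {1, 3, 4}"

lemmas coords_defs = fixed_coords_def slice_coords_def

lemma proj_coords_eq_self_iff:
  "proj fixed_coords x = x \<longleftrightarrow> is_fixed x" "proj slice_coords x = x \<longleftrightarrow> x$2 = 0"
  unfolding proj_eq_self_iff forall_4 by (simp_all add: coords_defs is_fixed_def)

text \<open>Invariance forces the discarded components of the gradient to vanish: on the fixed plane the
gradient is tangent to the plane, and at the other points of the hyperplane it is orthogonal to
the orbit, whose velocity points in direction 2.\<close>

lemma reduced_grad_eq_0_iff:
  assumes \<phi>: "invariant_C1 N \<phi>" and x: "proj J x \<in> N" and J: "J \<in> {fixed_coords, slice_coords}"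
  shows "reduced_map J (grad \<phi>) x = 0 \<longleftrightarrow> proj J x = x \<and> grad \<phi> x = 0"
proof -
  have "grad \<phi> x = 0" if p: "proj J x = x" and 0: "\<forall>i\<in>J. grad \<phi> x $ i = 0"
  proof -
    have xN: "x \<in> N" using x p by simp
    have 34: "grad \<phi> x $ 3 = 0" "grad \<phi> x $ 4 = 0" using 0 J by (auto simp: coords_defs)
    show ?thesis
    proof (cases "is_fixed x")
      case True
      then show ?thesis using grad_fixed[OF \<phi> xN] 34 by (simp add: is_fixed_def vec_eq_4_iff)
    next
      case False
      then have "J = slice_coords" "x$2 = 0" using J p by (auto simp: proj_coords_eq_self_iff)
      then have "grad \<phi> x $ 1 = 0" "x$1 \<noteq> 0" using 0 False by (auto simp: coords_defs is_fixed_def)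
      moreover from this have "grad \<phi> x $ 2 = 0"
        using grad_inner_tangent[OF \<phi> xN] by (simp add: tangent_def inner_4 vector_4)
      ultimately show ?thesis using 34 by (simp add: vec_eq_4_iff)
    qed
  qed
  then show ?thesis by (auto simp: reduced_eq_0_iff)
qed

lemma admissible_invariant_C1: "admissible_on rep_V D N \<phi> \<Longrightarrow> invariant_C1 N \<phi>"
  by (simp add: admissible_on_def invariant_C1_def)

lemma continuous_on_grad:
  assumes "invariant_C1 N \<phi>" shows "continuous_on N (grad \<phi>)"
proof -
  obtain f' where f': "\<And>x. x \<in> N \<Longrightarrow> (\<phi> has_derivative blinfun_apply (f' x)) (at x)" "continuous_on N f'"
    using assms unfolding invariant_C1_def C1_on_def by blast
  have "continuous_on N (\<lambda>x. \<Sum>b\<in>Basis. f' x b *\<^sub>R b)" by (intro continuous_intros f'(2))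
  then show ?thesis by (rule continuous_on_eq) (simp add: has_derivative_grad(2)[OF f'(1)])
qed

abbreviation (input) unit_ball :: "(real^4) set" where "unit_ball \<equiv> ball 0 1"

lemma reduced_grad_nonzero_on_sphere:
  assumes adm: "admissible_on rep_V unit_ball N \<phi>" and J: "J \<in> {fixed_coords, slice_coords}"
    and x: "x \<in> sphere 0 1"
  shows "reduced_map J (grad \<phi>) x \<noteq> 0"
proof -
  have N: "cball 0 1 \<subseteq> N" and nz: "grad \<phi> x \<noteq> 0" using adm x by (auto simp: admissible_on_def)
  have "proj J x \<in> N" using x by (intro subsetD[OF N proj_mem_cball]) simp
  with nz show ?thesis using reduced_grad_eq_0_iff[OF admissible_invariant_C1[OF adm] _ J] by blast
qed

lemma grad_cong:
  assumes "open N" "x \<in> N" "\<And>y. y \<in> N \<Longrightarrow> \<phi> y = \<psi> y"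
  shows "grad \<phi> x = grad \<psi> x"
proof -
  have "GDERIV \<phi> x :> g \<longleftrightarrow> GDERIV \<psi> x :> g" for g
    using has_derivative_transform_within_open[OF _ assms(1,2)] assms(3) unfolding gderiv_def by metis
  then show ?thesis by (simp add: grad_def)
qed

lemma reduced_degree_homotopy:
  assumes hom: "gradient_homotopic rep_V unit_ball \<phi> \<psi>" and J: "J \<in> {fixed_coords, slice_coords}"
  shows "mapping_degree (reduced_map J (grad \<phi>)) unit_ball = mapping_degree (reduced_map J (grad \<psi>)) unit_ball"
proof -
  obtain N h where adm: "\<And>t. t \<in> {0..1} \<Longrightarrow> admissible_on rep_V unit_ball N (h t)"
    and cont: "continuous_on ({0..1} \<times> N) (\<lambda>(t, x). grad (h t) x)"
    and ends: "\<And>x. x \<in> N \<Longrightarrow> h (0::real) x = \<phi> x" "\<And>x. x \<in> N \<Longrightarrow> h 1 x = \<psi> x"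
    using hom unfolding gradient_homotopic_def by blast
  have N: "open N" "cball 0 1 \<subseteq> N" using adm[of 0] by (auto simp: admissible_on_def)
  have grad: "grad (h 0) x = grad \<phi> x" "grad (h 1) x = grad \<psi> x" if "x \<in> cball 0 1" for x
    using grad_cong[OF N(1) subsetD[OF N(2) that]] ends by blast+
  have "mapping_degree (reduced_map J (grad (h 0))) unit_ball = mapping_degree (reduced_map J (grad (h 1))) unit_ball"
    using continuous_on_reduced[OF cont N(2)] reduced_grad_nonzero_on_sphere[OF adm J]
    by (intro mapping_degree_homotopy) auto
  moreover have "reduced_map J (grad (h 0)) x = reduced_map J (grad \<phi>) x"
      "reduced_map J (grad (h 1)) x = reduced_map J (grad \<psi>) x" if "x \<in> closure unit_ball" for x
    using grad[OF proj_mem_cball, of x J] that by (auto simp: vec_eq_iff reduced_nth)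
  ultimately show ?thesis using mapping_degree_cong by metis
qed

lemma degree_defined_reduced_grad:
  assumes adm: "admissible_on rep_V unit_ball N \<phi>" and J: "J \<in> {fixed_coords, slice_coords}"
  shows "degree_defined (reduced_map J (grad \<phi>)) unit_ball"
proof -
  have N: "cball 0 1 \<subseteq> N" using adm by (auto simp: admissible_on_def)
  have "continuous_on ({0::real} \<times> N) (\<lambda>(t, x). grad \<phi> x)"
    unfolding split_beta
    by (rule continuous_on_compose2[OF continuous_on_grad[OF admissible_invariant_C1[OF adm]]])
       (auto intro!: continuous_intros)
  note cont = continuous_on_reduced[OF this N, of J]
  have "continuous_on (cball 0 1) (\<lambda>x. (\<lambda>(t, x). reduced_map J (grad \<phi>) x) (0::real, x))"
    by (rule continuous_on_compose2[OF cont]) (auto intro!: continuous_intros)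
  then have "continuous_on (cball 0 1) (reduced_map J (grad \<phi>))" by simp
  then show ?thesis
    using reduced_grad_nonzero_on_sphere[OF adm J] by (auto simp: degree_defined_def)
qed

lemma reduced_grad_zeros:
  assumes adm: "admissible_on rep_V unit_ball N \<phi>" and J: "J \<in> {fixed_coords, slice_coords}"
  shows "{x \<in> unit_ball. reduced_map J (grad \<phi>) x = 0} = {x \<in> {x \<in> unit_ball. grad \<phi> x = 0}. proj J x = x}"
proof -
  have N: "cball 0 1 \<subseteq> N" using adm by (auto simp: admissible_on_def)
  have "reduced_map J (grad \<phi>) x = 0 \<longleftrightarrow> proj J x = x \<and> grad \<phi> x = 0" if "x \<in> unit_ball" for x
    using reduced_grad_eq_0_iff[OF admissible_invariant_C1[OF adm] subsetD[OF N proj_mem_cball] J] that by simp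
  then show ?thesis by blast
qed

section \<open>Generic potentials\<close>

lemma det_nonzero_of_kernel:
  fixes f :: "real^'n \<Rightarrow> real^'n"
  assumes "linear f" "\<And>h. f h = 0 \<Longrightarrow> h = 0"
  shows "det (matrix f) \<noteq> 0"
  using assms det_nz_iff_inj linear_injective_0 by blast

lemma generic_invariant:
  assumes "generic rep_V unit_ball \<psi> X"
  obtains N where "invariant_C1 N \<psi>" "cball 0 1 \<subseteq> N"
proof -
  obtain N where N: "admissible_on rep_V unit_ball N \<psi>" using assms by (auto simp: generic_def)
  moreover have "cball 0 1 \<subseteq> N" using N by (auto simp: admissible_on_def)
  ultimately show ?thesis using that admissible_invariant_C1 by blast
qed

lemma generic_critical:
  assumes gen: "generic rep_V unit_ball \<psi> X" and x: "x \<in> X" and y: "y \<in> orbit circle_group rep_V x"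
  shows "y \<in> unit_ball" "grad \<psi> y = 0" "(grad \<psi> has_derivative hessian \<psi> y) (at y)"
    "linear (hessian \<psi> y)" "hessian \<psi> y u \<bullet> v = u \<bullet> hessian \<psi> y v"
proof -
  have "{x\<in>unit_ball. grad \<psi> x = 0} = (\<Union>x\<in>X. orbit circle_group rep_V x)"
    using gen by (simp add: generic_def)
  then show "y \<in> unit_ball" "grad \<psi> y = 0" using x y by blast+
  obtain W where W: "open W" "orbit circle_group rep_V x \<subseteq> W" "C2_on W \<psi>"
    using gen x unfolding generic_def by blast
  then have "y \<in> W" using y by blast
  then show d: "(grad \<psi> has_derivative hessian \<psi> y) (at y)"
    and "hessian \<psi> y u \<bullet> v = u \<bullet> hessian \<psi> y v"
    using hessian_of_C2[OF W(1) _ W(3)] by blast+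
  show "linear (hessian \<psi> y)" using d by (rule has_derivative_linear)
qed

lemma generic_kernel:
  assumes gen: "generic rep_V unit_ball \<psi> X" and x: "x \<in> X"
  shows "dim {v. hessian \<psi> x v = 0} = (if is_fixed x then 0 else 1)"
  using assms by (simp add: generic_def orbit_dim_rep_V)

lemma generic_hessian_conj:
  assumes gen: "generic rep_V unit_ball \<psi> X" and x: "x \<in> X" and z: "z \<in> sphere 0 1"
  shows "hessian \<psi> (rep_V z x) = (\<lambda>h. rep_V z (hessian \<psi> x (rep_V (cnj z) h)))"
proof -
  obtain N where N: "invariant_C1 N \<psi>" "cball 0 1 \<subseteq> N" by (rule generic_invariant[OF gen])
  note crit = generic_critical[OF gen x]
  have "rep_V z x \<in> orbit circle_group rep_V x" using z by (auto simp: orbit_rep_V)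
  from crit(3)[OF this] show ?thesis
  proof (rule has_derivative_unique)
    have "x \<in> N" using crit(1)[OF mem_orbit_self] N(2) by auto
    then show "(grad \<psi> has_derivative (\<lambda>h. rep_V z (hessian \<psi> x (rep_V (cnj z) h)))) (at (rep_V z x))"
      by (rule hessian_conj[OF N(1) _ z crit(3)[OF mem_orbit_self]])
  qed
qed

lemma generic_morse_index_orbit:
  assumes gen: "generic rep_V unit_ball \<psi> X" and x: "x \<in> X" and y: "y \<in> orbit circle_group rep_V x"
  shows "morse_index (hessian \<psi> y) = morse_index (hessian \<psi> x)"
    and "dim {v. hessian \<psi> y v = 0} = dim {v. hessian \<psi> x v = 0}"
proof -
  obtain z where z: "z \<in> sphere 0 1" "y = rep_V z x" using y by (auto simp: orbit_rep_V)
  have H: "hessian \<psi> y = (\<lambda>h. rep_V z (hessian \<psi> x (rep_V (cnj z) h)))"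
    unfolding z(2) by (rule generic_hessian_conj[OF gen x z(1)])
  show "morse_index (hessian \<psi> y) = morse_index (hessian \<psi> x)"
    unfolding H
    by (rule morse_index_conj[OF generic_critical(4)[OF gen x mem_orbit_self] linear_rep_V linear_rep_V])
       (simp_all only: rep_V_cnj[OF z(1)])
  have "{v. hessian \<psi> y v = 0} = rep_V z ` {v. hessian \<psi> x v = 0}"
  proof (rule Set.set_eqI, rule iffI)
    fix v assume "v \<in> {v. hessian \<psi> y v = 0}"
    then have "rep_V (cnj z) (rep_V z (hessian \<psi> x (rep_V (cnj z) v))) = rep_V (cnj z) 0" by (simp add: H)
    then have "hessian \<psi> x (rep_V (cnj z) v) = 0"
      by (simp only: rep_V_cnj[OF z(1)] linear_0[OF linear_rep_V])
    then show "v \<in> rep_V z ` {v. hessian \<psi> x v = 0}"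
      by (intro image_eqI[of _ _ "rep_V (cnj z) v"]) (simp_all only: rep_V_cnj[OF z(1)] mem_Collect_eq)
  next
    fix v assume "v \<in> rep_V z ` {v. hessian \<psi> x v = 0}"
    then show "v \<in> {v. hessian \<psi> y v = 0}"
      by (auto simp: H rep_V_cnj(2)[OF z(1)] linear_0[OF linear_rep_V])
  qed
  moreover have "inj (rep_V z)" using rep_V_cnj(2)[OF z(1)] by (rule inj_on_inverseI)
  ultimately show "dim {v. hessian \<psi> y v = 0} = dim {v. hessian \<psi> x v = 0}"
    using dim_image_eq[OF linear_rep_V[of z]] by (simp add: inj_on_subset)
qed

text \<open>The normal form required of a generic potential, differentiated in a direction normal to the fixed
plane.\<close>

lemma generic_hessian_normal:
  assumes gen: "generic rep_V unit_ball \<psi> X" and x: "x \<in> X" "is_fixed x"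
    and v: "v$3 = 0" "v$4 = 0"
  shows "hessian \<psi> x v = v"
proof -
  have "\<exists>\<epsilon>>0. \<forall>y v. y \<in> fixed_space rep_V (isotropy rep_V x) \<and>
      infdist y (orbit circle_group rep_V x) < \<epsilon> \<and>
      v \<in> orthogonal_comp (fixed_space rep_V (isotropy rep_V x)) \<and> norm v < \<epsilon> \<longrightarrow>
      grad \<psi> (y + v) = grad \<psi> y + v"
    using gen x(1) by (simp add: generic_def)
  then obtain \<epsilon> where \<epsilon>: "\<epsilon> > 0" "\<forall>y v. y \<in> fixed_space rep_V (isotropy rep_V x) \<and>
      infdist y (orbit circle_group rep_V x) < \<epsilon> \<and>
      v \<in> orthogonal_comp (fixed_space rep_V (isotropy rep_V x)) \<and> norm v < \<epsilon> \<longrightarrow>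
      grad \<psi> (y + v) = grad \<psi> y + v"
    by (elim exE conjE)
  have comp: "s *\<^sub>R v \<in> orthogonal_comp (fixed_space rep_V (isotropy rep_V x))" for s
    using v by (auto simp: isotropy_fixed[OF x(2)] fixed_space_full orthogonal_comp_def orthogonal_def
        inner_4 is_fixed_def)
  have grad: "grad \<psi> (x + s *\<^sub>R v) = s *\<^sub>R v" if "norm (s *\<^sub>R v) < \<epsilon>" for s
    using \<epsilon>(2)[rule_format, of x "s *\<^sub>R v"] comp[of s] that x(2) \<epsilon>(1)
      generic_critical(2)[OF gen x(1) mem_orbit_self]
    by (simp add: isotropy_fixed fixed_space_full orbit_fixed)
  have "((\<lambda>s. x + s *\<^sub>R v) has_derivative (\<lambda>s. s *\<^sub>R v)) (at 0)" by (auto intro!: derivative_eq_intros)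
  moreover have "(grad \<psi> has_derivative hessian \<psi> x) (at (x + 0 *\<^sub>R v))"
    using generic_critical(3)[OF gen x(1) mem_orbit_self] by simp
  ultimately have "((\<lambda>s. grad \<psi> (x + s *\<^sub>R v)) has_derivative (\<lambda>s. hessian \<psi> x (s *\<^sub>R v))) (at 0)"
    by (rule has_derivative_compose)
  moreover have "((\<lambda>s. grad \<psi> (x + s *\<^sub>R v)) has_derivative (\<lambda>s. s *\<^sub>R v)) (at 0)"
  proof (rule has_derivative_transform_within_open[where s="{s. norm (s *\<^sub>R v) < \<epsilon>}"])
    show "((\<lambda>s. s *\<^sub>R v) has_derivative (\<lambda>s. s *\<^sub>R v)) (at 0)" by (auto intro!: derivative_eq_intros)
    show "open {s. norm (s *\<^sub>R v) < \<epsilon>}" by (intro open_Collect_less continuous_intros)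
  qed (use \<epsilon>(1) grad in auto)
  ultimately have "(\<lambda>s. hessian \<psi> x (s *\<^sub>R v)) = (\<lambda>s. s *\<^sub>R v)" by (rule has_derivative_unique)
  from fun_cong[OF this, of 1] show ?thesis by simp
qed

text \<open>At a fixed critical point the Hessian is the identity normal to the fixed plane, and by symmetry it
respects the splitting.  Thus reducing it to either coordinate subspace changes nothing.\<close>

lemma reduced_hessian_fixed:
  assumes gen: "generic rep_V unit_ball \<psi> X" and x: "x \<in> X" "is_fixed x"
    and J: "J \<in> {fixed_coords, slice_coords}"
  shows "reduced_map J (hessian \<psi> x) = hessian \<psi> x"
proof
  fix h
  let ?H = "hessian \<psi> x"
  note crit = generic_critical[OF gen x(1) mem_orbit_self]
  note normal = generic_hessian_normal[OF gen x]
  have "?H (h - proj J h) = h - proj J h" by (rule normal) (use J in \<open>auto simp: proj_nth coords_defs\<close>)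
  then have "?H (proj J h) = ?H h - (h - proj J h)" by (simp add: linear_diff[OF crit(4)] algebra_simps)
  then have "?H (proj J h) $ i = ?H h $ i" if "i \<in> J" for i using that by (simp add: proj_nth)
  moreover have "?H h $ i = h$i" if "i \<notin> J" for i
  proof -
    have "?H (axis i 1) = axis i 1" using that J by (intro normal) (auto simp: axis_def coords_defs)
    then show ?thesis using crit(5)[of h "axis i 1"] by (simp add: inner_axis)
  qed
  ultimately show "reduced_map J ?H h = ?H h" by (simp add: vec_eq_iff reduced_nth)
qed

lemma generic_det_hessian_fixed:
  assumes gen: "generic rep_V unit_ball \<psi> X" and x: "x \<in> X" "is_fixed x"
  shows "det (matrix (hessian \<psi> x)) \<noteq> 0"
    "sgn (det (matrix (hessian \<psi> x))) = (-1) ^ morse_index (hessian \<psi> x)"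
proof -
  note crit = generic_critical[OF gen x(1) mem_orbit_self]
  have "{v. hessian \<psi> x v = 0} \<subseteq> {0}" using generic_kernel[OF gen x(1)] x(2) by (simp add: dim_eq_0)
  then show nz: "det (matrix (hessian \<psi> x)) \<noteq> 0" by (intro det_nonzero_of_kernel crit(4)) auto
  show "sgn (det (matrix (hessian \<psi> x))) = (-1) ^ morse_index (hessian \<psi> x)"
    by (rule sgn_det_eq_morse_index[OF crit(4,5) nz])
qed

lemma reduced_grad_regular_fixed:
  assumes gen: "generic rep_V unit_ball \<psi> X" and x: "x \<in> X" "is_fixed x"
    and J: "J \<in> {fixed_coords, slice_coords}"
  shows "(reduced_map J (grad \<psi>) has_derivative hessian \<psi> x) (at x)"
proof -
  have "proj J x = x" using J x(2) by (auto simp: proj_coords_eq_self_iff is_fixed_def)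
  from reduced_has_derivative[OF generic_critical(3)[OF gen x(1) mem_orbit_self] this]
  show ?thesis unfolding reduced_hessian_fixed[OF gen x J] .
qed

text \<open>The orbit passes through \<open>y\<close> in direction 2, which the Hessian therefore maps to 0; by symmetry its
image is orthogonal to that direction.  The reduced derivative is the Hessian plus the orthogonal
projection to direction 2, and nondegeneracy of the critical orbit makes it invertible.\<close>

lemma reduced_grad_regular_free:
  assumes gen: "generic rep_V unit_ball \<psi> X" and x: "x \<in> X" "\<not> is_fixed x"
    and y: "y \<in> orbit circle_group rep_V x" "y$2 = 0"
  defines "A \<equiv> \<lambda>h. hessian \<psi> y h + (axis 2 1 \<bullet> h) *\<^sub>R axis 2 1"
  shows "(reduced_map slice_coords (grad \<psi>) has_derivative A) (at y)" "det (matrix A) \<noteq> 0"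
    "sgn (det (matrix A)) = (-1) ^ morse_index (hessian \<psi> y)"
proof -
  let ?H = "hessian \<psi> y" and ?e = "axis 2 1 :: real^4"
  obtain N where N: "invariant_C1 N \<psi>" "cball 0 1 \<subseteq> N" by (rule generic_invariant[OF gen])
  note crit = generic_critical[OF gen x(1) y(1)]
  have yN: "y \<in> N" using crit(1) N(2) by auto
  have "\<not> is_fixed y" using y(1) x(2) by (auto simp: orbit_rep_V is_fixed_rep_V simp del: mem_sphere_0)
  then have y1: "y$1 \<noteq> 0" using y(2) by (simp add: is_fixed_def)
  have "tangent y = y$1 *\<^sub>R ?e" using y(2) by (simp add: vec_eq_4_iff tangent_def vector_4 axis_def)
  then have "y$1 *\<^sub>R ?H ?e = 0"
    using hessian_tangent_eq_0[OF N(1) yN crit(2,3)] by (simp only: linear_scale[OF crit(4)])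
  then have He: "?H ?e = 0" using y1 by simp
  have H2: "?H h $ 2 = 0" for h using crit(5)[of h ?e] by (simp add: He inner_axis)
  have "proj slice_coords h = h - h$2 *\<^sub>R ?e" for h
    by (simp add: vec_eq_4_iff proj_nth axis_def coords_defs)
  then have Hp: "?H (proj slice_coords h) = ?H h" for h
    by (simp only: linear_diff[OF crit(4)] linear_scale[OF crit(4)] He) simp
  have "reduced_map slice_coords ?H = A"
    unfolding A_def
  proof
    fix h
    have "1 \<in> slice_coords" "2 \<notin> slice_coords" "3 \<in> slice_coords" "4 \<in> slice_coords"
      by (simp_all add: slice_coords_def)
    then show "reduced_map slice_coords ?H h = ?H h + (?e \<bullet> h) *\<^sub>R ?e"
      by (simp add: vec_eq_4_iff reduced_nth Hp H2 axis_def inner_4)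
  qed
  then show "(reduced_map slice_coords (grad \<psi>) has_derivative A) (at y)"
    using reduced_has_derivative[OF crit(3), of slice_coords] y(2) by (simp add: proj_coords_eq_self_iff)
  have lin: "linear A"
    unfolding A_def
    by (rule linearI) (simp_all add: linear_add[OF crit(4)] linear_scale[OF crit(4)] inner_add_right algebra_simps)
  show nz: "det (matrix A) \<noteq> 0"
  proof (rule det_nonzero_of_kernel[OF lin])
    fix h assume "A h = 0"
    then have "A h $ 2 = 0" by simp
    then have h2: "h$2 = 0" by (simp add: A_def H2 inner_axis')
    with \<open>A h = 0\<close> have "?H h = 0" by (simp add: A_def inner_axis')
    have "dim {v. ?H v = 0} = 1"
      using generic_morse_index_orbit(2)[OF gen x(1) y(1)] generic_kernel[OF gen x(1)] x(2) by simp
    moreover have "subspace {v. ?H v = 0}" by (auto simp: subspace_def linear_0[OF crit(4)] linear_add[OF crit(4)] linear_scale[OF crit(4)])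
    moreover have "dim {?e} = 1" by (simp add: dim_singleton axis_eq_0_iff)
    moreover have "span {?e} \<subseteq> {v. ?H v = 0}" using He \<open>subspace {v. ?H v = 0}\<close> by (intro span_minimal) auto
    ultimately have "span {?e} = {v. ?H v = 0}" by (intro subspace_dim_equal) auto
    then obtain c where "h = c *\<^sub>R ?e" using \<open>?H h = 0\<close> by (auto simp: span_singleton)
    with h2 show "h = 0" by simp
  qed
  have "A u \<bullet> v = u \<bullet> A v" for u v
    unfolding A_def by (simp add: inner_add_left inner_add_right crit(5) inner_commute[of u])
  from sgn_det_eq_morse_index[OF lin this nz]
  show "sgn (det (matrix A)) = (-1) ^ morse_index (hessian \<psi> y)"
    unfolding A_def using morse_index_add_kernel[OF crit(4,5) He] by simp
qed

text \<open>The reduced map has the fixed critical points as its zeros, and its derivative there is the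
Hessian.\<close>

lemma generic_fixed_degree:
  assumes gen: "generic rep_V unit_ball \<psi> X"
  shows "mapping_degree (reduced_map fixed_coords (grad \<psi>)) unit_ball =
    (\<Sum>x | x \<in> X \<and> is_fixed x. (-1) ^ morse_index (hessian \<psi> x))"
proof -
  obtain N where N: "admissible_on rep_V unit_ball N \<psi>" using gen by (auto simp: generic_def)
  have crit: "{x\<in>unit_ball. grad \<psi> x = 0} = (\<Union>x\<in>X. orbit circle_group rep_V x)"
    using gen by (simp add: generic_def)
  have "{x \<in> unit_ball. reduced_map fixed_coords (grad \<psi>) x = 0} = {x \<in> {x\<in>unit_ball. grad \<psi> x = 0}. is_fixed x}"
    using reduced_grad_zeros[OF N, of fixed_coords] by (simp add: proj_coords_eq_self_iff)
  also have "\<dots> = {x \<in> X. is_fixed x}"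
  proof -
    have "y \<in> X" if "x \<in> X" "y \<in> orbit circle_group rep_V x" "is_fixed y" for x y
    proof -
      have "is_fixed x" using that(2,3) by (auto simp: orbit_rep_V is_fixed_rep_V simp del: mem_sphere_0)
      with that show ?thesis by (simp add: orbit_fixed)
    qed
    then show ?thesis unfolding crit using mem_orbit_self by blast
  qed
  finally have zeros: "{x \<in> unit_ball. reduced_map fixed_coords (grad \<psi>) x = 0} = {x \<in> X. is_fixed x}" .
  have "mapping_degree (reduced_map fixed_coords (grad \<psi>)) unit_ball =
      (\<Sum>x | x \<in> unit_ball \<and> reduced_map fixed_coords (grad \<psi>) x = 0. (-1) ^ morse_index (hessian \<psi> x))"
  proof (rule mapping_degree_eq_sum(2)[OF degree_defined_reduced_grad[OF N]])
    show "fixed_coords \<in> {fixed_coords, slice_coords}" by simp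
    fix x assume "x \<in> unit_ball" "reduced_map fixed_coords (grad \<psi>) x = 0"
    then have x: "x \<in> X" "is_fixed x" using zeros by blast+
    show "\<exists>f'. (reduced_map fixed_coords (grad \<psi>) has_derivative f') (at x) \<and> det (matrix f') \<noteq> 0 \<and>
        sgn (det (matrix f')) = (-1) ^ morse_index (hessian \<psi> x)"
      using reduced_grad_regular_fixed[OF gen x] generic_det_hessian_fixed[OF gen x] by blast
  qed
  then show ?thesis unfolding zeros .
qed

text \<open>The hyperplane contains all fixed critical points and two points of every free critical orbit.
At both points the sign is the same, because the Hessians are conjugate.\<close>

lemma generic_slice_degree:
  assumes gen: "generic rep_V unit_ball \<psi> X"
  shows "mapping_degree (reduced_map slice_coords (grad \<psi>)) unit_ball =
    (\<Sum>x | x \<in> X \<and> is_fixed x. (-1) ^ morse_index (hessian \<psi> x)) +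
    2 * (\<Sum>x | x \<in> X \<and> \<not> is_fixed x. (-1) ^ morse_index (hessian \<psi> x))"
proof -
  obtain N where N: "admissible_on rep_V unit_ball N \<psi>" using gen by (auto simp: generic_def)
  have fin: "finite X" and inj: "inj_on (orbit circle_group rep_V) X"
    and crit: "{x\<in>unit_ball. grad \<psi> x = 0} = (\<Union>x\<in>X. orbit circle_group rep_V x)"
    using gen by (simp_all add: generic_def)
  define Z where "Z x = {y \<in> orbit circle_group rep_V x. y$2 = 0}" for x
  define \<sigma> :: "real^4 \<Rightarrow> real" where "\<sigma> y = (-1) ^ morse_index (hessian \<psi> y)" for y
  have "{x \<in> unit_ball. reduced_map slice_coords (grad \<psi>) x = 0} = {x \<in> {x\<in>unit_ball. grad \<psi> x = 0}. x$2 = 0}"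
    using reduced_grad_zeros[OF N, of slice_coords] by (simp add: proj_coords_eq_self_iff)
  also have "\<dots> = (\<Union>x\<in>X. Z x)" unfolding crit Z_def by blast
  finally have zeros: "{x \<in> unit_ball. reduced_map slice_coords (grad \<psi>) x = 0} = (\<Union>x\<in>X. Z x)" .
  have Z: "finite (Z x)" "card (Z x) = (if is_fixed x then 1 else 2)" for x
  proof -
    show card: "card (Z x) = (if is_fixed x then 1 else 2)"
    proof (cases "is_fixed x")
      case True
      then have "Z x = {x}" by (auto simp: Z_def orbit_fixed is_fixed_def)
      with True show ?thesis by simp
    qed (simp add: Z_def orbit_meets_slice)
    show "finite (Z x)" by (rule card_ge_0_finite) (simp add: card)
  qed
  have "mapping_degree (reduced_map slice_coords (grad \<psi>)) unit_ball =
      (\<Sum>x | x \<in> unit_ball \<and> reduced_map slice_coords (grad \<psi>) x = 0. \<sigma> x)"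
  proof (rule mapping_degree_eq_sum(2)[OF degree_defined_reduced_grad[OF N]])
    show "slice_coords \<in> {fixed_coords, slice_coords}" by simp
    fix y assume "y \<in> unit_ball" "reduced_map slice_coords (grad \<psi>) y = 0"
    then obtain x where x: "x \<in> X" and y: "y \<in> orbit circle_group rep_V x" "y$2 = 0"
      using zeros unfolding Z_def by blast
    show "\<exists>f'. (reduced_map slice_coords (grad \<psi>) has_derivative f') (at y) \<and> det (matrix f') \<noteq> 0 \<and>
        sgn (det (matrix f')) = \<sigma> y"
    proof (cases "is_fixed x")
      case True
      then have "y = x" using y(1) by (simp add: orbit_fixed)
      then show ?thesis
        unfolding \<sigma>_def
        using reduced_grad_regular_fixed[OF gen x True] generic_det_hessian_fixed[OF gen x True] by blast
    next
      case False
      show ?thesis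
        unfolding \<sigma>_def using reduced_grad_regular_free[OF gen x False y] by blast
    qed
  qed
  also have "\<dots> = (\<Sum>x\<in>X. \<Sum>y\<in>Z x. \<sigma> y)"
    unfolding zeros
  proof (rule sum.UNION_disjoint[OF fin])
    show "\<forall>x\<in>X. \<forall>y\<in>X. x \<noteq> y \<longrightarrow> Z x \<inter> Z y = {}"
    proof (intro ballI impI)
      fix x x' assume "x \<in> X" "x' \<in> X" "x \<noteq> x'"
      then have "orbit circle_group rep_V x \<noteq> orbit circle_group rep_V x'" using inj by (auto dest: inj_onD)
      then have "y \<notin> Z x'" if "y \<in> Z x" for y using orbit_eq[of y x] orbit_eq[of y x'] that by (auto simp: Z_def)
      then show "Z x \<inter> Z x' = {}" by blast
    qed
  qed (use Z(1) in auto)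
  also have "\<dots> = (\<Sum>x\<in>X. real (card (Z x)) * \<sigma> x)"
  proof (rule sum.cong[OF refl])
    fix x assume "x \<in> X"
    then have "\<sigma> y = \<sigma> x" if "y \<in> Z x" for y
      using generic_morse_index_orbit(1)[OF gen] that by (simp add: \<sigma>_def Z_def)
    then show "(\<Sum>y\<in>Z x. \<sigma> y) = real (card (Z x)) * \<sigma> x" by simp
  qed
  also have "\<dots> = (\<Sum>x\<in>X. if is_fixed x then \<sigma> x else 2 * \<sigma> x)"
    by (intro sum.cong) (auto simp: Z(2))
  also have "\<dots> = (\<Sum>x | x \<in> X \<and> is_fixed x. \<sigma> x) + (\<Sum>x | x \<in> X \<and> \<not> is_fixed x. 2 * \<sigma> x)"
    using fin by (simp add: sum.If_cases Int_def)
  finally show ?thesis by (simp add: \<sigma>_def sum_distrib_left)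
qed

definition generic_degree :: "(real^4 \<Rightarrow> real) \<Rightarrow> (real^4) set \<Rightarrow> euler_ring"
  where "generic_degree \<psi> X =
    (\<Sum>x\<in>X. frag_cmul ((-1) ^ morse_index (hessian \<psi> x)) (euler_char (isotropy rep_V x)))"

lemma sum_frag_cmul_const:
  "(\<Sum>x\<in>A. frag_cmul (k x) c) = frag_cmul (\<Sum>x\<in>A. k x) c"
  by (induction A rule: infinite_finite_induct) (simp_all add: frag_cmul_distrib)

lemma generic_degree_eq:
  assumes gen: "generic rep_V unit_ball \<psi> X"
  shows "generic_degree \<psi> X =
    frag_cmul (\<Sum>x | x \<in> X \<and> is_fixed x. (-1) ^ morse_index (hessian \<psi> x)) (euler_char full_circle) +
    frag_cmul (\<Sum>x | x \<in> X \<and> \<not> is_fixed x. (-1) ^ morse_index (hessian \<psi> x)) (euler_char (cyclic_subgroup 1))"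
proof -
  have fin: "finite X" using gen by (simp add: generic_def)
  have "generic_degree \<psi> X = (\<Sum>x\<in>X. if is_fixed x
      then frag_cmul ((-1) ^ morse_index (hessian \<psi> x)) (euler_char full_circle)
      else frag_cmul ((-1) ^ morse_index (hessian \<psi> x)) (euler_char (cyclic_subgroup 1)))"
    unfolding generic_degree_def
    by (intro sum.cong refl) (auto simp: isotropy_fixed isotropy_not_fixed simp del: One_nat_def)
  also have "\<dots> = (\<Sum>x | x \<in> X \<and> is_fixed x. frag_cmul ((-1) ^ morse_index (hessian \<psi> x)) (euler_char full_circle)) +
      (\<Sum>x | x \<in> X \<and> \<not> is_fixed x. frag_cmul ((-1) ^ morse_index (hessian \<psi> x)) (euler_char (cyclic_subgroup 1)))"
    using fin by (simp add: sum.If_cases Int_def)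
  finally show ?thesis by (simp only: sum_frag_cmul_const)
qed

text \<open>The sums \<open>a\<close> and \<open>b\<close> of signs over fixed points and free orbits are determined by the degrees of
the two reduced maps, which are \<open>a\<close> and \<open>a + 2 * b\<close> and invariant under gradient homotopies.\<close>

lemma generic_degree_unique:
  assumes hom: "gradient_homotopic rep_V unit_ball \<phi> \<psi>" "gradient_homotopic rep_V unit_ball \<phi> \<psi>'"
    and gen: "generic rep_V unit_ball \<psi> X" "generic rep_V unit_ball \<psi>' X'"
  shows "generic_degree \<psi> X = generic_degree \<psi>' X'"
proof -
  define a where "a \<psi> X = (\<Sum>x | x \<in> X \<and> is_fixed x. (-1 :: int) ^ morse_index (hessian \<psi> x))" for \<psi> X
  define b where "b \<psi> X = (\<Sum>x | x \<in> X \<and> \<not> is_fixed x. (-1 :: int) ^ morse_index (hessian \<psi> x))" for \<psi> X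
  have a: "real_of_int (a \<psi> X) = mapping_degree (reduced_map fixed_coords (grad \<psi>)) unit_ball"
    if "generic rep_V unit_ball \<psi> X" for \<psi> X
    using generic_fixed_degree[OF that] by (simp add: a_def)
  have b: "real_of_int (a \<psi> X) + 2 * real_of_int (b \<psi> X) = mapping_degree (reduced_map slice_coords (grad \<psi>)) unit_ball"
    if "generic rep_V unit_ball \<psi> X" for \<psi> X
    using generic_slice_degree[OF that] by (simp add: a_def b_def)
  have "real_of_int (a \<psi> X) = real_of_int (a \<psi>' X')"
    using a[OF gen(1)] a[OF gen(2)] reduced_degree_homotopy[OF hom(1), of fixed_coords]
      reduced_degree_homotopy[OF hom(2), of fixed_coords] by simp
  moreover have "real_of_int (a \<psi> X) + 2 * real_of_int (b \<psi> X) = real_of_int (a \<psi>' X') + 2 * real_of_int (b \<psi>' X')"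
    using b[OF gen(1)] b[OF gen(2)] reduced_degree_homotopy[OF hom(1), of slice_coords]
      reduced_degree_homotopy[OF hom(2), of slice_coords] by simp
  ultimately have "a \<psi> X = a \<psi>' X'" "b \<psi> X = b \<psi>' X'" by linarith+
  then show ?thesis
    using generic_degree_eq[OF gen(1)] generic_degree_eq[OF gen(2)] by (simp only: a_def b_def)
qed

lemma gradient_degree_eqI:
  assumes hom: "gradient_homotopic rep_V unit_ball \<phi> \<psi>" and gen: "generic rep_V unit_ball \<psi> X"
  shows "gradient_degree rep_V \<phi> unit_ball = generic_degree \<psi> X"
  unfolding gradient_degree_def generic_degree_def[symmetric]
proof (rule the_equality)
  show "\<exists>\<psi>' X'. gradient_homotopic rep_V unit_ball \<phi> \<psi>' \<and> generic rep_V unit_ball \<psi>' X' \<and>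
      generic_degree \<psi> X = generic_degree \<psi>' X'"
    using hom gen by blast
  show "d = generic_degree \<psi> X"
    if "\<exists>\<psi> X. gradient_homotopic rep_V unit_ball \<phi> \<psi> \<and> generic rep_V unit_ball \<psi> X \<and> d = generic_degree \<psi> X" for d
    using that generic_degree_unique[OF _ hom _ gen] by blast
qed

section \<open>A generic potential near the given one\<close>

lemma invariant_pot: "invariant_fun rep_V UNIV (pot c)"
proof -
  have "pot c (rep_V z x) = pot c x" if "z \<in> sphere 0 1" for z x
  proof -
    have "(rep_V z x $ 1)\<^sup>2 + (rep_V z x $ 2)\<^sup>2 = ((Re z)\<^sup>2 + (Im z)\<^sup>2) * ((x$1)\<^sup>2 + (x$2)\<^sup>2)"
      by (simp add: rep_V_nth power2_eq_square algebra_simps)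
    also have "(Re z)\<^sup>2 + (Im z)\<^sup>2 = 1" using that by (simp flip: cmod_power2)
    finally show ?thesis by (simp add: pot_U_def rep_V_nth(3,4))
  qed
  then show ?thesis by (simp add: invariant_fun_def)
qed

lemma admissible_pot:
  assumes "0 \<le> c" "c < 1"
  shows "admissible_on rep_V unit_ball UNIV (pot c)"
proof -
  have "pgrad c x \<noteq> 0" if x: "norm x = 1" for x
  proof
    assume "pgrad c x = 0"
    then consider "x$4 = 0" "x$3 = 0" "(x$1)\<^sup>2 + (x$2)\<^sup>2 = c" | "x$4 = x$3" "x$1 = 0" "x$2 = 0" "(x$3)\<^sup>2 = - c"
      by (auto simp: pgrad_eq_0_iff)
    then show False
    proof cases
      case 1 with x assms(2) show False by (simp add: norm_eq_1_iff_4)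
    next
      case 2
      then have "(x$3)\<^sup>2 = 0" using assms(1) zero_le_power2[of "x$3"] by linarith
      with 2 x show False by (simp add: norm_eq_1_iff_4)
    qed
  qed
  moreover have "invariant_set rep_V unit_ball" by (auto simp: invariant_set_def norm_rep_V simp del: mem_sphere_0)
  ultimately show ?thesis
    by (simp add: admissible_on_def orthogonal_rep_V invariant_pot C1_on_real_polynomial real_polynomial_pot
        grad_pot invariant_set_def)
qed

lemma pot_homotopic:
  assumes "0 \<le> c" "c < 1"
  shows "gradient_homotopic rep_V unit_ball (\<lambda>x. - pot_U x) (pot c)"
proof -
  define h where "h = (\<lambda>t. pot (t * c))"
  have "admissible_on rep_V unit_ball UNIV (h t)" if "t \<in> {0..1}" for t
  proof -
    have "t * c \<le> 1 * c" using that assms(1) by (intro mult_right_mono) auto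
    then show ?thesis unfolding h_def using that assms by (intro admissible_pot) auto
  qed
  moreover have "continuous_on ({0..1} \<times> UNIV) (\<lambda>(t, x). h t x)"
    unfolding h_def pot_U_def split_beta by (intro continuous_intros)
  moreover have "continuous_on ({0..1} \<times> UNIV) (\<lambda>(t, x). grad (h t) x)"
    unfolding h_def grad_pot split_beta
  proof (rule continuous_on_vecI)
    show "continuous_on ({0..1} \<times> UNIV) (\<lambda>p. pgrad (fst p * c) (snd p) $ i)" for i
      using exhaust_4[of i] by (elim disjE) (auto simp: pgrad_nth intro!: continuous_intros)
  qed
  ultimately show ?thesis
    unfolding gradient_homotopic_def by (intro exI[of _ UNIV] exI[of _ h]) (auto simp: h_def)
qed

text \<open>The critical orbit is the circle of radius \<open>a\<close>.  At \<open>p\<close> the Hessian, made invertible on its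
kernel, has determinant \<open>4 * a\<^sup>2 > 0\<close>, so that the Morse index is even.\<close>

lemma generic_pot:
  assumes a: "0 < a" "a < 1"
  defines "p \<equiv> vector [a, 0, 0, 0] :: real^4"
  shows "generic rep_V unit_ball (pot (a\<^sup>2)) {p}" and "even (morse_index (hessian (pot (a\<^sup>2)) p))"
proof -
  let ?H = "hessian (pot (a\<^sup>2)) p"
  have p: "p$1 = a" "p$2 = 0" "p$3 = 0" "p$4 = 0" by (simp_all add: p_def vector_4)
  have nf: "\<not> is_fixed p" using a by (simp add: is_fixed_def p)
  have zeros: "{x \<in> unit_ball. grad (pot (a\<^sup>2)) x = 0} = orbit circle_group rep_V p"
  proof (rule Set.set_eqI, rule iffI)
    fix x assume "x \<in> {x \<in> unit_ball. grad (pot (a\<^sup>2)) x = 0}"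
    then have "pgrad (a\<^sup>2) x = 0" by (simp add: grad_pot)
    moreover have "(x$3)\<^sup>2 \<noteq> - a\<^sup>2"
      using a(1) zero_le_power2[of "x$3"] zero_less_power[of a 2] by linarith
    ultimately have x: "x$4 = 0" "x$3 = 0" "(x$1)\<^sup>2 + (x$2)\<^sup>2 = a\<^sup>2" by (auto simp: pgrad_eq_0_iff)
    define z where "z = Complex (x$1 / a) (x$2 / a)"
    have "(Re z)\<^sup>2 + (Im z)\<^sup>2 = ((x$1)\<^sup>2 + (x$2)\<^sup>2) / a\<^sup>2"
      by (simp add: z_def power_divide add_divide_distrib)
    also have "\<dots> = 1" unfolding x(3) using a(1) by simp
    finally have "z \<in> sphere 0 1" by (simp add: cmod_def)
    moreover have "x = rep_V z p" using a(1) x by (simp add: vec_eq_4_iff rep_V_nth p z_def)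
    ultimately show "x \<in> orbit circle_group rep_V p" unfolding orbit_rep_V by blast
  next
    fix x assume "x \<in> orbit circle_group rep_V p"
    then obtain z where z: "z \<in> sphere 0 1" "x = rep_V z p" by (auto simp: orbit_rep_V)
    have "a\<^sup>2 < 1" using a by (simp add: power_less_one_iff abs_square_less_1)
    then have "norm p < 1" by (simp add: norm_less_1_iff_4 p)
    then have "norm x < 1" using norm_rep_V[OF z(1)] z(2) by simp
    moreover have "(x$1)\<^sup>2 + (x$2)\<^sup>2 = ((Re z)\<^sup>2 + (Im z)\<^sup>2) * a\<^sup>2"
      by (simp add: z(2) rep_V_nth p power2_eq_square algebra_simps)
    moreover have "(Re z)\<^sup>2 + (Im z)\<^sup>2 = 1" using z(1) by (simp flip: cmod_power2)
    ultimately show "x \<in> {x \<in> unit_ball. grad (pot (a\<^sup>2)) x = 0}"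
      by (simp add: grad_pot pgrad_eq_0_iff z(2) rep_V_nth p)
  qed
  have H: "?H h = 0 \<longleftrightarrow> h$1 = 0 \<and> h$3 = 0 \<and> h$4 = 0" for h
    using a by (auto simp: hessian_pot vec_eq_4_iff pgrad_jac_mult p)
  have ker: "{h. ?H h = 0} = span {axis 2 1}"
  proof (rule Set.set_eqI, rule iffI)
    fix h assume "h \<in> {h. ?H h = 0}"
    then have "h = h$2 *\<^sub>R axis 2 1" by (simp add: H vec_eq_4_iff[of h] axis_def)
    then show "h \<in> span {axis 2 1}" by (metis rangeI span_singleton)
  next
    fix h assume "h \<in> span {axis 2 1 :: real^4}"
    then obtain k where "h = k *\<^sub>R axis 2 1" by (auto simp: span_singleton)
    then show "h \<in> {h. ?H h = 0}" by (simp add: H axis_def)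
  qed
  have dim: "dim {h. ?H h = 0} = 1" unfolding ker by (simp add: dim_singleton axis_eq_0_iff)
  show gen: "generic rep_V unit_ball (pot (a\<^sup>2)) {p}"
    unfolding generic_def
  proof (intro conjI ballI)
    have "a\<^sup>2 < 1" using a by (simp add: abs_square_less_1)
    then show "\<exists>N. admissible_on rep_V unit_ball N (pot (a\<^sup>2))"
      by (intro exI[of _ UNIV] admissible_pot) simp_all
    show "{x \<in> unit_ball. grad (pot (a\<^sup>2)) x = 0} = (\<Union>x\<in>{p}. orbit circle_group rep_V x)"
      using zeros by simp
    fix x assume "x \<in> {p}"
    then have x: "x = p" by simp
    show "\<exists>W. open W \<and> orbit circle_group rep_V x \<subseteq> W \<and> C2_on W (pot (a\<^sup>2))"
      by (intro exI[of _ UNIV]) (simp add: C2_on_real_polynomial real_polynomial_pot)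
    show "dim {v. hessian (pot (a\<^sup>2)) x v = 0} = orbit_dim rep_V x"
      unfolding x dim orbit_dim_rep_V using nf by simp
    have "v = 0" if "v \<in> orthogonal_comp UNIV" for v :: "real^4"
      using that by (auto simp: orthogonal_comp_def orthogonal_def dest: spec[of _ v])
    then show "\<exists>\<epsilon>>0. \<forall>y v. y \<in> fixed_space rep_V (isotropy rep_V x) \<and>
        infdist y (orbit circle_group rep_V x) < \<epsilon> \<and>
        v \<in> orthogonal_comp (fixed_space rep_V (isotropy rep_V x)) \<and> norm v < \<epsilon> \<longrightarrow>
        grad (pot (a\<^sup>2)) (y + v) = grad (pot (a\<^sup>2)) y + v"
      unfolding x isotropy_not_fixed[OF nf] fixed_space_trivial
      by (intro exI[of _ 1]) (auto simp del: One_nat_def)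
  qed simp_all
  let ?A = "\<lambda>h. ?H h + (axis 2 1 \<bullet> h) *\<^sub>R axis 2 1"
  have "matrix ?A $ i $ j = (pgrad_jac p *v axis j 1) $ i + (if i = 2 \<and> j = 2 then 1 else 0)" for i j
  proof -
    have "(axis 2 1 :: real^4) \<bullet> axis j 1 = (if j = 2 then 1 else 0)" by (simp add: inner_axis_axis)
    moreover have "(axis 2 1 :: real^4) $ i = (if i = 2 then 1 else 0)" by (simp add: axis_def)
    ultimately show ?thesis by (simp add: matrix_def hessian_pot)
  qed
  then have "det (matrix ?A) = 4 * a\<^sup>2"
    unfolding det_4 by (simp add: pgrad_jac_mult p axis_def power2_eq_square)
  then have "(-1 :: real) ^ morse_index ?H = 1"
    using reduced_grad_regular_free(3)[OF gen _ nf mem_orbit_self p(2)] a(1) by simp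
  then show "even (morse_index ?H)" by (metis neg_one_odd_power one_neq_neg_one)
qed

lemma gradient_degree_pot_U:
  "gradient_degree rep_V (\<lambda>x. - pot_U x) unit_ball = euler_char (cyclic_subgroup 1)"
proof -
  \<comment> \<open>any radius strictly between 0 and 1 gives the same result\<close>
  let ?p = "vector [1/2, 0, 0, 0] :: real^4" and ?\<psi> = "pot ((1/2)\<^sup>2)"
  have gen: "generic rep_V unit_ball ?\<psi> {?p}" and even: "even (morse_index (hessian ?\<psi> ?p))"
    using generic_pot[of "1/2"] by simp_all
  have "gradient_degree rep_V (\<lambda>x. - pot_U x) unit_ball = generic_degree ?\<psi> {?p}"
    by (rule gradient_degree_eqI[OF pot_homotopic gen]) (auto simp: power2_eq_square)
  also have "\<dots> = euler_char (isotropy rep_V ?p)" using even by (simp add: generic_degree_def)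
  also have "isotropy rep_V ?p = cyclic_subgroup 1"
    by (rule isotropy_not_fixed) (simp add: is_fixed_def vector_4)
  finally show ?thesis .
qed

theorem lemma4p2:
  "{x. grad pot_U x = 0} = {0} \<and>
   spectrum (hessian pot_U 0) = {0, 2} \<and>
   brouwer_degree (\<lambda>x. - grad pot_U x) (ball 0 1) 0 = 0 \<and>
   gradient_degree rep_V (\<lambda>x. - pot_U x) (ball 0 1) = euler_char (cyclic_subgroup 1) \<and>
   euler_char (cyclic_subgroup 1) \<noteq> 0"
proof (intro conjI)
  show "{x. grad pot_U x = 0} = {0}" by (simp add: grad_pot_U pgrad_0_eq_0_iff)
qed (simp_all add: spectrum_hessian_pot_U brouwer_degree_pot_U gradient_degree_pot_U euler_char_def del: One_nat_def)

end
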